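(* Let $r\ge 1$, and let $\mathfrak{g}$ be a simple Lie algebra of type $C_n$ ($\mathfrak{sp}_{2n}$, $n\ge 1$) or $D_n$ ($\mathfrak{so}_{2n}$, $n\ge 3$) over $\mathbb{Q}$, with natural representation $\mathsf{E}$. Then the Schur algebra $\mathsf{S}(r)$ is the generalized Schur algebra $S(\pi)$ determined by the saturated set $\pi=\Pi^+(\mathsf{E}^{\otimes r})$; that is, the kernel of the representation $\mathfrak{U}(\mathfrak{g})\to\operatorname{End}(\mathsf{E}^{\otimes r})$ equals the ideal $\mathcal{I}$ of $\mathfrak{U}(\mathfrak{g})$ consisting of all elements that annihilate every simple $\mathfrak{U}(\mathfrak{g})$-module of highest weight belonging to $\pi$.
   Context: Everything is over $\mathbb{Q}$. $\mathfrak{g}\subset\mathfrak{gl}_{2n}$ is the Lie algebra preserving the bilinear form on $\mathsf{E}=\mathbb{Q}^{2n}$ with block matrix $\begin{pmatrix} 0 & I \\ -I & 0 \end{pmatrix}$ in type $C_n$ and $\begin{pmatrix} 0 & I \\ I & 0 \end{pmatrix}$ in type $D_n$. The diagonal Cartan subalgebra $\mathfrak{h}$ has basis $H_i=e_{i,i}-e_{n+i,n+i}$ with dual basis $\varepsilon_i$ of $\mathfrak{h}^*$. The simple roots are $\alpha_i=\varepsilon_i-\varepsilon_{i+1}$ for $i<n$, and $\alpha_n=2\varepsilon_n$ in type $C_n$, $\alpha_n=\varepsilon_{n-1}+\varepsilon_n$ in type $D_n$. The dominance order on integral weights is: $\lambda\le\mu$ iff $\mu-\lambda\in\sum\mathbb{N}\alpha_i$.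 A set $\pi$ of dominant weights is saturated if $\lambda\in\pi$, $\mu$ dominant, $\mu\le\lambda$ imply $\mu\in\pi$. $\Pi^+(\mathsf{E}^{\otimes r})$ denotes the set of all dominant weights occurring as weights of $\mathsf{E}^{\otimes r}$ (not only those which are highest weights of composition factors); it is saturated. The generalized Schur algebra of a finite saturated set $\pi$ is $S(\pi)=\mathfrak{U}(\mathfrak{g})/\mathcal{I}$ with $\mathcal{I}$ as in the claim. The Schur algebra $\mathsf{S}(r)$ is the image of $\mathfrak{U}(\mathfrak{g})\to\operatorname{End}(\mathsf{E}^{\otimes r})$. *)

theory Defs
  imports
    "Jordan_Normal_Form.Matrix"
    "HOL-Algebra.QuotRing"
begin

section \<open>Simple modules over a ring that need not be commutative\<close>

text \<open>The locale \<^locale>\<open>module\<close> requires a commutative ring of scalars; this is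
  the same list of axioms without commutativity.\<close>

locale left_module = R?: ring R + M?: abelian_group M
  for R (structure) and M :: "('a, 'v) module" (structure) +
  assumes smult_closed [simp, intro]:
      "\<lbrakk> a \<in> carrier R; x \<in> carrier M \<rbrakk> \<Longrightarrow> a \<odot>\<^bsub>M\<^esub> x \<in> carrier M"
    and smult_l_distr:
      "\<lbrakk> a \<in> carrier R; b \<in> carrier R; x \<in> carrier M \<rbrakk> \<Longrightarrow>
        (a \<oplus> b) \<odot>\<^bsub>M\<^esub> x = a \<odot>\<^bsub>M\<^esub> x \<oplus>\<^bsub>M\<^esub> b \<odot>\<^bsub>M\<^esub> x"
    and smult_r_distr:
      "\<lbrakk> a \<in> carrier R; x \<in> carrier M; y \<in> carrier M \<rbrakk> \<Longrightarrow>
        a \<odot>\<^bsub>M\<^esub> (x \<oplus>\<^bsub>M\<^esub> y) = a \<odot>\<^bsub>M\<^esub> x \<oplus>\<^bsub>M\<^esub> a \<odot>\<^bsub>M\<^esub> y"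
    and smult_assoc1:
      "\<lbrakk> a \<in> carrier R; b \<in> carrier R; x \<in> carrier M \<rbrakk> \<Longrightarrow>
        (a \<otimes> b) \<odot>\<^bsub>M\<^esub> x = a \<odot>\<^bsub>M\<^esub> (b \<odot>\<^bsub>M\<^esub> x)"
    and smult_one [simp]:
      "x \<in> carrier M \<Longrightarrow> \<one> \<odot>\<^bsub>M\<^esub> x = x"

definition simple_module :: "('a, 'm) ring_scheme \<Rightarrow> ('a, 'v) module \<Rightarrow> bool" where
  "simple_module R M \<longleftrightarrow>
     left_module R M \<and> carrier M \<noteq> {\<zero>\<^bsub>M\<^esub>} \<and>
     (\<forall>N. submodule N R M \<longrightarrow> N = {\<zero>\<^bsub>M\<^esub>} \<or> N = carrier M)"

definition annihilates :: "'a \<Rightarrow> ('a, 'v) module \<Rightarrow> bool" where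
  "annihilates u M \<longleftrightarrow> (\<forall>v \<in> carrier M. u \<odot>\<^bsub>M\<^esub> v = \<zero>\<^bsub>M\<^esub>)"


section \<open>Universal enveloping algebras of Lie algebras of rational matrices\<close>

text \<open>The free associative unital algebra over the rationals on a set \<open>A\<close>: finitely
  supported functions on the words over \<open>A\<close>, multiplied by convolution with respect to
  concatenation. An associative algebra is stored in the record type \<^typ>\<open>(rat, 'b) module\<close>,
  which has both a multiplication and scalars.\<close>

definition free_algebra :: "'a set \<Rightarrow> (rat, 'a list \<Rightarrow> rat) module" where
  "free_algebra A =
     \<lparr> carrier = {p. finite {w. p w \<noteq> 0} \<and> {w. p w \<noteq> 0} \<subseteq> lists A},
       mult = (\<lambda>p q w. \<Sum>k\<le>length w. p (take k w) * q (drop k w)),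
       one = (\<lambda>w. if w = [] then 1 else 0),
       zero = (\<lambda>w. 0),
       add = (\<lambda>p q w. p w + q w),
       smult = (\<lambda>c p w. c * p w) \<rparr>"

lemma ring_free_algebra: "ring (free_algebra A)"
proof (rule ringI)
  let ?F = "free_algebra A"
  have supp_mult: "{w. (\<Sum>k\<le>length w. p (take k w) * q (drop k w)) \<noteq> 0}
      \<subseteq> (\<lambda>(u, v). u @ v) ` ({u. p u \<noteq> 0} \<times> {v. q v \<noteq> 0})" for p q :: "'a list \<Rightarrow> rat"
  proof
    fix w assume "w \<in> {w. (\<Sum>k\<le>length w. p (take k w) * q (drop k w)) \<noteq> 0}"
    then obtain k where "p (take k w) * q (drop k w) \<noteq> 0" by (force elim: sum.not_neutral_contains_not_neutral)
    then show "w \<in> (\<lambda>(u, v). u @ v) ` ({u. p u \<noteq> 0} \<times> {v. q v \<noteq> 0})"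
      by (intro image_eqI[of _ _ "(take k w, drop k w)"]) auto
  qed
  have uminus: "\<exists>q\<in>carrier ?F. q \<oplus>\<^bsub>?F\<^esub> p = \<zero>\<^bsub>?F\<^esub>" if "p \<in> carrier ?F" for p
    using that by (intro bexI[of _ "\<lambda>w. - p w"]) (auto simp: free_algebra_def)
  have supp_add: "{w. p w + q w \<noteq> 0} \<subseteq> {w. p w \<noteq> 0} \<union> {w. q w \<noteq> 0}" for p q :: "'a list \<Rightarrow> rat"
    by auto
  show "abelian_group ?F"
  proof (rule abelian_groupI)
    fix p q assume "p \<in> carrier ?F" "q \<in> carrier ?F"
    then show "p \<oplus>\<^bsub>?F\<^esub> q \<in> carrier ?F"
      using finite_subset[OF supp_add[of p q]] supp_add[of p q]
      by (auto simp: free_algebra_def)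
  next
    fix p assume "p \<in> carrier ?F"
    then show "\<exists>q\<in>carrier ?F. q \<oplus>\<^bsub>?F\<^esub> p = \<zero>\<^bsub>?F\<^esub>" by (rule uminus)
  qed (auto simp: free_algebra_def add_ac)
  show "Group.monoid ?F"
  proof (rule monoidI)
    fix p q assume "p \<in> carrier ?F" "q \<in> carrier ?F"
    then have f: "finite ((\<lambda>(u, v). u @ v) ` ({u. p u \<noteq> 0} \<times> {v. q v \<noteq> 0}))"
      and s: "(\<lambda>(u, v). u @ v) ` ({u. p u \<noteq> 0} \<times> {v. q v \<noteq> 0}) \<subseteq> lists A"
      by (auto simp: free_algebra_def subset_iff in_lists_conv_set)
    show "p \<otimes>\<^bsub>?F\<^esub> q \<in> carrier ?F"
      using finite_subset[OF supp_mult f] subset_trans[OF supp_mult s]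
      by (simp add: free_algebra_def)
  next
    show "\<one>\<^bsub>?F\<^esub> \<in> carrier ?F" by (auto simp: free_algebra_def)
  next
    fix p q s assume "p \<in> carrier ?F" "q \<in> carrier ?F" "s \<in> carrier ?F"
    show "p \<otimes>\<^bsub>?F\<^esub> q \<otimes>\<^bsub>?F\<^esub> s = p \<otimes>\<^bsub>?F\<^esub> (q \<otimes>\<^bsub>?F\<^esub> s)"
    proof
      fix w :: "'a list"
      let ?n = "length w"
      let ?T = "\<lambda>i j. p (take i w) * q (take (j - i) (drop i w)) * s (drop j w)"
      have "(p \<otimes>\<^bsub>?F\<^esub> q \<otimes>\<^bsub>?F\<^esub> s) w = (\<Sum>j\<le>?n. \<Sum>i\<le>j. ?T i j)"
        by (auto simp: free_algebra_def sum_distrib_right drop_take min_def intro!: sum.cong)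
      also have "\<dots> = (\<Sum>i\<le>?n. \<Sum>j\<in>{i..?n}. ?T i j)"
        by (subst (1 2) sum.Sigma) (auto intro!: sum.reindex_bij_witness[of _ "\<lambda>(i,j). (j,i)" "\<lambda>(i,j). (j,i)"])
      also have "\<dots> = (\<Sum>i\<le>?n. \<Sum>k\<le>?n - i. ?T i (i + k))"
      proof (rule sum.cong[OF refl])
        fix i assume "i \<in> {..?n}"
        then have "i \<le> ?n" by simp
        then show "(\<Sum>j\<in>{i..?n}. ?T i j) = (\<Sum>k\<le>?n - i. ?T i (i + k))"
          by (intro sum.reindex_bij_witness[of _ "\<lambda>k. i + k" "\<lambda>j. j - i"]) auto
      qed
      also have "\<dots> = (p \<otimes>\<^bsub>?F\<^esub> (q \<otimes>\<^bsub>?F\<^esub> s)) w"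
        by (auto simp: free_algebra_def sum_distrib_left mult.assoc add.commute intro!: sum.cong)
      finally show "(p \<otimes>\<^bsub>?F\<^esub> q \<otimes>\<^bsub>?F\<^esub> s) w = (p \<otimes>\<^bsub>?F\<^esub> (q \<otimes>\<^bsub>?F\<^esub> s)) w" .
    qed
  next
    fix p assume "p \<in> carrier ?F"
    show "\<one>\<^bsub>?F\<^esub> \<otimes>\<^bsub>?F\<^esub> p = p"
    proof
      fix w :: "'a list"
      have "(\<one>\<^bsub>?F\<^esub> \<otimes>\<^bsub>?F\<^esub> p) w = (\<Sum>k\<le>length w. (if take k w = [] then 1 else 0) * p (drop k w))"
        by (simp add: free_algebra_def)
      also have "\<dots> = (\<Sum>k\<le>length w. if k = 0 then p w else 0)"
        by (intro sum.cong) auto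
      finally show "(\<one>\<^bsub>?F\<^esub> \<otimes>\<^bsub>?F\<^esub> p) w = p w" by simp
    qed
    show "p \<otimes>\<^bsub>?F\<^esub> \<one>\<^bsub>?F\<^esub> = p"
    proof
      fix w :: "'a list"
      have "(p \<otimes>\<^bsub>?F\<^esub> \<one>\<^bsub>?F\<^esub>) w = (\<Sum>k\<le>length w. p (take k w) * (if drop k w = [] then 1 else 0))"
        by (simp add: free_algebra_def)
      also have "\<dots> = (\<Sum>k\<le>length w. if k = length w then p w else 0)"
        by (intro sum.cong) auto
      finally show "(p \<otimes>\<^bsub>?F\<^esub> \<one>\<^bsub>?F\<^esub>) w = p w" by simp
    qed
  qed
qed (auto simp: free_algebra_def sum.distrib algebra_simps)

definition free_gen :: "'a \<Rightarrow> 'a list \<Rightarrow> rat" where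
  "free_gen a = (\<lambda>w. if w = [a] then 1 else 0)"

definition lie_bracket :: "rat mat \<Rightarrow> rat mat \<Rightarrow> rat mat" where
  "lie_bracket x y = x * y - y * x"

text \<open>The free algebra on the underlying set of \<open>L\<close> modulo the first two families of relations
  is the tensor algebra of the vector space \<open>L\<close>; the third family cuts out the enveloping
  algebra. Scalars of the free algebra are central multiples of \<open>\<one>\<close>, so ring ideals are
  algebra ideals.\<close>

definition uea_relations :: "rat mat set \<Rightarrow> (rat mat list \<Rightarrow> rat) set" where
  "uea_relations L = (let F = free_algebra L in
       {free_gen (x + y) \<ominus>\<^bsub>F\<^esub> (free_gen x \<oplus>\<^bsub>F\<^esub> free_gen y) | x y. x \<in> L \<and> y \<in> L}
     \<union> {free_gen (c \<cdot>\<^sub>m x) \<ominus>\<^bsub>F\<^esub> (c \<odot>\<^bsub>F\<^esub> free_gen x) | c x. x \<in> L}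
     \<union> {free_gen (lie_bracket x y)
          \<ominus>\<^bsub>F\<^esub> (free_gen x \<otimes>\<^bsub>F\<^esub> free_gen y \<ominus>\<^bsub>F\<^esub> free_gen y \<otimes>\<^bsub>F\<^esub> free_gen x)
        | x y. x \<in> L \<and> y \<in> L})"

definition uea_ideal :: "rat mat set \<Rightarrow> (rat mat list \<Rightarrow> rat) set" where
  "uea_ideal L = genideal (free_algebra L) (uea_relations L)"

definition uea :: "rat mat set \<Rightarrow> (rat mat list \<Rightarrow> rat) set ring" where
  "uea L = free_algebra L Quot uea_ideal L"

definition uea_gen :: "rat mat set \<Rightarrow> rat mat \<Rightarrow> (rat mat list \<Rightarrow> rat) set" where
  "uea_gen L x = uea_ideal L +>\<^bsub>free_algebra L\<^esub> free_gen x"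

definition uea_scalar :: "rat mat set \<Rightarrow> rat \<Rightarrow> (rat mat list \<Rightarrow> rat) set" where
  "uea_scalar L c =
     uea_ideal L +>\<^bsub>free_algebra L\<^esub> (c \<odot>\<^bsub>free_algebra L\<^esub> \<one>\<^bsub>free_algebra L\<^esub>)"

lemma uea_relations_carrier: "uea_relations L \<subseteq> carrier (free_algebra L)"
  if "\<And>x y. x \<in> L \<Longrightarrow> y \<in> L \<Longrightarrow> x + y \<in> L \<and> lie_bracket x y \<in> L" "\<And>c x. x \<in> L \<Longrightarrow> c \<cdot>\<^sub>m x \<in> L"
proof -
  interpret ring "free_algebra L" by (rule ring_free_algebra)
  have g: "free_gen x \<in> carrier (free_algebra L)" if "x \<in> L" for x
    using that by (auto simp: free_algebra_def free_gen_def)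
  have s: "c \<odot>\<^bsub>free_algebra L\<^esub> p \<in> carrier (free_algebra L)" if "p \<in> carrier (free_algebra L)" for c p
    using that by (auto simp: free_algebra_def)
  show ?thesis using that by (auto simp: uea_relations_def Let_def intro!: g s)
qed

lemma ring_uea: "ring (uea L)"
  if "\<And>x y. x \<in> L \<Longrightarrow> y \<in> L \<Longrightarrow> x + y \<in> L \<and> lie_bracket x y \<in> L" "\<And>c x. x \<in> L \<Longrightarrow> c \<cdot>\<^sub>m x \<in> L"
  unfolding uea_def uea_ideal_def
  by (rule ideal.quotient_is_ring[OF ring.genideal_ideal[OF ring_free_algebra uea_relations_carrier]])
    (use that in auto)


section \<open>Representations of enveloping algebras\<close>

text \<open>Linear maps are made extensional on \<^term>\<open>carrier V\<close>, so that equality in this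
  algebra is equality of maps on \<open>V\<close>.\<close>

definition End_alg :: "(rat, 'v) module \<Rightarrow> (rat, 'v \<Rightarrow> 'v) module" where
  "End_alg V =
     \<lparr> carrier = {f \<in> carrier V \<rightarrow>\<^sub>E carrier V.
         (\<forall>u \<in> carrier V. \<forall>v \<in> carrier V. f (u \<oplus>\<^bsub>V\<^esub> v) = f u \<oplus>\<^bsub>V\<^esub> f v) \<and>
         (\<forall>c. \<forall>v \<in> carrier V. f (c \<odot>\<^bsub>V\<^esub> v) = c \<odot>\<^bsub>V\<^esub> f v)},
       mult = (\<lambda>f g. compose (carrier V) f g),
       one = (\<lambda>v \<in> carrier V. v),
       zero = (\<lambda>v \<in> carrier V. \<zero>\<^bsub>V\<^esub>),
       add = (\<lambda>f g. \<lambda>v \<in> carrier V. f v \<oplus>\<^bsub>V\<^esub> g v),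
       smult = (\<lambda>c f. \<lambda>v \<in> carrier V. c \<odot>\<^bsub>V\<^esub> f v) \<rparr>"

definition free_eval :: "(rat, 'b) module \<Rightarrow> ('a \<Rightarrow> 'b) \<Rightarrow> ('a list \<Rightarrow> rat) \<Rightarrow> 'b" where
  "free_eval A \<rho> p =
     (\<Oplus>\<^bsub>A\<^esub>w \<in> {w. p w \<noteq> 0}. p w \<odot>\<^bsub>A\<^esub> foldr (\<lambda>x b. \<rho> x \<otimes>\<^bsub>A\<^esub> b) w \<one>\<^bsub>A\<^esub>)"

text \<open>The extension of a Lie algebra representation \<open>\<rho>\<close> to the enveloping algebra: elements of
  the latter are cosets, and the extension to the free algebra is constant on each of them.\<close>

definition uea_eval :: "(rat, 'b) module \<Rightarrow> (rat mat \<Rightarrow> 'b) \<Rightarrow> (rat mat list \<Rightarrow> rat) set \<Rightarrow> 'b" where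
  "uea_eval A \<rho> u = the_elem (free_eval A \<rho> ` u)"


section \<open>The Lie algebras of types C and D\<close>

datatype lie_type = TypeC | TypeD

definition form_mat :: "lie_type \<Rightarrow> nat \<Rightarrow> rat mat" where
  "form_mat t n =
     four_block_mat (0\<^sub>m n n) (1\<^sub>m n)
       (case t of TypeC \<Rightarrow> - 1\<^sub>m n | TypeD \<Rightarrow> 1\<^sub>m n) (0\<^sub>m n n)"

definition bil_form :: "lie_type \<Rightarrow> nat \<Rightarrow> rat vec \<Rightarrow> rat vec \<Rightarrow> rat" where
  "bil_form t n v w = v \<bullet> (form_mat t n *\<^sub>v w)"

definition lie_alg :: "lie_type \<Rightarrow> nat \<Rightarrow> rat mat set" where
  "lie_alg t n = {x \<in> carrier_mat (2 * n) (2 * n).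
     \<forall>v \<in> carrier_vec (2 * n). \<forall>w \<in> carrier_vec (2 * n).
       bil_form t n (x *\<^sub>v v) w + bil_form t n v (x *\<^sub>v w) = 0}"

lemma lie_alg_closed:
  assumes "x \<in> lie_alg t n" "y \<in> lie_alg t n"
  shows "x + y \<in> lie_alg t n" "c \<cdot>\<^sub>m x \<in> lie_alg t n" "lie_bracket x y \<in> lie_alg t n"
proof -
  let ?B = "bil_form t n" and ?V = "carrier_vec (2 * n) :: rat vec set"
  have J: "form_mat t n \<in> carrier_mat (2 * n) (2 * n)"
    by (auto simp: form_mat_def mult_2 split: lie_type.split)
  have x: "x \<in> carrier_mat (2 * n) (2 * n)" and y: "y \<in> carrier_mat (2 * n) (2 * n)"
    using assms by (auto simp: lie_alg_def)
  have xv: "x *\<^sub>v v \<in> ?V" "y *\<^sub>v v \<in> ?V" if "v \<in> ?V" for v using x y that by auto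
  have Jv: "form_mat t n *\<^sub>v v \<in> ?V" if "v \<in> ?V" for v using J that by auto
  have add1: "?B (u + v) w = ?B u w + ?B v w" and add2: "?B w (u + v) = ?B w u + ?B w v"
   and minus1: "?B (u - v) w = ?B u w - ?B v w" and minus2: "?B w (u - v) = ?B w u - ?B w v"
    if "u \<in> ?V" "v \<in> ?V" "w \<in> ?V" for u v w
    using that Jv J
    by (auto simp: bil_form_def add_scalar_prod_distrib[of _ "2 * n"] scalar_prod_add_distrib[of _ "2 * n"]
         minus_scalar_prod_distrib[of _ "2 * n"] scalar_prod_minus_distrib[of _ "2 * n"]
         mult_add_distrib_mat_vec[of _ "2*n" "2*n"] mult_minus_distrib_mat_vec[of _ "2*n" "2*n"])
  have sm: "?B (c \<cdot>\<^sub>v u) w = c * ?B u w" "?B w (c \<cdot>\<^sub>v u) = c * ?B w u" if "u \<in> ?V" "w \<in> ?V" for u w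
    using that Jv J by (auto simp: bil_form_def mult_mat_vec[of _ "2*n" "2*n"])
  have hx: "?B (x *\<^sub>v v) w = - ?B v (x *\<^sub>v w)" and hy: "?B (y *\<^sub>v v) w = - ?B v (y *\<^sub>v w)"
    if "v \<in> ?V" "w \<in> ?V" for v w
    using assms that by (auto simp: lie_alg_def eq_neg_iff_add_eq_0)
  show "x + y \<in> lie_alg t n"
    using x y xv by (auto simp: lie_alg_def add_mult_distrib_mat_vec[of _ "2*n" "2*n"] add1 add2 hx hy)
  have cx: "(c \<cdot>\<^sub>m x) *\<^sub>v v = c \<cdot>\<^sub>v (x *\<^sub>v v)" if "v \<in> ?V" for v
    using x that by (intro eq_vecI) auto
  show "c \<cdot>\<^sub>m x \<in> lie_alg t n"
    using x xv by (auto simp: lie_alg_def cx sm hx)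
  have br: "lie_bracket x y *\<^sub>v v = x *\<^sub>v (y *\<^sub>v v) - y *\<^sub>v (x *\<^sub>v v)" if "v \<in> ?V" for v
    using x y that unfolding lie_bracket_def
    by (subst minus_mult_distrib_mat_vec[of _ "2*n" "2*n"]) auto
  show "lie_bracket x y \<in> lie_alg t n"
    unfolding lie_alg_def
    using x y xv by (auto simp: br minus1 minus2 hx hy) (auto simp: lie_bracket_def)
qed


text \<open>Indices start at 0: \<open>H\<^sub>i\<close> for \<open>i < n\<close> is the difference of the matrix units at
  \<open>(i, i)\<close> and \<open>(n + i, n + i)\<close>.\<close>

definition cartan :: "nat \<Rightarrow> nat \<Rightarrow> rat mat" where
  "cartan n i = mat (2 * n) (2 * n)
     (\<lambda>(j, k). if j = i \<and> k = i then 1 else if j = n + i \<and> k = n + i then -1 else 0)"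

text \<open>A linear form on the Cartan subalgebra is given by its vector of coordinates, of
  dimension \<open>n\<close>, in the basis dual to the \<open>H\<^sub>i\<close>; that is, its \<open>i\<close>-th coordinate is its value
  at \<open>H\<^sub>i\<close>.\<close>

definition simple_root :: "lie_type \<Rightarrow> nat \<Rightarrow> nat \<Rightarrow> rat vec" where
  "simple_root t n i =
     (if Suc i < n then unit_vec n i - unit_vec n (Suc i)
      else (case t of
        TypeC \<Rightarrow> 2 \<cdot>\<^sub>v unit_vec n (n - 1)
      | TypeD \<Rightarrow> unit_vec n (n - 2) + unit_vec n (n - 1)))"

definition dom_le :: "lie_type \<Rightarrow> nat \<Rightarrow> rat vec \<Rightarrow> rat vec \<Rightarrow> bool" where
  "dom_le t n \<nu> \<mu> \<longleftrightarrow>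
     (\<exists>m :: nat \<Rightarrow> nat. \<mu> - \<nu> = vec n (\<lambda>j. \<Sum>i<n. of_nat (m i) * simple_root t n i $ j))"

text \<open>The pairing of \<open>\<nu>\<close> with the coroot of \<open>\<alpha>\<close> is \<open>2 (\<nu>, \<alpha>) / (\<alpha>, \<alpha>)\<close> for a Weyl group
  invariant scalar product; the one making the \<open>\<epsilon>\<^sub>i\<close> orthonormal is invariant in both types.
  Membership in \<^term>\<open>\<nat> :: rat set\<close> includes integrality.\<close>

definition dominant_weights :: "lie_type \<Rightarrow> nat \<Rightarrow> rat vec set" where
  "dominant_weights t n = {\<nu> \<in> carrier_vec n.
     \<forall>i<n. 2 * (\<nu> \<bullet> simple_root t n i) / (simple_root t n i \<bullet> simple_root t n i) \<in> \<nat>}"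

definition saturated :: "lie_type \<Rightarrow> nat \<Rightarrow> rat vec set \<Rightarrow> bool" where
  "saturated t n \<pi> \<longleftrightarrow> \<pi> \<subseteq> dominant_weights t n \<and>
     (\<forall>\<nu> \<in> \<pi>. \<forall>\<mu> \<in> dominant_weights t n. dom_le t n \<mu> \<nu> \<longrightarrow> \<mu> \<in> \<pi>)"

definition root_space :: "lie_type \<Rightarrow> nat \<Rightarrow> rat vec \<Rightarrow> rat mat set" where
  "root_space t n \<alpha> = {x \<in> lie_alg t n. \<forall>i<n. lie_bracket (cartan n i) x = \<alpha> $ i \<cdot>\<^sub>m x}"

abbreviation env_alg :: "lie_type \<Rightarrow> nat \<Rightarrow> (rat mat list \<Rightarrow> rat) set ring" where
  "env_alg t n \<equiv> uea (lie_alg t n)"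

lemma ring_env_alg: "ring (env_alg t n)"
  by (rule ring_uea) (auto intro: lie_alg_closed)

text \<open>Here \<open>\<alpha>\<close> runs through all nonzero sums of simple roots; when such an \<open>\<alpha>\<close> is not a
  (positive) root, its root space is zero and the condition is void.\<close>

definition maximal_vector ::
  "lie_type \<Rightarrow> nat \<Rightarrow> ((rat mat list \<Rightarrow> rat) set, 'v) module \<Rightarrow> rat vec \<Rightarrow> 'v \<Rightarrow> bool" where
  "maximal_vector t n M \<nu> v \<longleftrightarrow> v \<in> carrier M \<and> v \<noteq> \<zero>\<^bsub>M\<^esub> \<and>
     (\<forall>i<n. uea_gen (lie_alg t n) (cartan n i) \<odot>\<^bsub>M\<^esub> v
            = uea_scalar (lie_alg t n) (\<nu> $ i) \<odot>\<^bsub>M\<^esub> v) \<and>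
     (\<forall>\<alpha> \<in> carrier_vec n. \<alpha> \<noteq> 0\<^sub>v n \<and> dom_le t n (0\<^sub>v n) \<alpha> \<longrightarrow>
        (\<forall>x \<in> root_space t n \<alpha>. uea_gen (lie_alg t n) x \<odot>\<^bsub>M\<^esub> v = \<zero>\<^bsub>M\<^esub>))"

definition highest_weight_module ::
  "lie_type \<Rightarrow> nat \<Rightarrow> ((rat mat list \<Rightarrow> rat) set, 'v) module \<Rightarrow> rat vec \<Rightarrow> bool" where
  "highest_weight_module t n M \<nu> \<longleftrightarrow> left_module (env_alg t n) M \<and>
     (\<exists>v. maximal_vector t n M \<nu> v \<and>
          (\<forall>N. submodule N (env_alg t n) M \<and> v \<in> N \<longrightarrow> N = carrier M))"


section \<open>Generalized Schur algebras\<close>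

text \<open>The modules range over all those whose elements are taken from the type \<open>'v\<close>, as one cannot
  quantify over types inside a term. Simple modules over the enveloping algebra are
  cyclic, hence countable, so every infinite \<open>'v\<close> contains copies of all of them and yields the
  same ideal.\<close>

definition gen_schur_ideal ::
  "'v itself \<Rightarrow> lie_type \<Rightarrow> nat \<Rightarrow> rat vec set \<Rightarrow> (rat mat list \<Rightarrow> rat) set set" where
  "gen_schur_ideal _ t n \<pi> = {u \<in> carrier (env_alg t n).
     \<forall>(M :: ((rat mat list \<Rightarrow> rat) set, 'v) module) \<nu>.
       \<nu> \<in> \<pi> \<and> simple_module (env_alg t n) M \<and> highest_weight_module t n M \<nu>
       \<longrightarrow> annihilates u M}"

definition gen_schur_algebra ::
  "'v itself \<Rightarrow> lie_type \<Rightarrow> nat \<Rightarrow> rat vec set \<Rightarrow> (rat mat list \<Rightarrow> rat) set set ring" where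
  "gen_schur_algebra T t n \<pi> = env_alg t n Quot gen_schur_ideal T t n \<pi>"


section \<open>Tensor powers of the natural representation\<close>

text \<open>A tensor of degree \<open>r\<close> over \<open>\<rat>\<^sup>N\<close> is given by its coordinates in the
  basis of pure tensors \<open>e\<^bsub>w 0\<^esub> \<otimes> \<dots> \<otimes> e\<^bsub>w (r-1)\<^esub>\<close>, indexed by the words \<open>w\<close> of length \<open>r\<close>
  in \<open>{..<N}\<close>.\<close>

definition tensor_words :: "nat \<Rightarrow> nat \<Rightarrow> nat list set" where
  "tensor_words N r = {w. length w = r \<and> set w \<subseteq> {..<N}}"

definition tensor_space :: "nat \<Rightarrow> nat \<Rightarrow> (rat, nat list \<Rightarrow> rat) module" where
  "tensor_space N r =
     \<lparr> carrier = {T. {w. T w \<noteq> 0} \<subseteq> tensor_words N r},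
       mult = undefined, one = undefined,
       zero = (\<lambda>w. 0),
       add = (\<lambda>S T w. S w + T w),
       smult = (\<lambda>c T w. c * T w) \<rparr>"

text \<open>A matrix acts as the sum over \<open>k < r\<close> of its actions on the \<open>k\<close>-th tensor factor.\<close>

definition tensor_action :: "nat \<Rightarrow> nat \<Rightarrow> rat mat \<Rightarrow> (nat list \<Rightarrow> rat) \<Rightarrow> nat list \<Rightarrow> rat" where
  "tensor_action N r x = (\<lambda>T \<in> carrier (tensor_space N r). \<lambda>w.
     if w \<in> tensor_words N r
     then \<Sum>k<r. \<Sum>j<N. x $$ (w ! k, j) * T (w[k := j])
     else 0)"

definition pure_tensor :: "nat \<Rightarrow> rat vec list \<Rightarrow> nat list \<Rightarrow> rat" where
  "pure_tensor N vs = (\<lambda>w.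
     if w \<in> tensor_words N (length vs) then \<Prod>k<length vs. vs ! k $ (w ! k) else 0)"

lemma tensor_action_pure_tensor:
  assumes x: "x \<in> carrier_mat N N" and vs: "set vs \<subseteq> carrier_vec N" and len: "length vs = r"
  shows "tensor_action N r x (pure_tensor N vs)
       = (\<lambda>w. \<Sum>k<r. pure_tensor N (vs[k := x *\<^sub>v (vs ! k)]) w)"
proof
  fix w
  have car: "pure_tensor N vs \<in> carrier (tensor_space N r)"
    using len by (auto simp: tensor_space_def pure_tensor_def split: if_splits)
  show "tensor_action N r x (pure_tensor N vs) w
      = (\<Sum>k<r. pure_tensor N (vs[k := x *\<^sub>v (vs ! k)]) w)"
  proof (cases "w \<in> tensor_words N r")
    case False
    then show ?thesis using car len by (simp add: tensor_action_def pure_tensor_def)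
  next
    case True
    have "(\<Sum>j<N. x $$ (w ! k, j) * pure_tensor N vs (w[k := j]))
        = pure_tensor N (vs[k := x *\<^sub>v (vs ! k)]) w" if k: "k < r" for k
    proof -
      have wk: "w ! k < N" and lw: "length w = r"
        using True k by (auto simp: tensor_words_def subset_iff)
      have vk: "vs ! k \<in> carrier_vec N" using vs k len by auto
      have split: "(\<Prod>l<r. f l) = f k * (\<Prod>l\<in>{..<r}-{k}. f l)" for f :: "nat \<Rightarrow> rat"
        using k by (simp add: prod.remove)
      define P where "P = (\<Prod>l\<in>{..<r}-{k}. vs ! l $ (w ! l))"
      have 1: "pure_tensor N vs (w[k := j]) = vs ! k $ j * P" if j: "j < N" for j
      proof -
        have "w[k := j] \<in> tensor_words N r"
          using True j set_update_subset_insert[of w k j] by (auto simp: tensor_words_def)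
        then have "pure_tensor N vs (w[k := j]) = (\<Prod>l<r. vs ! l $ (w[k := j] ! l))"
          using len by (simp add: pure_tensor_def)
        also have "\<dots> = vs ! k $ j * (\<Prod>l\<in>{..<r}-{k}. vs ! l $ (w[k := j] ! l))"
          using k lw by (subst split) simp
        also have "(\<Prod>l\<in>{..<r}-{k}. vs ! l $ (w[k := j] ! l)) = P"
          unfolding P_def by (intro prod.cong) auto
        finally show ?thesis .
      qed
      have "pure_tensor N (vs[k := x *\<^sub>v (vs ! k)]) w
          = (\<Prod>l<r. vs[k := x *\<^sub>v (vs ! k)] ! l $ (w ! l))"
        using True len by (simp add: pure_tensor_def)
      also have "\<dots> = (x *\<^sub>v (vs ! k)) $ (w ! k)
          * (\<Prod>l\<in>{..<r}-{k}. vs[k := x *\<^sub>v (vs ! k)] ! l $ (w ! l))"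
        using k len by (subst split) simp
      also have "(\<Prod>l\<in>{..<r}-{k}. vs[k := x *\<^sub>v (vs ! k)] ! l $ (w ! l)) = P"
        unfolding P_def by (intro prod.cong) auto
      also have "(x *\<^sub>v (vs ! k)) $ (w ! k) = (\<Sum>j<N. x $$ (w ! k, j) * vs ! k $ j)"
        using x vk wk by (simp add: scalar_prod_def atLeast0LessThan)
      finally show ?thesis using 1 by (simp add: sum_distrib_right mult.assoc)
    qed
    then show ?thesis using True car by (simp add: tensor_action_def)
  qed
qed

definition tensor_rep ::
  "lie_type \<Rightarrow> nat \<Rightarrow> nat \<Rightarrow> (rat mat list \<Rightarrow> rat) set \<Rightarrow> (nat list \<Rightarrow> rat) \<Rightarrow> nat list \<Rightarrow> rat" where
  "tensor_rep t n r = uea_eval (End_alg (tensor_space (2 * n) r)) (tensor_action (2 * n) r)"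

definition schur_algebra ::
  "lie_type \<Rightarrow> nat \<Rightarrow> nat \<Rightarrow> (rat, (nat list \<Rightarrow> rat) \<Rightarrow> nat list \<Rightarrow> rat) module" where
  "schur_algebra t n r =
     (End_alg (tensor_space (2 * n) r))\<lparr>carrier := tensor_rep t n r ` carrier (env_alg t n)\<rparr>"

definition tensor_dominant_weights :: "lie_type \<Rightarrow> nat \<Rightarrow> nat \<Rightarrow> rat vec set" where
  "tensor_dominant_weights t n r = {\<nu> \<in> dominant_weights t n.
     \<exists>T \<in> carrier (tensor_space (2 * n) r). T \<noteq> \<zero>\<^bsub>tensor_space (2 * n) r\<^esub> \<and>
       (\<forall>i<n. tensor_action (2 * n) r (cartan n i) T
              = (\<nu> $ i) \<odot>\<^bsub>tensor_space (2 * n) r\<^esub> T)}"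

end

theory Submission
  imports
    Defs
    "Jordan_Normal_Form.Determinant"
    "HOL-Library.Function_Algebras"
    "HOL-Library.Countable"
begin

text \<open>The Lie algebra is closed under transposition, so the coordinate dot product on the tensor
  power is contravariant; it is positive definite over the rationals, which makes the tensor power
  completely reducible by taking orthogonal complements. Each simple submodule is generated by a
  maximal vector \<open>T\<close>, whose weight is dominant because its value at a simple coroot is a positive
  multiple of \<open>\<langle>f T, f T\<rangle> \<ge> 0\<close>. Hence what annihilates all simple modules of highest weight in \<open>\<pi>\<close>
  annihilates the tensor power.

  Conversely the weights in \<open>\<pi>\<close> are the integral dominant weights \<open>c\<close> with \<open>\<Sum>i. \<bar>c i\<bar> \<le> r\<close> and
  \<open>\<Sum>i. \<bar>c i\<bar>\<close> of the same parity as \<open>r\<close>, and each of them is the weight of a maximal vector in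
  the tensor power: a product of exterior powers of the natural representation, padded with copies
  of the invariant form. A simple module with the same highest weight is a subquotient, hence is
  annihilated by the kernel of the tensor representation.\<close>

section \<open>Free algebras and enveloping algebras\<close>

text \<open>The ideal speaks of arbitrary simple modules, of which nothing is given but a maximal
  vector, so they must be compared with the tensor power without a classification. One diagonal
  element does this: \<open>grading_mat\<close>, the sum of the (n - i) H_i with i counted from 0,
  is positive on every simple root. Hence every vector generated by a maximal vector is a multiple
  of it plus eigenvectors of smaller eigenvalue, and in the module generated by a pair of maximal
  vectors of one weight the top eigenspace is a line. This replaces the uniqueness of the simple
  module with a given highest weight. The same element finds the maximal vectors in submodules of
  the tensor power: a weight vector of greatest height cannot be raised. Working over the rationals
  is harmless: words are weight vectors with integral weights, and orthogonal projection divides by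
  square lengths only. The size and parity conditions on weights come from single letters, each of
  which changes one coordinate by 1 or -1.\<close>

lemma free_gen_closed [simp, intro]: "x \<in> A \<Longrightarrow> free_gen x \<in> carrier (free_algebra A)"
  by (auto simp: free_algebra_def free_gen_def)

lemma free_smult_closed [simp, intro]:
  "p \<in> carrier (free_algebra A) \<Longrightarrow> c \<odot>\<^bsub>free_algebra A\<^esub> p \<in> carrier (free_algebra A)"
  by (auto simp: free_algebra_def)

lemma free_algebra_simps:
  "(p \<otimes>\<^bsub>free_algebra A\<^esub> q) w = (\<Sum>k\<le>length w. p (take k w) * q (drop k w))"
  "\<one>\<^bsub>free_algebra A\<^esub> w = (if w = [] then 1 else 0)"
  "(p \<oplus>\<^bsub>free_algebra A\<^esub> q) w = p w + q w"
  "(c \<odot>\<^bsub>free_algebra A\<^esub> p) w = c * p w"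
  by (simp_all add: free_algebra_def)

lemma free_const_mult:
  "(c \<odot>\<^bsub>free_algebra A\<^esub> \<one>\<^bsub>free_algebra A\<^esub>) \<otimes>\<^bsub>free_algebra A\<^esub> p = c \<odot>\<^bsub>free_algebra A\<^esub> p"
proof
  fix w
  have "((c \<odot>\<^bsub>free_algebra A\<^esub> \<one>\<^bsub>free_algebra A\<^esub>) \<otimes>\<^bsub>free_algebra A\<^esub> p) w
      = (\<Sum>k\<le>length w. if k = 0 then c * p w else 0)"
    unfolding free_algebra_simps by (intro sum.cong) auto
  then show "((c \<odot>\<^bsub>free_algebra A\<^esub> \<one>\<^bsub>free_algebra A\<^esub>) \<otimes>\<^bsub>free_algebra A\<^esub> p) w
      = (c \<odot>\<^bsub>free_algebra A\<^esub> p) w"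
    by (simp add: free_algebra_def)
qed

lemma free_mult_const:
  "p \<otimes>\<^bsub>free_algebra A\<^esub> (c \<odot>\<^bsub>free_algebra A\<^esub> \<one>\<^bsub>free_algebra A\<^esub>) = c \<odot>\<^bsub>free_algebra A\<^esub> p"
proof
  fix w
  have "(p \<otimes>\<^bsub>free_algebra A\<^esub> (c \<odot>\<^bsub>free_algebra A\<^esub> \<one>\<^bsub>free_algebra A\<^esub>)) w
      = (\<Sum>k\<le>length w. if k = length w then c * p w else 0)"
    unfolding free_algebra_simps by (intro sum.cong) auto
  then show "(p \<otimes>\<^bsub>free_algebra A\<^esub> (c \<odot>\<^bsub>free_algebra A\<^esub> \<one>\<^bsub>free_algebra A\<^esub>)) w
      = (c \<odot>\<^bsub>free_algebra A\<^esub> p) w"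
    by (simp add: free_algebra_def)
qed

text \<open>Only the cut after the first letter contributes to the convolution.\<close>

lemma free_gen_mult:
  "free_gen x \<otimes>\<^bsub>free_algebra A\<^esub> p = (\<lambda>w. if w \<noteq> [] \<and> hd w = x then p (tl w) else 0)"
proof
  fix w
  have "(free_gen x \<otimes>\<^bsub>free_algebra A\<^esub> p) w
      = (\<Sum>k\<le>length w. if k = 1 then (if hd w = x then p (tl w) else 0) else 0)"
    unfolding free_algebra_simps
  proof (intro sum.cong refl)
    fix k assume "k \<in> {..length w}"
    then show "free_gen x (take k w) * p (drop k w)
        = (if k = 1 then (if hd w = x then p (tl w) else 0) else 0)"
      by (cases w; cases k) (auto simp: free_gen_def)
  qed
  then show "(free_gen x \<otimes>\<^bsub>free_algebra A\<^esub> p) w = (if w \<noteq> [] \<and> hd w = x then p (tl w) else 0)"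
    by (cases w) (auto simp: Suc_le_eq)
qed

text \<open>A monomial arises from a constant by attaching letters on the left, and every element is
  a finite sum of monomials. Keeping the generator on the left suits left modules.\<close>

lemma free_algebra_induct [consumes 1, case_names const gen add]:
  assumes p: "p \<in> carrier (free_algebra A)"
    and const: "\<And>c. P (c \<odot>\<^bsub>free_algebra A\<^esub> \<one>\<^bsub>free_algebra A\<^esub>)"
    and gen: "\<And>x q. x \<in> A \<Longrightarrow> q \<in> carrier (free_algebra A) \<Longrightarrow> P q \<Longrightarrow>
        P (free_gen x \<otimes>\<^bsub>free_algebra A\<^esub> q)"
    and add: "\<And>q q'. q \<in> carrier (free_algebra A) \<Longrightarrow> q' \<in> carrier (free_algebra A) \<Longrightarrow>
        P q \<Longrightarrow> P q' \<Longrightarrow> P (q \<oplus>\<^bsub>free_algebra A\<^esub> q')"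
  shows "P p"
proof -
  define mono where "mono w c = (\<lambda>v. if v = w then c else 0 :: rat)" for w :: "'a list" and c
  have mono: "mono w c \<in> carrier (free_algebra A) \<and> P (mono w c)" if "set w \<subseteq> A" for w c
    using that
  proof (induction w)
    case Nil
    have "mono [] c = c \<odot>\<^bsub>free_algebra A\<^esub> \<one>\<^bsub>free_algebra A\<^esub>"
      by (auto simp: mono_def free_algebra_def)
    moreover have "mono [] c \<in> carrier (free_algebra A)"
      by (auto simp: mono_def free_algebra_def)
    ultimately show ?case using const by simp
  next
    case (Cons x w)
    have "mono (x # w) c = free_gen x \<otimes>\<^bsub>free_algebra A\<^esub> mono w c"
      unfolding free_gen_mult mono_def by (rule ext) (auto simp: neq_Nil_conv)
    moreover have "mono (x # w) c \<in> carrier (free_algebra A)"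
      using Cons.prems by (auto simp: mono_def free_algebra_def)
    ultimately show ?case using Cons gen by auto
  qed
  have "P q" if "finite S" "q \<in> carrier (free_algebra A)" "{w. q w \<noteq> 0} \<subseteq> S" for q S
    using that
  proof (induction S arbitrary: q rule: finite_induct)
    case empty
    then have "q = mono [] 0" by (auto simp: mono_def)
    then show ?case using mono[of "[]" 0] by simp
  next
    case (insert w S)
    show ?case
    proof (cases "q w = 0")
      case True
      then show ?thesis using insert by (intro insert.IH) auto
    next
      case False
      let ?q = "q(w := 0)"
      have w: "set w \<subseteq> A" using insert.prems(1) False by (auto simp: free_algebra_def)
      have q: "?q \<in> carrier (free_algebra A)"
        using insert.prems(1) by (auto simp: free_algebra_def elim: rev_finite_subset)
      have "q = mono w (q w) \<oplus>\<^bsub>free_algebra A\<^esub> ?q"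
        by (auto simp: mono_def free_algebra_def)
      moreover have "P ?q" by (rule insert.IH[OF q]) (use insert.prems in auto)
      ultimately show ?thesis using add[OF _ q, of "mono w (q w)"] mono[OF w] by simp
    qed
  qed
  then show ?thesis using p by (auto simp: free_algebra_def)
qed

section \<open>Generators, scalars and induction in the enveloping algebra\<close>

locale mat_lie_algebra =
  fixes L :: "rat mat set"
  assumes add_closed: "\<And>x y. x \<in> L \<Longrightarrow> y \<in> L \<Longrightarrow> x + y \<in> L"
    and smult_closed: "\<And>c x. x \<in> L \<Longrightarrow> c \<cdot>\<^sub>m x \<in> L"
    and bracket_closed: "\<And>x y. x \<in> L \<Longrightarrow> y \<in> L \<Longrightarrow> lie_bracket x y \<in> L"
begin

abbreviation "F \<equiv> free_algebra L"
abbreviation "U \<equiv> uea L"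
abbreviation "gen \<equiv> uea_gen L"
abbreviation "scal \<equiv> uea_scalar L"
abbreviation "proj \<equiv> (+>\<^bsub>F\<^esub>) (uea_ideal L)"

sublocale F: ring F by (rule ring_free_algebra)

sublocale U: ring U by (rule ring_uea) (simp_all add: add_closed smult_closed bracket_closed)

text \<open>Closure of \<open>L\<close> under the three operations places the defining relations in
  the free algebra on \<open>L\<close>, so that \<open>genideal\<close> yields an ideal
  there.\<close>

sublocale I: ideal "uea_ideal L" F
  unfolding uea_ideal_def
  by (rule F.genideal_ideal[OF uea_relations_carrier])
    (simp_all add: add_closed smult_closed bracket_closed)

sublocale proj: ring_hom_ring F U proj
  unfolding uea_def by (rule I.rcos_ring_hom_ring)

lemma relations_subset: "uea_relations L \<subseteq> uea_ideal L"
  unfolding uea_ideal_def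
  by (rule F.genideal_self[OF uea_relations_carrier])
    (simp_all add: add_closed smult_closed bracket_closed)

lemma gen_closed [simp, intro]: "x \<in> L \<Longrightarrow> gen x \<in> carrier U"
  unfolding uea_gen_def by auto

lemma scal_closed [simp, intro]: "scal c \<in> carrier U"
  unfolding uea_scalar_def by auto

lemma carrier_U: "carrier U = proj ` carrier F"
  unfolding uea_def FactRing_def A_RCOSETS_def' partial_object.simps by blast

lemma proj_eqI:
  assumes "p \<in> carrier F" "q \<in> carrier F" "p \<ominus>\<^bsub>F\<^esub> q \<in> uea_ideal L"
  shows "proj p = proj q"
  using F.quotient_eq_iff_same_a_r_cos[OF I.ideal_axioms assms(1,2)] assms(3) by simp

text \<open>With this rule a claim about \<open>u\<close> acting on a fixed vector is proved by
  letting one element of \<open>L\<close> act at a time.\<close>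

lemma uea_induct [consumes 1, case_names scal gen add]:
  assumes u: "u \<in> carrier U"
    and "\<And>c. P (scal c)"
    and "\<And>x u. x \<in> L \<Longrightarrow> u \<in> carrier U \<Longrightarrow> P u \<Longrightarrow> P (gen x \<otimes>\<^bsub>U\<^esub> u)"
    and "\<And>u v. u \<in> carrier U \<Longrightarrow> v \<in> carrier U \<Longrightarrow> P u \<Longrightarrow> P v \<Longrightarrow> P (u \<oplus>\<^bsub>U\<^esub> v)"
  shows "P u"
proof -
  obtain p where p: "p \<in> carrier F" and up: "u = proj p" using u carrier_U by auto
  from p have "P (proj p)"
  proof (induction p rule: free_algebra_induct)
    case (const c)
    then show ?case using assms(2) by (simp add: uea_scalar_def)
  next
    case (gen x q)
    then show ?case using assms(3)[of x "proj q"] by (simp add: uea_gen_def)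
  next
    case (add q q')
    then show ?case using assms(4)[of "proj q" "proj q'"] by simp
  qed
  then show ?thesis using up by simp
qed

lemma gen_add: "x \<in> L \<Longrightarrow> y \<in> L \<Longrightarrow> gen (x + y) = gen x \<oplus>\<^bsub>U\<^esub> gen y"
proof -
  assume xy: "x \<in> L" "y \<in> L"
  have "free_gen (x + y) \<ominus>\<^bsub>F\<^esub> (free_gen x \<oplus>\<^bsub>F\<^esub> free_gen y) \<in> uea_ideal L"
    using relations_subset xy by (auto simp: uea_relations_def Let_def)
  then have "proj (free_gen (x + y)) = proj (free_gen x \<oplus>\<^bsub>F\<^esub> free_gen y)"
    using xy add_closed by (intro proj_eqI) auto
  then show ?thesis using xy by (simp add: uea_gen_def)
qed

text \<open>The enveloping algebra is stored as a plain ring; rational scalars act through the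
  central elements \<open>scal c\<close>.\<close>

lemma gen_smult:
  assumes x: "x \<in> L"
  shows "gen (c \<cdot>\<^sub>m x) = scal c \<otimes>\<^bsub>U\<^esub> gen x"
proof -
  have g: "free_gen x \<in> carrier F" "free_gen (c \<cdot>\<^sub>m x) \<in> carrier F"
    using free_gen_closed x smult_closed by blast+
  have c: "c \<odot>\<^bsub>F\<^esub> \<one>\<^bsub>F\<^esub> \<in> carrier F" by auto
  have "free_gen (c \<cdot>\<^sub>m x) \<ominus>\<^bsub>F\<^esub> (c \<odot>\<^bsub>F\<^esub> free_gen x) \<in> uea_ideal L"
    using x by (intro subsetD[OF relations_subset]) (unfold uea_relations_def Let_def, blast)
  then have "proj (free_gen (c \<cdot>\<^sub>m x)) = proj (c \<odot>\<^bsub>F\<^esub> free_gen x)"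
    using g free_smult_closed by (intro proj_eqI)
  then show ?thesis
    unfolding uea_gen_def uea_scalar_def proj.hom_mult[OF c g(1), symmetric] free_const_mult .
qed

lemma gen_bracket:
  assumes x: "x \<in> L" and y: "y \<in> L"
  shows "gen (lie_bracket x y) = gen x \<otimes>\<^bsub>U\<^esub> gen y \<ominus>\<^bsub>U\<^esub> gen y \<otimes>\<^bsub>U\<^esub> gen x"
proof -
  have g: "free_gen x \<in> carrier F" "free_gen y \<in> carrier F"
      "free_gen (lie_bracket x y) \<in> carrier F"
    using free_gen_closed x y bracket_closed by blast+
  have "free_gen (lie_bracket x y)
      \<ominus>\<^bsub>F\<^esub> (free_gen x \<otimes>\<^bsub>F\<^esub> free_gen y \<ominus>\<^bsub>F\<^esub> free_gen y \<otimes>\<^bsub>F\<^esub> free_gen x) \<in> uea_ideal L"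
    using x y by (intro subsetD[OF relations_subset]) (unfold uea_relations_def Let_def, blast)
  then have "proj (free_gen (lie_bracket x y))
      = proj (free_gen x \<otimes>\<^bsub>F\<^esub> free_gen y \<ominus>\<^bsub>F\<^esub> free_gen y \<otimes>\<^bsub>F\<^esub> free_gen x)"
    using g by (intro proj_eqI F.minus_closed F.m_closed)
  then show ?thesis using g by (simp add: uea_gen_def a_minus_def)
qed

lemma scal_one: "scal 1 = \<one>\<^bsub>U\<^esub>"
proof -
  have "1 \<odot>\<^bsub>F\<^esub> \<one>\<^bsub>F\<^esub> = \<one>\<^bsub>F\<^esub>" by (simp add: free_algebra_def)
  then show ?thesis by (simp add: uea_scalar_def)
qed

lemma scal_mult: "scal c \<otimes>\<^bsub>U\<^esub> scal d = scal (c * d)"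
proof -
  have 1: "c \<odot>\<^bsub>F\<^esub> \<one>\<^bsub>F\<^esub> \<in> carrier F" for c by auto
  have "(c \<odot>\<^bsub>F\<^esub> \<one>\<^bsub>F\<^esub>) \<otimes>\<^bsub>F\<^esub> (d \<odot>\<^bsub>F\<^esub> \<one>\<^bsub>F\<^esub>) = (c * d) \<odot>\<^bsub>F\<^esub> \<one>\<^bsub>F\<^esub>"
    unfolding free_const_mult by (auto simp: free_algebra_def)
  then show ?thesis
    unfolding uea_scalar_def by (simp only: proj.hom_mult[OF 1 1, symmetric])
qed

lemma scal_add: "scal (c + d) = scal c \<oplus>\<^bsub>U\<^esub> scal d"
proof -
  have 1: "c \<odot>\<^bsub>F\<^esub> \<one>\<^bsub>F\<^esub> \<in> carrier F" for c by auto
  have "(c + d) \<odot>\<^bsub>F\<^esub> \<one>\<^bsub>F\<^esub> = (c \<odot>\<^bsub>F\<^esub> \<one>\<^bsub>F\<^esub>) \<oplus>\<^bsub>F\<^esub> (d \<odot>\<^bsub>F\<^esub> \<one>\<^bsub>F\<^esub>)"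
    by (auto simp: free_algebra_def algebra_simps)
  then show ?thesis unfolding uea_scalar_def by (simp only: proj.hom_add[OF 1 1])
qed

lemma scal_central: "u \<in> carrier U \<Longrightarrow> scal c \<otimes>\<^bsub>U\<^esub> u = u \<otimes>\<^bsub>U\<^esub> scal c"
proof -
  assume "u \<in> carrier U"
  then obtain p where p: "p \<in> carrier F" and u: "u = proj p" using carrier_U by auto
  have c: "c \<odot>\<^bsub>F\<^esub> \<one>\<^bsub>F\<^esub> \<in> carrier F" by auto
  show ?thesis
    unfolding u uea_scalar_def proj.hom_mult[OF c p, symmetric] proj.hom_mult[OF p c, symmetric]
      free_const_mult free_mult_const ..
qed

lemma scal_zero: "scal 0 = \<zero>\<^bsub>U\<^esub>"
proof -
  have "0 \<odot>\<^bsub>F\<^esub> \<one>\<^bsub>F\<^esub> = \<zero>\<^bsub>F\<^esub>" by (simp add: free_algebra_def)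
  then show ?thesis unfolding uea_scalar_def by (simp only: proj.hom_zero)
qed

end

section \<open>The tensor representation\<close>

lemma tensor_words_Nil [simp]: "[] \<in> tensor_words N r \<longleftrightarrow> r = 0"
  by (auto simp: tensor_words_def)

lemma tensor_words_Cons [simp]:
  "a # w \<in> tensor_words N r \<longleftrightarrow> a < N \<and> r = Suc (length w) \<and> w \<in> tensor_words N (length w)"
  by (auto simp: tensor_words_def)

lemma tensor_words_length: "w \<in> tensor_words N r \<Longrightarrow> length w = r"
  by (simp add: tensor_words_def)

lemma tensor_words_nth: "w \<in> tensor_words N r \<Longrightarrow> k < r \<Longrightarrow> w ! k < N"
  by (auto simp: tensor_words_def subset_iff)

lemma tensor_words_update: "w \<in> tensor_words N r \<Longrightarrow> j < N \<Longrightarrow> w[k := j] \<in> tensor_words N r"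
  using set_update_subset_insert[of w k j] by (auto simp: tensor_words_def)

lemma finite_tensor_words [simp]: "finite (tensor_words N r)"
proof -
  have "tensor_words N r = {w. set w \<subseteq> {..<N} \<and> length w = r}" by (auto simp: tensor_words_def)
  then show ?thesis using finite_lists_length_eq[of "{..<N}" r] by simp
qed

text \<open>The recursion peels off the first tensor factor, so that identities about the action
  follow by induction on words.\<close>

fun deriv_action :: "nat \<Rightarrow> rat mat \<Rightarrow> (nat list \<Rightarrow> rat) \<Rightarrow> nat list \<Rightarrow> rat" where
  "deriv_action N x T [] = 0"
| "deriv_action N x T (a # w) =
     (\<Sum>j<N. x $$ (a, j) * T (j # w)) + deriv_action N x (\<lambda>u. T (a # u)) w"

lemma deriv_action_eq:
  "deriv_action N x T w = (\<Sum>k<length w. \<Sum>j<N. x $$ (w ! k, j) * T (w[k := j]))"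
proof (induction w arbitrary: T)
  case (Cons a w)
  show ?case by (simp add: sum.lessThan_Suc_shift Cons.IH del: sum.lessThan_Suc)
qed simp

lemma tensor_action_eq:
  assumes "T \<in> carrier (tensor_space N r)"
  shows "tensor_action N r x T
    = (\<lambda>w. if w \<in> tensor_words N r then deriv_action N x T w else 0)"
  using assms by (auto simp: tensor_action_def deriv_action_eq tensor_words_length)

text \<open>\<open>tensor_action\<close> cuts off to zero outside \<open>tensor_words\<close>, while
  \<open>deriv_action\<close> does not. As the action never leaves the words of a given degree, the
  cut-off can be ignored inside a composition.\<close>

lemma deriv_action_cong:
  assumes "w \<in> tensor_words N r" "\<And>u. u \<in> tensor_words N r \<Longrightarrow> S u = T u"
  shows "deriv_action N x S w = deriv_action N x T w"
  unfolding deriv_action_eq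
  using assms tensor_words_update[OF assms(1)] by (auto intro!: sum.cong)

lemma deriv_action_sum:
  "deriv_action N x (\<lambda>w. \<Sum>i\<in>I. c i * T i w) w = (\<Sum>i\<in>I. c i * deriv_action N x (T i) w)"
proof (induction w arbitrary: T)
  case (Cons a w)
  have "(\<Sum>j<N. x $$ (a, j) * (\<Sum>i\<in>I. c i * T i (j # w)))
      = (\<Sum>i\<in>I. c i * (\<Sum>j<N. x $$ (a, j) * T i (j # w)))"
    by (simp add: sum_distrib_left sum.swap[of _ _ I] mult_ac)
  then show ?case by (simp add: Cons.IH sum.distrib ring_distribs)
qed simp

lemma deriv_action_add:
  "deriv_action N x (\<lambda>w. S w + T w) w = deriv_action N x S w + deriv_action N x T w"
  by (induction w arbitrary: S T) (simp_all add: sum.distrib algebra_simps)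

lemma deriv_action_scale:
  "deriv_action N x (\<lambda>w. c * T w) w = c * deriv_action N x T w"
  by (induction w arbitrary: T) (simp_all add: sum_distrib_left algebra_simps)

lemma deriv_action_mat_add:
  assumes "x \<in> carrier_mat N N" "y \<in> carrier_mat N N" "w \<in> tensor_words N r"
  shows "deriv_action N (x + y) T w = deriv_action N x T w + deriv_action N y T w"
  using assms(3)
  by (induction w arbitrary: T r) (use assms(1,2) in \<open>auto simp: sum.distrib algebra_simps\<close>)

lemma deriv_action_mat_smult:
  assumes "x \<in> carrier_mat N N" "w \<in> tensor_words N r"
  shows "deriv_action N (c \<cdot>\<^sub>m x) T w = c * deriv_action N x T w"
  using assms(2)
  by (induction w arbitrary: T r) (use assms(1) in \<open>auto simp: sum_distrib_left algebra_simps\<close>)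

lemma deriv_action_bracket:
  assumes x: "x \<in> carrier_mat N N" and y: "y \<in> carrier_mat N N" and w: "w \<in> tensor_words N r"
  shows "deriv_action N (lie_bracket x y) T w
    = deriv_action N x (deriv_action N y T) w - deriv_action N y (deriv_action N x T) w"
  using w
proof (induction w arbitrary: T r)
  case (Cons a w)
  have a: "a < N" and w: "w \<in> tensor_words N (length w)" using Cons.prems by auto
  have prod: "(\<Sum>j<N. (x * y) $$ (a, j) * T (j # w))
      = (\<Sum>j<N. x $$ (a, j) * (\<Sum>i<N. y $$ (j, i) * T (i # w)))"
    if "x \<in> carrier_mat N N" "y \<in> carrier_mat N N" for x y :: "rat mat"
  proof -
    have "(\<Sum>i<N. (x * y) $$ (a, i) * T (i # w))
        = (\<Sum>i<N. \<Sum>j<N. x $$ (a, j) * y $$ (j, i) * T (i # w))"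
      using that a by (simp add: scalar_prod_def atLeast0LessThan sum_distrib_right)
    also have "\<dots> = (\<Sum>j<N. \<Sum>i<N. x $$ (a, j) * y $$ (j, i) * T (i # w))"
      by (rule sum.swap)
    finally show ?thesis by (simp add: sum_distrib_left mult.assoc)
  qed
  have br: "(\<Sum>j<N. lie_bracket x y $$ (a, j) * T (j # w))
      = (\<Sum>j<N. (x * y) $$ (a, j) * T (j # w)) - (\<Sum>j<N. (y * x) $$ (a, j) * T (j # w))"
    using x y a by (simp add: lie_bracket_def sum_subtractf[symmetric] left_diff_distrib)
  \<comment> \<open>In the two middle sums \<open>x\<close> and \<open>y\<close> hit different
    tensor factors. Exchanging \<open>x\<close> and \<open>y\<close> exchanges these sums, so they
    cancel in the commutator.\<close>
  have exp: "deriv_action N x (deriv_action N y T) (a # w)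
      = (\<Sum>j<N. x $$ (a, j) * (\<Sum>i<N. y $$ (j, i) * T (i # w)))
      + (\<Sum>j<N. x $$ (a, j) * deriv_action N y (\<lambda>u. T (j # u)) w)
      + (\<Sum>j<N. y $$ (a, j) * deriv_action N x (\<lambda>u. T (j # u)) w)
      + deriv_action N x (deriv_action N y (\<lambda>u. T (a # u))) w" for x y
    by (simp add: deriv_action_add deriv_action_sum ring_distribs sum.distrib)
  show ?case
    unfolding deriv_action.simps(2)[of N "lie_bracket x y"] exp br prod[OF x y] prod[OF y x]
      Cons.IH[OF w] by simp
qed simp

lemma tensor_space_simps [simp]:
  "\<zero>\<^bsub>tensor_space N r\<^esub> = (\<lambda>w. 0)"
  "S \<oplus>\<^bsub>tensor_space N r\<^esub> T = (\<lambda>w. S w + T w)"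
  "c \<odot>\<^bsub>tensor_space N r\<^esub> T = (\<lambda>w. c * T w)"
  by (simp_all add: tensor_space_def)

lemma tensor_space_carrier: "T \<in> carrier (tensor_space N r) \<longleftrightarrow> (\<forall>w. w \<notin> tensor_words N r \<longrightarrow> T w = 0)"
  by (auto simp: tensor_space_def)

lemma tensor_space_closed [simp, intro]:
  "(\<lambda>w. 0) \<in> carrier (tensor_space N r)"
  "S \<in> carrier (tensor_space N r) \<Longrightarrow> T \<in> carrier (tensor_space N r) \<Longrightarrow>
    (\<lambda>w. S w + T w) \<in> carrier (tensor_space N r)"
  "T \<in> carrier (tensor_space N r) \<Longrightarrow> (\<lambda>w. c * T w) \<in> carrier (tensor_space N r)"
  "T \<in> carrier (tensor_space N r) \<Longrightarrow> (\<lambda>w. - T w) \<in> carrier (tensor_space N r)"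
  by (auto simp: tensor_space_carrier)

lemma tensor_action_closed [simp, intro]:
  "T \<in> carrier (tensor_space N r) \<Longrightarrow> tensor_action N r x T \<in> carrier (tensor_space N r)"
  by (auto simp: tensor_action_eq tensor_space_carrier)

section \<open>The endomorphism algebra of the tensor space\<close>

abbreviation tensor_End :: "nat \<Rightarrow> nat \<Rightarrow> (rat, (nat list \<Rightarrow> rat) \<Rightarrow> nat list \<Rightarrow> rat) module" where
  "tensor_End N r \<equiv> End_alg (tensor_space N r)"

lemma tensor_End_carrier:
  "f \<in> carrier (tensor_End N r) \<longleftrightarrow>
     f \<in> carrier (tensor_space N r) \<rightarrow>\<^sub>E carrier (tensor_space N r) \<and>
     (\<forall>S \<in> carrier (tensor_space N r). \<forall>T \<in> carrier (tensor_space N r).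
        f (\<lambda>w. S w + T w) = (\<lambda>w. f S w + f T w)) \<and>
     (\<forall>c. \<forall>T \<in> carrier (tensor_space N r). f (\<lambda>w. c * T w) = (\<lambda>w. c * f T w))"
  by (auto simp: End_alg_def)

lemma tensor_End_simps:
  "f \<otimes>\<^bsub>tensor_End N r\<^esub> g = compose (carrier (tensor_space N r)) f g"
  "\<one>\<^bsub>tensor_End N r\<^esub> = (\<lambda>T \<in> carrier (tensor_space N r). T)"
  "\<zero>\<^bsub>tensor_End N r\<^esub> = (\<lambda>T \<in> carrier (tensor_space N r). \<lambda>w. 0)"
  "f \<oplus>\<^bsub>tensor_End N r\<^esub> g = (\<lambda>T \<in> carrier (tensor_space N r). \<lambda>w. f T w + g T w)"
  "c \<odot>\<^bsub>tensor_End N r\<^esub> f = (\<lambda>T \<in> carrier (tensor_space N r). \<lambda>w. c * f T w)"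
  by (simp_all add: End_alg_def)

lemma tensor_End_mem:
  assumes "f \<in> carrier (tensor_End N r)"
  shows "T \<in> carrier (tensor_space N r) \<Longrightarrow> f T \<in> carrier (tensor_space N r)"
    and "f \<in> extensional (carrier (tensor_space N r))"
    and "S \<in> carrier (tensor_space N r) \<Longrightarrow> T \<in> carrier (tensor_space N r) \<Longrightarrow>
        f (\<lambda>w. S w + T w) = (\<lambda>w. f S w + f T w)"
    and "T \<in> carrier (tensor_space N r) \<Longrightarrow> f (\<lambda>w. c * T w) = (\<lambda>w. c * f T w)"
  using assms by (auto simp: tensor_End_carrier PiE_def)

lemma tensor_End_smult_closed:
  "f \<in> carrier (tensor_End N r) \<Longrightarrow> c \<odot>\<^bsub>tensor_End N r\<^esub> f \<in> carrier (tensor_End N r)"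
  by (auto simp: tensor_End_carrier tensor_End_simps algebra_simps)

lemma tensor_End_apply:
  assumes "T \<in> carrier (tensor_space N r)"
  shows "(f \<otimes>\<^bsub>tensor_End N r\<^esub> g) T = f (g T)"
    and "\<one>\<^bsub>tensor_End N r\<^esub> T = T"
    and "\<zero>\<^bsub>tensor_End N r\<^esub> T = (\<lambda>w. 0)"
    and "(f \<oplus>\<^bsub>tensor_End N r\<^esub> g) T = (\<lambda>w. f T w + g T w)"
    and "(c \<odot>\<^bsub>tensor_End N r\<^esub> f) T = (\<lambda>w. c * f T w)"
  using assms by (simp_all add: tensor_End_simps compose_def)

lemma tensor_End_eqI:
  assumes "f \<in> carrier (tensor_End N r)" "g \<in> carrier (tensor_End N r)"
    "\<And>T. T \<in> carrier (tensor_space N r) \<Longrightarrow> f T = g T"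
  shows "f = g"
  using tensor_End_mem(2)[OF assms(1)] tensor_End_mem(2)[OF assms(2)] assms(3)
  by (rule extensionalityI)

lemma tensor_End_closed:
  "\<one>\<^bsub>tensor_End N r\<^esub> \<in> carrier (tensor_End N r)"
  "\<zero>\<^bsub>tensor_End N r\<^esub> \<in> carrier (tensor_End N r)"
  "f \<in> carrier (tensor_End N r) \<Longrightarrow> g \<in> carrier (tensor_End N r) \<Longrightarrow>
    f \<oplus>\<^bsub>tensor_End N r\<^esub> g \<in> carrier (tensor_End N r)"
  "f \<in> carrier (tensor_End N r) \<Longrightarrow> g \<in> carrier (tensor_End N r) \<Longrightarrow>
    f \<otimes>\<^bsub>tensor_End N r\<^esub> g \<in> carrier (tensor_End N r)"
proof -
  show "\<one>\<^bsub>tensor_End N r\<^esub> \<in> carrier (tensor_End N r)"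
    and "\<zero>\<^bsub>tensor_End N r\<^esub> \<in> carrier (tensor_End N r)"
    by (auto simp: tensor_End_carrier tensor_End_simps)
  assume f: "f \<in> carrier (tensor_End N r)" and g: "g \<in> carrier (tensor_End N r)"
  show "f \<oplus>\<^bsub>tensor_End N r\<^esub> g \<in> carrier (tensor_End N r)"
    "f \<otimes>\<^bsub>tensor_End N r\<^esub> g \<in> carrier (tensor_End N r)"
    using tensor_End_mem[OF f] tensor_End_mem[OF g]
    by (auto simp: tensor_End_carrier tensor_End_simps compose_def algebra_simps)
qed

lemma ring_tensor_End: "ring (tensor_End N r)"
proof (rule ringI)
  let ?A = "tensor_End N r"
  note closed = tensor_End_closed[where N = N and r = r] tensor_End_smult_closed[where N = N and r = r]
  note eqI = tensor_End_eqI[where N = N and r = r]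
  note mem = tensor_End_mem(1,3)[where N = N and r = r]
  show "abelian_group ?A"
  proof (rule abelian_groupI)
    fix f assume f: "f \<in> carrier ?A"
    show "\<exists>g\<in>carrier ?A. g \<oplus>\<^bsub>?A\<^esub> f = \<zero>\<^bsub>?A\<^esub>"
      by (rule bexI[of _ "(-1) \<odot>\<^bsub>?A\<^esub> f"], rule eqI)
        (simp_all add: f closed tensor_End_apply)
  qed (simp_all add: closed, (rule eqI; simp add: closed tensor_End_apply add_ac)+)
  show "Group.monoid ?A"
    by (rule monoidI)
      (simp_all add: closed, (rule eqI; simp add: closed tensor_End_apply mem)+)
  fix f g h assume fgh: "f \<in> carrier ?A" "g \<in> carrier ?A" "h \<in> carrier ?A"
  show "(f \<oplus>\<^bsub>?A\<^esub> g) \<otimes>\<^bsub>?A\<^esub> h = f \<otimes>\<^bsub>?A\<^esub> h \<oplus>\<^bsub>?A\<^esub> g \<otimes>\<^bsub>?A\<^esub> h"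
    using fgh by (intro eqI closed) (simp_all add: tensor_End_apply mem)
  show "h \<otimes>\<^bsub>?A\<^esub> (f \<oplus>\<^bsub>?A\<^esub> g) = h \<otimes>\<^bsub>?A\<^esub> f \<oplus>\<^bsub>?A\<^esub> h \<otimes>\<^bsub>?A\<^esub> g"
    using fgh by (intro eqI closed) (simp_all add: tensor_End_apply mem)
qed

lemma tensor_action_End: "tensor_action N r x \<in> carrier (tensor_End N r)"
proof -
  have "tensor_action N r x \<in> extensional (carrier (tensor_space N r))"
    by (simp add: tensor_action_def)
  then show ?thesis
    by (auto simp: tensor_End_carrier PiE_def tensor_action_eq deriv_action_add deriv_action_scale
        fun_eq_iff tensor_space_carrier)
qed

section \<open>Extension of the tensor action to the enveloping algebra\<close>

locale tensor_representation = mat_lie_algebra L for L +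
  fixes N r :: nat
  assumes L_carrier: "L \<subseteq> carrier_mat N N"
begin

abbreviation "V \<equiv> carrier (tensor_space N r)"
abbreviation "A \<equiv> tensor_End N r"
abbreviation "\<rho> \<equiv> tensor_action N r"
abbreviation "ev \<equiv> free_eval A \<rho>"
abbreviation "rep \<equiv> uea_eval A \<rho>"

sublocale A: ring A by (rule ring_tensor_End)

abbreviation "word_act ws \<equiv> foldr (\<lambda>x b. \<rho> x \<otimes>\<^bsub>A\<^esub> b) ws \<one>\<^bsub>A\<^esub>"

lemma word_act_closed: "word_act ws \<in> carrier A"
  by (induction ws) (auto intro: tensor_action_End)

lemma finsum_A:
  assumes "finite S" "\<And>s. s \<in> S \<Longrightarrow> f s \<in> carrier A" "T \<in> V"
  shows "finsum A f S T w = (\<Sum>s\<in>S. f s T w)"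
  using assms(1,2)
proof (induction S rule: finite_induct)
  case (insert s S)
  have "finsum A f (insert s S) = f s \<oplus>\<^bsub>A\<^esub> finsum A f S"
    using insert by (intro A.finsum_insert) auto
  then show ?case using insert assms(3) by (simp add: tensor_End_simps)
qed (use assms(3) in \<open>simp add: tensor_End_simps\<close>)

lemma ev_closed: "ev p \<in> carrier A"
  unfolding free_eval_def
  by (intro A.finsum_closed) (auto intro: tensor_End_smult_closed word_act_closed)

text \<open>Allowing any finite \<open>S\<close> containing the support lets elements with different
  supports be evaluated over a common index set.\<close>

lemma ev_apply:
  assumes "p \<in> carrier F" "T \<in> V" "finite S" "{ws. p ws \<noteq> 0} \<subseteq> S"
  shows "ev p T w = (\<Sum>ws\<in>S. p ws * word_act ws T w)"
proof -
  have "ev p T w = (\<Sum>ws | p ws \<noteq> 0. (p ws \<odot>\<^bsub>A\<^esub> word_act ws) T w)"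
    unfolding free_eval_def using assms finite_subset
    by (intro finsum_A) (auto intro: tensor_End_smult_closed word_act_closed)
  also have "\<dots> = (\<Sum>ws | p ws \<noteq> 0. p ws * word_act ws T w)"
    using assms(2) by (simp add: tensor_End_simps)
  also have "\<dots> = (\<Sum>ws\<in>S. p ws * word_act ws T w)"
    using assms by (intro sum.mono_neutral_left) auto
  finally show ?thesis .
qed

lemma A_eqI:
  assumes "f \<in> carrier A" "g \<in> carrier A" "\<And>T w. T \<in> V \<Longrightarrow> f T w = g T w"
  shows "f = g"
  using assms tensor_End_mem(2) by (intro extensionalityI[of _ V]) (auto simp: fun_eq_iff)

lemma ev_const: "ev (c \<odot>\<^bsub>F\<^esub> \<one>\<^bsub>F\<^esub>) = c \<odot>\<^bsub>A\<^esub> \<one>\<^bsub>A\<^esub>"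
proof (rule A_eqI)
  fix T w assume T: "T \<in> V"
  have "ev (c \<odot>\<^bsub>F\<^esub> \<one>\<^bsub>F\<^esub>) T w
      = (\<Sum>ws\<in>{[]}. (c \<odot>\<^bsub>F\<^esub> \<one>\<^bsub>F\<^esub>) ws * word_act ws T w)"
    using T by (intro ev_apply) (auto simp: free_algebra_def)
  then show "ev (c \<odot>\<^bsub>F\<^esub> \<one>\<^bsub>F\<^esub>) T w = (c \<odot>\<^bsub>A\<^esub> \<one>\<^bsub>A\<^esub>) T w"
    using T by (simp add: tensor_End_simps) (simp add: free_algebra_def)
qed (auto intro: ev_closed tensor_End_smult_closed)

lemma ev_add:
  assumes p: "p \<in> carrier F" and q: "q \<in> carrier F"
  shows "ev (p \<oplus>\<^bsub>F\<^esub> q) = ev p \<oplus>\<^bsub>A\<^esub> ev q"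
proof (rule A_eqI)
  fix T w assume T: "T \<in> V"
  let ?S = "{ws. p ws \<noteq> 0} \<union> {ws. q ws \<noteq> 0}"
  have S: "finite ?S" using p q by (auto simp: free_algebra_def)
  have pq: "(p \<oplus>\<^bsub>F\<^esub> q) = (\<lambda>w. p w + q w)" by (simp add: free_algebra_def)
  have "ev (p \<oplus>\<^bsub>F\<^esub> q) T w = (\<Sum>ws\<in>?S. (p \<oplus>\<^bsub>F\<^esub> q) ws * word_act ws T w)"
    using p q T S by (intro ev_apply F.a_closed) (auto simp: pq)
  also have "\<dots> = (\<Sum>ws\<in>?S. p ws * word_act ws T w) + (\<Sum>ws\<in>?S. q ws * word_act ws T w)"
    by (simp add: pq sum.distrib algebra_simps)
  also have "\<dots> = ev p T w + ev q T w"
    using ev_apply[OF p T S] ev_apply[OF q T S] by simp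
  finally show "ev (p \<oplus>\<^bsub>F\<^esub> q) T w = (ev p \<oplus>\<^bsub>A\<^esub> ev q) T w"
    using T by (simp add: tensor_End_simps)
qed (auto intro: ev_closed)

lemma ev_gen_mult:
  assumes x: "x \<in> L" and q: "q \<in> carrier F"
  shows "ev (free_gen x \<otimes>\<^bsub>F\<^esub> q) = \<rho> x \<otimes>\<^bsub>A\<^esub> ev q"
proof (rule A_eqI)
  fix T w assume T: "T \<in> V"
  let ?S = "{ws. q ws \<noteq> 0}"
  have S: "finite ?S" using q by (auto simp: free_algebra_def)
  let ?p = "free_gen x \<otimes>\<^bsub>F\<^esub> q"
  have "ev ?p T w = (\<Sum>ws\<in>(#) x ` ?S. ?p ws * word_act ws T w)"
  proof (intro ev_apply)
    show "{ws. ?p ws \<noteq> 0} \<subseteq> (#) x ` ?S"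
      by (auto simp: free_gen_mult neq_Nil_conv split: if_splits)
  qed (use x q T S in auto)
  also have "\<dots> = (\<Sum>ws\<in>?S. q ws * \<rho> x (word_act ws T) w)"
    using T by (subst sum.reindex) (auto simp: free_gen_mult tensor_End_simps compose_def intro!: sum.cong)
  also have "\<dots> = (if w \<in> tensor_words N r
      then deriv_action N x (\<lambda>w. \<Sum>ws\<in>?S. q ws * word_act ws T w) w else 0)"
    using tensor_End_mem(1)[OF word_act_closed T] by (simp add: tensor_action_eq deriv_action_sum)
  also have "(\<lambda>w. \<Sum>ws\<in>?S. q ws * word_act ws T w) = ev q T"
    using ev_apply[OF q T S] by (auto simp: fun_eq_iff)
  finally show "ev ?p T w = (\<rho> x \<otimes>\<^bsub>A\<^esub> ev q) T w"
    using T tensor_End_mem(1)[OF ev_closed[of q] T]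
    by (simp add: tensor_End_simps compose_def tensor_action_eq)
qed (auto intro: ev_closed tensor_action_End)

lemma A_const_mult: "f \<in> carrier A \<Longrightarrow> (c \<odot>\<^bsub>A\<^esub> \<one>\<^bsub>A\<^esub>) \<otimes>\<^bsub>A\<^esub> f = c \<odot>\<^bsub>A\<^esub> f"
  using tensor_End_mem(1)[of f N r]
  by (auto simp: tensor_End_simps compose_def fun_eq_iff restrict_def)

lemma ev_smult:
  assumes "p \<in> carrier F"
  shows "ev (c \<odot>\<^bsub>F\<^esub> p) = c \<odot>\<^bsub>A\<^esub> ev p"
proof (rule A_eqI)
  fix T w assume T: "T \<in> V"
  let ?S = "{ws. p ws \<noteq> 0}"
  have S: "finite ?S" using assms by (auto simp: free_algebra_def)
  have cp: "c \<odot>\<^bsub>F\<^esub> p = (\<lambda>w. c * p w)" by (simp add: free_algebra_def)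
  have "ev (c \<odot>\<^bsub>F\<^esub> p) T w = (\<Sum>ws\<in>?S. (c \<odot>\<^bsub>F\<^esub> p) ws * word_act ws T w)"
    using assms T S by (intro ev_apply free_smult_closed) (auto simp: cp)
  then show "ev (c \<odot>\<^bsub>F\<^esub> p) T w = (c \<odot>\<^bsub>A\<^esub> ev p) T w"
    using T ev_apply[OF assms T S] by (simp add: cp tensor_End_simps sum_distrib_left mult.assoc)
qed (auto intro: ev_closed tensor_End_smult_closed)

text \<open>Induction on the left factor leaves only products with a constant or a generator, which
  have been computed directly.\<close>

lemma ev_mult:
  assumes p: "p \<in> carrier F" and q: "q \<in> carrier F"
  shows "ev (p \<otimes>\<^bsub>F\<^esub> q) = ev p \<otimes>\<^bsub>A\<^esub> ev q"
  using p
proof (induction p rule: free_algebra_induct)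
  case (const c)
  show ?case using q by (simp add: free_const_mult ev_const ev_smult A_const_mult ev_closed)
next
  case (gen x p)
  then show ?case using q
    by (simp add: F.m_assoc A.m_assoc ev_gen_mult ev_closed tensor_action_End)
next
  case (add p p')
  then show ?case using q by (simp add: F.l_distr A.l_distr ev_add ev_closed)
qed

lemma ev_one: "ev \<one>\<^bsub>F\<^esub> = \<one>\<^bsub>A\<^esub>"
proof -
  have 1: "1 \<odot>\<^bsub>F\<^esub> \<one>\<^bsub>F\<^esub> = \<one>\<^bsub>F\<^esub>" by (simp add: free_algebra_def)
  have "1 \<odot>\<^bsub>A\<^esub> \<one>\<^bsub>A\<^esub> = \<one>\<^bsub>A\<^esub>" by (simp add: tensor_End_simps fun_eq_iff)
  then show ?thesis using ev_const[of 1] 1 by simp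
qed

sublocale ev: ring_hom_ring F A ev
  by (rule ring_hom_ringI2[OF F.ring_axioms A.ring_axioms])
    (auto simp: ring_hom_def ev_closed ev_mult ev_add ev_one)

lemma ev_gen: "x \<in> L \<Longrightarrow> ev (free_gen x) = \<rho> x"
  using ev_gen_mult[of x "\<one>\<^bsub>F\<^esub>"] by (simp add: ev_one tensor_action_End)

text \<open>Subtraction in the ring goes through an abstractly given additive inverse; adding
  \<open>g\<close> back recovers the pointwise value.\<close>

lemma A_minus_apply:
  assumes "f \<in> carrier A" "g \<in> carrier A" "T \<in> V"
  shows "(f \<ominus>\<^bsub>A\<^esub> g) T w = f T w - g T w"
proof -
  have "(f \<ominus>\<^bsub>A\<^esub> g) \<oplus>\<^bsub>A\<^esub> g = f" using assms by (simp add: A.minus_eq A.a_assoc A.l_neg)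
  moreover have "((f \<ominus>\<^bsub>A\<^esub> g) \<oplus>\<^bsub>A\<^esub> g) T w = (f \<ominus>\<^bsub>A\<^esub> g) T w + g T w"
    using assms(3) unfolding tensor_End_simps by simp
  ultimately have "(f \<ominus>\<^bsub>A\<^esub> g) T w + g T w = f T w" by simp
  then show ?thesis by simp
qed

lemma action_add: "x \<in> L \<Longrightarrow> y \<in> L \<Longrightarrow> \<rho> (x + y) = \<rho> x \<oplus>\<^bsub>A\<^esub> \<rho> y"
  using L_carrier
  by (intro A_eqI A.a_closed tensor_action_End)
    (auto simp: tensor_End_simps tensor_action_eq deriv_action_mat_add subset_iff)

lemma action_smult: "x \<in> L \<Longrightarrow> \<rho> (c \<cdot>\<^sub>m x) = c \<odot>\<^bsub>A\<^esub> \<rho> x"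
  using L_carrier
  by (intro A_eqI tensor_End_smult_closed tensor_action_End)
    (auto simp: tensor_End_simps tensor_action_eq deriv_action_mat_smult subset_iff)

lemma action_bracket:
  assumes x: "x \<in> L" and y: "y \<in> L"
  shows "\<rho> (lie_bracket x y) = \<rho> x \<otimes>\<^bsub>A\<^esub> \<rho> y \<ominus>\<^bsub>A\<^esub> \<rho> y \<otimes>\<^bsub>A\<^esub> \<rho> x"
proof (rule A_eqI)
  fix T w assume T: "T \<in> V"
  have comp: "(\<rho> x \<otimes>\<^bsub>A\<^esub> \<rho> y) T w
      = (if w \<in> tensor_words N r then deriv_action N x (deriv_action N y T) w else 0)" for x y
    using T by (auto simp: tensor_End_simps compose_def tensor_action_eq
        tensor_action_eq[of "\<lambda>w. if w \<in> tensor_words N r then deriv_action N y T w else 0"]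
        tensor_space_carrier intro: deriv_action_cong)
  have "x \<in> carrier_mat N N" "y \<in> carrier_mat N N" using x y L_carrier by auto
  then show "\<rho> (lie_bracket x y) T w = (\<rho> x \<otimes>\<^bsub>A\<^esub> \<rho> y \<ominus>\<^bsub>A\<^esub> \<rho> y \<otimes>\<^bsub>A\<^esub> \<rho> x) T w"
    using T by (simp add: A_minus_apply tensor_action_End comp tensor_action_eq deriv_action_bracket)
qed (auto intro: tensor_action_End)

text \<open>The kernel is an ideal, so it is enough to kill the three families of relations; they go
  to \<open>action_add\<close>, \<open>action_smult\<close> and
  \<open>action_bracket\<close>.\<close>

lemma ideal_le_kernel: "uea_ideal L \<subseteq> a_kernel F A ev"
  unfolding uea_ideal_def
proof (rule F.genideal_minimal[OF ev.kernel_is_ideal], rule subsetI)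
  fix q assume q: "q \<in> uea_relations L"
  have min: "ev (p \<ominus>\<^bsub>F\<^esub> p') = ev p \<ominus>\<^bsub>A\<^esub> ev p'"
    if "p \<in> carrier F" "p' \<in> carrier F" for p p'
    unfolding a_minus_def ev.hom_add[OF that(1) F.a_inv_closed[OF that(2)]]
      ev.hom_a_inv[OF that(2)] ..
  have mem: "p \<ominus>\<^bsub>F\<^esub> p' \<in> a_kernel F A ev"
    if p: "p \<in> carrier F" "p' \<in> carrier F" and eq: "ev p = ev p'" for p p'
  proof -
    have "ev (p \<ominus>\<^bsub>F\<^esub> p') = \<zero>\<^bsub>A\<^esub>"
      unfolding min[OF p] eq unfolding a_minus_def by (rule A.r_neg[OF ev_closed])
    then show ?thesis
      unfolding a_kernel_def' using F.minus_closed[OF p] by blast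
  qed
  note g = free_gen_closed[of _ L]
  from q show "q \<in> a_kernel F A ev"
    unfolding uea_relations_def Let_def
  proof (elim UnE CollectE exE conjE)
    fix x y assume xy: "x \<in> L" "y \<in> L"
    show "q \<in> a_kernel F A ev"
      if "q = free_gen (x + y) \<ominus>\<^bsub>F\<^esub> (free_gen x \<oplus>\<^bsub>F\<^esub> free_gen y)"
      unfolding that using g[OF xy(1)] g[OF xy(2)] g[OF add_closed[OF xy]] xy add_closed[OF xy]
      by (intro mem F.a_closed) (simp_all only: ev_add ev_gen action_add)
    show "q \<in> a_kernel F A ev"
      if "q = free_gen (lie_bracket x y)
          \<ominus>\<^bsub>F\<^esub> (free_gen x \<otimes>\<^bsub>F\<^esub> free_gen y \<ominus>\<^bsub>F\<^esub> free_gen y \<otimes>\<^bsub>F\<^esub> free_gen x)"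
      unfolding that
      using g[OF xy(1)] g[OF xy(2)] g[OF bracket_closed[OF xy]] xy bracket_closed[OF xy]
      by (intro mem F.minus_closed F.m_closed)
        (simp_all only: min F.m_closed ev_mult ev_gen action_bracket)
  next
    fix c x assume x: "x \<in> L"
    show "q \<in> a_kernel F A ev"
      if "q = free_gen (c \<cdot>\<^sub>m x) \<ominus>\<^bsub>F\<^esub> (c \<odot>\<^bsub>F\<^esub> free_gen x)"
      unfolding that using g[OF x] g[OF smult_closed[OF x]] x smult_closed[OF x]
      by (intro mem free_smult_closed) (simp_all only: ev_smult ev_gen action_smult)
  qed
qed

text \<open>Members of a coset differ by elements that \<open>ev\<close> kills, so the image of the
  coset is a singleton and \<open>the_elem\<close> in \<open>uea_eval\<close> picks its only
  element.\<close>

lemma rep_proj: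
  assumes p: "p \<in> carrier F"
  shows "rep (proj p) = ev p"
proof -
  have "ev q = ev p" if "q \<in> proj p" for q
  proof -
    have "q \<in> (\<Union>i\<in>uea_ideal L. {i \<oplus>\<^bsub>F\<^esub> p})"
      using that unfolding a_r_coset_def' .
    then obtain i where i: "i \<in> uea_ideal L" "q = i \<oplus>\<^bsub>F\<^esub> p"
      by (elim UN_E singletonE)
    then have "i \<in> carrier F" "ev i = \<zero>\<^bsub>A\<^esub>"
      using subsetD[OF ideal_le_kernel i(1)] unfolding a_kernel_def' by blast+
    then show ?thesis
      unfolding i(2) by (simp only: ev_add[OF _ p] A.l_zero ev_closed)
  qed
  moreover have "p \<in> proj p" using I.a_rcos_self[OF p] .
  ultimately have "ev ` (proj p) = {ev p}" by blast
  then show ?thesis by (simp add: uea_eval_def)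
qed

sublocale rep: ring_hom_ring U A rep
proof (rule ring_hom_ringI2[OF U.ring_axioms A.ring_axioms], rule ring_hom_memI)
  fix u assume "u \<in> carrier U"
  then obtain p where "p \<in> carrier F" "u = proj p" unfolding carrier_U by blast
  then show "rep u \<in> carrier A" by (simp only: rep_proj ev_closed)
next
  fix u v assume "u \<in> carrier U" "v \<in> carrier U"
  then obtain p q where pq: "p \<in> carrier F" "q \<in> carrier F" and uv: "u = proj p" "v = proj q"
    unfolding carrier_U by blast
  show "rep (u \<otimes>\<^bsub>U\<^esub> v) = rep u \<otimes>\<^bsub>A\<^esub> rep v"
    unfolding uv proj.hom_mult[OF pq, symmetric] using pq
    by (simp only: rep_proj ev_mult F.m_closed)
  show "rep (u \<oplus>\<^bsub>U\<^esub> v) = rep u \<oplus>\<^bsub>A\<^esub> rep v"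
    unfolding uv proj.hom_add[OF pq, symmetric] using pq
    by (simp only: rep_proj ev_add F.a_closed)
next
  show "rep \<one>\<^bsub>U\<^esub> = \<one>\<^bsub>A\<^esub>"
    unfolding proj.hom_one[symmetric] by (simp only: rep_proj ev_one F.one_closed)
qed

lemma rep_gen: "x \<in> L \<Longrightarrow> rep (gen x) = \<rho> x"
  by (simp add: uea_gen_def rep_proj ev_gen)

lemma rep_scal: "T \<in> V \<Longrightarrow> rep (scal c) T = (\<lambda>w. c * T w)"
  by (simp add: uea_scalar_def rep_proj ev_const tensor_End_simps)

definition tensor_module :: "((rat mat list \<Rightarrow> rat) set, nat list \<Rightarrow> rat) module" where
  "tensor_module = \<lparr> carrier = V, mult = undefined, one = undefined,
     zero = (\<lambda>w. 0), add = (\<lambda>S T w. S w + T w), module.smult = rep \<rparr>"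

lemma tensor_module_simps [simp]:
  "carrier tensor_module = V"
  "\<zero>\<^bsub>tensor_module\<^esub> = (\<lambda>w. 0)"
  "S \<oplus>\<^bsub>tensor_module\<^esub> T = (\<lambda>w. S w + T w)"
  "u \<odot>\<^bsub>tensor_module\<^esub> T = rep u T"
  by (simp_all add: tensor_module_def)

lemma left_module_tensor: "left_module U tensor_module"
proof (intro left_module.intro left_module_axioms.intro U.ring_axioms)
  show "abelian_group tensor_module"
  proof (rule abelian_groupI)
    fix T assume "T \<in> carrier tensor_module"
    then show "\<exists>S\<in>carrier tensor_module. S \<oplus>\<^bsub>tensor_module\<^esub> T = \<zero>\<^bsub>tensor_module\<^esub>"
      by (intro bexI[of _ "\<lambda>w. - T w"]) auto
  qed (auto simp: add_ac)
next
  fix u T assume u: "u \<in> carrier U" and "T \<in> carrier tensor_module"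
  then show "u \<odot>\<^bsub>tensor_module\<^esub> T \<in> carrier tensor_module"
    unfolding tensor_module_simps by (rule tensor_End_mem(1)[OF rep.hom_closed])
next
  fix u v T assume u: "u \<in> carrier U" "v \<in> carrier U" and "T \<in> carrier tensor_module"
  then have T: "T \<in> V" by simp
  show "(u \<oplus>\<^bsub>U\<^esub> v) \<odot>\<^bsub>tensor_module\<^esub> T
      = u \<odot>\<^bsub>tensor_module\<^esub> T \<oplus>\<^bsub>tensor_module\<^esub> v \<odot>\<^bsub>tensor_module\<^esub> T"
    unfolding tensor_module_simps rep.hom_add[OF u] tensor_End_apply[OF T] ..
  show "(u \<otimes>\<^bsub>U\<^esub> v) \<odot>\<^bsub>tensor_module\<^esub> T
      = u \<odot>\<^bsub>tensor_module\<^esub> (v \<odot>\<^bsub>tensor_module\<^esub> T)"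
    unfolding tensor_module_simps rep.hom_mult[OF u] tensor_End_apply[OF T] ..
next
  fix u S T assume "u \<in> carrier U" "S \<in> carrier tensor_module" "T \<in> carrier tensor_module"
  then show "u \<odot>\<^bsub>tensor_module\<^esub> (S \<oplus>\<^bsub>tensor_module\<^esub> T)
      = u \<odot>\<^bsub>tensor_module\<^esub> S \<oplus>\<^bsub>tensor_module\<^esub> u \<odot>\<^bsub>tensor_module\<^esub> T"
    unfolding tensor_module_simps by (rule tensor_End_mem(3)[OF rep.hom_closed])
next
  fix T assume "T \<in> carrier tensor_module"
  then show "\<one>\<^bsub>U\<^esub> \<odot>\<^bsub>tensor_module\<^esub> T = T"
    unfolding tensor_module_simps rep.hom_one by (rule tensor_End_apply(2))
qed

end

section \<open>Left modules\<close>

context left_module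
begin

lemma smult_r_null [simp]: "a \<in> carrier R \<Longrightarrow> a \<odot>\<^bsub>M\<^esub> \<zero>\<^bsub>M\<^esub> = \<zero>\<^bsub>M\<^esub>"
proof -
  assume a: "a \<in> carrier R"
  have "a \<odot>\<^bsub>M\<^esub> \<zero>\<^bsub>M\<^esub> \<oplus>\<^bsub>M\<^esub> a \<odot>\<^bsub>M\<^esub> \<zero>\<^bsub>M\<^esub> = a \<odot>\<^bsub>M\<^esub> \<zero>\<^bsub>M\<^esub>"
    using a smult_r_distr[of a "\<zero>\<^bsub>M\<^esub>" "\<zero>\<^bsub>M\<^esub>"] by simp
  then show ?thesis using a M.add.r_cancel_one[of "a \<odot>\<^bsub>M\<^esub> \<zero>\<^bsub>M\<^esub>" "a \<odot>\<^bsub>M\<^esub> \<zero>\<^bsub>M\<^esub>"] by simp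
qed

lemma smult_l_null [simp]: "x \<in> carrier M \<Longrightarrow> \<zero> \<odot>\<^bsub>M\<^esub> x = \<zero>\<^bsub>M\<^esub>"
proof -
  assume x: "x \<in> carrier M"
  have "\<zero> \<odot>\<^bsub>M\<^esub> x \<oplus>\<^bsub>M\<^esub> \<zero> \<odot>\<^bsub>M\<^esub> x = \<zero> \<odot>\<^bsub>M\<^esub> x"
    using x smult_l_distr[of \<zero> \<zero> x] by simp
  then show ?thesis using x M.add.r_cancel_one[of "\<zero> \<odot>\<^bsub>M\<^esub> x" "\<zero> \<odot>\<^bsub>M\<^esub> x"] by simp
qed

lemma smult_l_minus:
  assumes "a \<in> carrier R" "x \<in> carrier M"
  shows "(\<ominus> a) \<odot>\<^bsub>M\<^esub> x = \<ominus>\<^bsub>M\<^esub> (a \<odot>\<^bsub>M\<^esub> x)"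
proof -
  have "(\<ominus> a) \<odot>\<^bsub>M\<^esub> x \<oplus>\<^bsub>M\<^esub> a \<odot>\<^bsub>M\<^esub> x = \<zero>\<^bsub>M\<^esub>"
    using assms by (simp add: smult_l_distr[symmetric] R.l_neg)
  then show ?thesis using assms by (intro M.minus_equality[symmetric]) auto
qed

text \<open>Closure under negatives comes from multiplication by the negative of the unit.\<close>

lemma submoduleI:
  assumes sub: "H \<subseteq> carrier M" and zero: "\<zero>\<^bsub>M\<^esub> \<in> H"
    and add: "\<And>x y. x \<in> H \<Longrightarrow> y \<in> H \<Longrightarrow> x \<oplus>\<^bsub>M\<^esub> y \<in> H"
    and smult: "\<And>a x. a \<in> carrier R \<Longrightarrow> x \<in> H \<Longrightarrow> a \<odot>\<^bsub>M\<^esub> x \<in> H"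
  shows "submodule H R M"
proof (intro submodule.intro subgroup.intro submodule_axioms.intro)
  fix x assume x: "x \<in> H"
  have "\<ominus>\<^bsub>M\<^esub> x \<in> H"
    using smult[OF _ x, of "\<ominus> \<one>"] smult_l_minus[of \<one> x] x sub by auto
  then show "inv\<^bsub>add_monoid M\<^esub> x \<in> H" by (simp add: a_inv_def)
qed (use assms in auto)

lemma submoduleD:
  assumes "submodule H R M"
  shows "H \<subseteq> carrier M" "\<zero>\<^bsub>M\<^esub> \<in> H"
    "x \<in> H \<Longrightarrow> y \<in> H \<Longrightarrow> x \<oplus>\<^bsub>M\<^esub> y \<in> H"
    "a \<in> carrier R \<Longrightarrow> x \<in> H \<Longrightarrow> a \<odot>\<^bsub>M\<^esub> x \<in> H"
  using submodule.axioms(1)[OF assms] submodule.smult_closed[OF assms]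
  by (auto simp: subgroup_def)

lemma cyclic_submodule:
  assumes "v \<in> carrier M"
  shows "submodule {a \<odot>\<^bsub>M\<^esub> v | a. a \<in> carrier R} R M"
proof (rule submoduleI)
  show "\<zero>\<^bsub>M\<^esub> \<in> {a \<odot>\<^bsub>M\<^esub> v | a. a \<in> carrier R}"
    using assms by (auto intro!: exI[of _ \<zero>])
  show "x \<oplus>\<^bsub>M\<^esub> y \<in> {a \<odot>\<^bsub>M\<^esub> v | a. a \<in> carrier R}"
    if "x \<in> {a \<odot>\<^bsub>M\<^esub> v | a. a \<in> carrier R}" "y \<in> {a \<odot>\<^bsub>M\<^esub> v | a. a \<in> carrier R}" for x y
    using that assms smult_l_distr[symmetric] by blast
  show "b \<odot>\<^bsub>M\<^esub> x \<in> {a \<odot>\<^bsub>M\<^esub> v | a. a \<in> carrier R}"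
    if "b \<in> carrier R" "x \<in> {a \<odot>\<^bsub>M\<^esub> v | a. a \<in> carrier R}" for b x
    using that assms smult_assoc1[symmetric] by blast
qed (use assms in auto)

end

lemma simple_module_cyclic:
  assumes "simple_module R M" "v \<in> carrier M" "v \<noteq> \<zero>\<^bsub>M\<^esub>" "x \<in> carrier M"
  obtains a where "a \<in> carrier R" "x = a \<odot>\<^bsub>M\<^esub> v"
proof -
  interpret left_module R M using assms(1) by (simp add: simple_module_def)
  let ?N = "{a \<odot>\<^bsub>M\<^esub> v | a. a \<in> carrier R}"
  have "v \<in> ?N" using assms(2) by (auto intro!: exI[of _ "\<one>\<^bsub>R\<^esub>"])
  then have "?N = carrier M"
    using assms(1,3) cyclic_submodule[OF assms(2)] unfolding simple_module_def by blast
  then show ?thesis using that assms(4) by blast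
qed

text \<open>A copy of the submodule \<open>W\<close> inside another type. It turns submodules of the
  tensor space into modules over the type \<open>'v\<close> that \<open>gen_schur_ideal\<close>
  ranges over. Going back by \<open>inv_into W g\<close> requires \<open>g\<close> to be injective
  on \<open>W\<close> only.\<close>

definition transport :: "('v \<Rightarrow> 'w) \<Rightarrow> 'v set \<Rightarrow> ('a, 'v) module \<Rightarrow> ('a, 'w) module" where
  "transport g W M = \<lparr> carrier = g ` W, mult = undefined, one = undefined,
     zero = g \<zero>\<^bsub>M\<^esub>,
     add = (\<lambda>x y. g (inv_into W g x \<oplus>\<^bsub>M\<^esub> inv_into W g y)),
     module.smult = (\<lambda>a x. g (a \<odot>\<^bsub>M\<^esub> inv_into W g x)) \<rparr>"

lemma transport_simps:
  assumes "inj_on g W" "x \<in> W" "y \<in> W"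
  shows "g x \<oplus>\<^bsub>transport g W M\<^esub> g y = g (x \<oplus>\<^bsub>M\<^esub> y)"
    and "a \<odot>\<^bsub>transport g W M\<^esub> g x = g (a \<odot>\<^bsub>M\<^esub> x)"
  using assms by (simp_all add: transport_def)

lemma transport_carrier [simp]:
  "carrier (transport g W M) = g ` W" "\<zero>\<^bsub>transport g W M\<^esub> = g \<zero>\<^bsub>M\<^esub>"
  by (simp_all add: transport_def)

lemma left_module_transport:
  assumes "left_module R M" and W: "submodule W R M" and g: "inj_on g W"
  shows "left_module R (transport g W M)"
proof -
  interpret left_module R M by fact
  note W' = submoduleD[OF W]
  have car: "x \<in> carrier M" if "x \<in> W" for x using W'(1) that by auto
  note T = transport_simps[OF g]
  have "abelian_group (transport g W M)"
  proof (rule abelian_groupI)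
    fix x assume "x \<in> carrier (transport g W M)"
    then obtain y where y: "y \<in> W" "x = g y" by auto
    have "(\<ominus>\<^bsub>R\<^esub> \<one>\<^bsub>R\<^esub>) \<odot>\<^bsub>M\<^esub> y \<oplus>\<^bsub>M\<^esub> y = \<zero>\<^bsub>M\<^esub>"
      using car[OF y(1)] by (simp add: smult_l_minus M.l_neg)
    then show "\<exists>z\<in>carrier (transport g W M). z \<oplus>\<^bsub>transport g W M\<^esub> x = \<zero>\<^bsub>transport g W M\<^esub>"
      using y W'(4)[OF _ y(1), of "\<ominus>\<^bsub>R\<^esub> \<one>\<^bsub>R\<^esub>"]
      by (intro bexI[of _ "g ((\<ominus>\<^bsub>R\<^esub> \<one>\<^bsub>R\<^esub>) \<odot>\<^bsub>M\<^esub> y)"]) (auto simp: T)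
  qed (use W' car in \<open>auto simp: T M.a_ac\<close>)
  then show ?thesis
    by (intro left_module.intro left_module_axioms.intro R.ring_axioms)
      (use W' car in \<open>auto simp: T smult_l_distr smult_r_distr smult_assoc1\<close>)
qed

text \<open>A submodule of the copy pulls back along \<open>g\<close> to a submodule of
  \<open>M\<close> inside \<open>W\<close>, where minimality of \<open>W\<close> applies.\<close>

lemma simple_module_transport:
  assumes "left_module R M" and W: "submodule W R M" and g: "inj_on g W"
    and W0: "W \<noteq> {\<zero>\<^bsub>M\<^esub>}"
    and minimal: "\<And>N. submodule N R M \<Longrightarrow> N \<subseteq> W \<Longrightarrow> N = {\<zero>\<^bsub>M\<^esub>} \<or> N = W"
  shows "simple_module R (transport g W M)"
  unfolding simple_module_def
proof (intro conjI allI impI)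
  interpret left_module R M by fact
  note W' = submoduleD[OF W]
  note T = transport_simps[OF g]
  show lm: "left_module R (transport g W M)" by (rule left_module_transport) fact+
  interpret T: left_module R "transport g W M" by fact
  show "carrier (transport g W M) \<noteq> {\<zero>\<^bsub>transport g W M\<^esub>}"
  proof
    assume "carrier (transport g W M) = {\<zero>\<^bsub>transport g W M\<^esub>}"
    then have "W = {\<zero>\<^bsub>M\<^esub>}" using W'(2) g by (auto simp: inj_on_def)
    then show False using W0 by simp
  qed
  fix N assume N: "submodule N R (transport g W M)"
  note N' = T.submoduleD[OF N]
  let ?N = "{x \<in> W. g x \<in> N}"
  have eq: "N = g ` ?N" using N'(1) by auto
  have "submodule ?N R M"
    by (rule submoduleI) (use W' N'(2-4) in \<open>auto simp: T[symmetric]\<close>)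
  then have "?N = {\<zero>\<^bsub>M\<^esub>} \<or> ?N = W" by (intro minimal) auto
  then show "N = {\<zero>\<^bsub>transport g W M\<^esub>} \<or> N = carrier (transport g W M)"
    using eq by (metis (no_types, lifting) image_empty image_insert transport_carrier)
qed

text \<open>The direct sum, in which the cyclic submodule of a pair of maximal vectors links two
  modules whose elements may have different types.\<close>

definition prod_module :: "('a, 'v) module \<Rightarrow> ('a, 'w) module \<Rightarrow> ('a, 'v \<times> 'w) module" where
  "prod_module M M' = \<lparr> carrier = carrier M \<times> carrier M', mult = undefined, one = undefined,
     zero = (\<zero>\<^bsub>M\<^esub>, \<zero>\<^bsub>M'\<^esub>),
     add = (\<lambda>x y. (fst x \<oplus>\<^bsub>M\<^esub> fst y, snd x \<oplus>\<^bsub>M'\<^esub> snd y)),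
     module.smult = (\<lambda>a x. (a \<odot>\<^bsub>M\<^esub> fst x, a \<odot>\<^bsub>M'\<^esub> snd x)) \<rparr>"

lemma prod_module_simps [simp]:
  "carrier (prod_module M M') = carrier M \<times> carrier M'"
  "\<zero>\<^bsub>prod_module M M'\<^esub> = (\<zero>\<^bsub>M\<^esub>, \<zero>\<^bsub>M'\<^esub>)"
  "x \<oplus>\<^bsub>prod_module M M'\<^esub> y = (fst x \<oplus>\<^bsub>M\<^esub> fst y, snd x \<oplus>\<^bsub>M'\<^esub> snd y)"
  "a \<odot>\<^bsub>prod_module M M'\<^esub> x = (a \<odot>\<^bsub>M\<^esub> fst x, a \<odot>\<^bsub>M'\<^esub> snd x)"
  by (simp_all add: prod_module_def)

lemma left_module_prod:
  assumes "left_module R M" "left_module R M'"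
  shows "left_module R (prod_module M M')"
proof -
  interpret M: left_module R M by fact
  interpret M': left_module R M' by fact
  have "abelian_group (prod_module M M')"
  proof (rule abelian_groupI)
    fix x assume "x \<in> carrier (prod_module M M')"
    then show "\<exists>y\<in>carrier (prod_module M M'). y \<oplus>\<^bsub>prod_module M M'\<^esub> x = \<zero>\<^bsub>prod_module M M'\<^esub>"
      by (intro bexI[of _ "(\<ominus>\<^bsub>M\<^esub> fst x, \<ominus>\<^bsub>M'\<^esub> snd x)"]) (auto simp: M.M.l_neg M'.M.l_neg)
  qed (auto simp: M.M.a_ac M'.M.a_ac)
  then show ?thesis
    by (intro left_module.intro left_module_axioms.intro M.R.ring_axioms)
      (auto simp: M.smult_l_distr M'.smult_l_distr M.smult_r_distr M'.smult_r_distr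
        M.smult_assoc1 M'.smult_assoc1)
qed


section \<open>Vectors generated by a maximal vector\<close>

text \<open>An abstract triangular decomposition: \<open>Bor\<close> acts on maximal vectors by
  scalars, \<open>Neg\<close> lowers the eigenvalue of \<open>h0\<close> by positive integers, and
  together they span \<open>L\<close>. Neither set has to be closed under sums or brackets. Spanning
  is phrased as an induction rule, the form in which it is applied.\<close>

locale triangular_lie_algebra = mat_lie_algebra L for L +
  fixes h0 :: "rat mat" and Neg Bor :: "rat mat set"
  assumes Neg_subset: "Neg \<subseteq> L" and Bor_subset: "Bor \<subseteq> L" and h0_Bor: "h0 \<in> Bor"
    and Neg_lowers: "\<And>f. f \<in> Neg \<Longrightarrow> \<exists>k\<ge>1. lie_bracket h0 f = (- of_nat k) \<cdot>\<^sub>m f"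
    and span_induct: "\<And>x P. x \<in> L \<Longrightarrow> (\<And>y. y \<in> Neg \<union> Bor \<Longrightarrow> P y) \<Longrightarrow>
        (\<And>y z. y \<in> L \<Longrightarrow> z \<in> L \<Longrightarrow> P y \<Longrightarrow> P z \<Longrightarrow> P (y + z)) \<Longrightarrow>
        (\<And>c y. y \<in> L \<Longrightarrow> P y \<Longrightarrow> P (c \<cdot>\<^sub>m y)) \<Longrightarrow> P x"

locale triangular_module = triangular_lie_algebra L h0 Neg Bor + M: left_module "uea L" M
  for L h0 Neg Bor and M :: "((rat mat list \<Rightarrow> rat) set, 'v) module"
begin

lemma h0_L: "h0 \<in> L" using h0_Bor Bor_subset by auto

lemma scal_gen_swap:
  "x \<in> L \<Longrightarrow> m \<in> carrier M \<Longrightarrow> gen x \<odot>\<^bsub>M\<^esub> (scal c \<odot>\<^bsub>M\<^esub> m) = scal c \<odot>\<^bsub>M\<^esub> (gen x \<odot>\<^bsub>M\<^esub> m)"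
  using scal_central[of "gen x" c] by (simp add: M.smult_assoc1[symmetric])

lemma scal_scal: "m \<in> carrier M \<Longrightarrow> scal c \<odot>\<^bsub>M\<^esub> (scal d \<odot>\<^bsub>M\<^esub> m) = scal (c * d) \<odot>\<^bsub>M\<^esub> m"
  by (simp add: M.smult_assoc1[symmetric] scal_mult)

lemma scal_plus: "m \<in> carrier M \<Longrightarrow> scal c \<odot>\<^bsub>M\<^esub> m \<oplus>\<^bsub>M\<^esub> scal d \<odot>\<^bsub>M\<^esub> m = scal (c + d) \<odot>\<^bsub>M\<^esub> m"
  by (simp add: M.smult_l_distr[symmetric] scal_add)

lemma scal_one_act [simp]: "m \<in> carrier M \<Longrightarrow> scal 1 \<odot>\<^bsub>M\<^esub> m = m"
  by (simp add: scal_one)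

lemma scal_zero_act [simp]: "m \<in> carrier M \<Longrightarrow> scal 0 \<odot>\<^bsub>M\<^esub> m = \<zero>\<^bsub>M\<^esub>"
  by (simp add: scal_zero)

lemma scal_cancel:
  assumes "m \<in> carrier M" "m' \<in> carrier M" "c \<noteq> 0" "scal c \<odot>\<^bsub>M\<^esub> m = scal c \<odot>\<^bsub>M\<^esub> m'"
  shows "m = m'"
proof -
  have "scal (1 / c) \<odot>\<^bsub>M\<^esub> (scal c \<odot>\<^bsub>M\<^esub> m) = scal (1 / c) \<odot>\<^bsub>M\<^esub> (scal c \<odot>\<^bsub>M\<^esub> m')"
    using assms(4) by simp
  then show ?thesis using assms(1-3) by (simp add: scal_scal)
qed

lemma gen_swap:
  assumes "x \<in> L" "y \<in> L" "m \<in> carrier M"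
  shows "gen x \<odot>\<^bsub>M\<^esub> (gen y \<odot>\<^bsub>M\<^esub> m)
    = gen y \<odot>\<^bsub>M\<^esub> (gen x \<odot>\<^bsub>M\<^esub> m) \<oplus>\<^bsub>M\<^esub> gen (lie_bracket x y) \<odot>\<^bsub>M\<^esub> m"
proof -
  have c: "gen x \<in> carrier U" "gen y \<in> carrier U" using assms by auto
  have "gen x \<otimes>\<^bsub>U\<^esub> gen y = gen y \<otimes>\<^bsub>U\<^esub> gen x \<oplus>\<^bsub>U\<^esub> gen (lie_bracket x y)"
    using c unfolding gen_bracket[OF assms(1,2)] a_minus_def
    by (simp add: U.a_comm U.a_assoc U.l_neg U.add.m_lcomm U.r_neg)
  then have "(gen x \<otimes>\<^bsub>U\<^esub> gen y) \<odot>\<^bsub>M\<^esub> m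
      = (gen y \<otimes>\<^bsub>U\<^esub> gen x \<oplus>\<^bsub>U\<^esub> gen (lie_bracket x y)) \<odot>\<^bsub>M\<^esub> m" by simp
  then show ?thesis
    using assms c gen_closed[OF bracket_closed[OF assms(1,2)]]
    by (simp add: M.smult_assoc1 M.smult_l_distr)
qed

lemma gen_smult_act:
  "x \<in> L \<Longrightarrow> m \<in> carrier M \<Longrightarrow> gen (c \<cdot>\<^sub>m x) \<odot>\<^bsub>M\<^esub> m = scal c \<odot>\<^bsub>M\<^esub> (gen x \<odot>\<^bsub>M\<^esub> m)"
  by (simp add: gen_smult M.smult_assoc1)

lemma gen_add_act:
  "x \<in> L \<Longrightarrow> y \<in> L \<Longrightarrow> m \<in> carrier M \<Longrightarrow>
    gen (x + y) \<odot>\<^bsub>M\<^esub> m = gen x \<odot>\<^bsub>M\<^esub> m \<oplus>\<^bsub>M\<^esub> gen y \<odot>\<^bsub>M\<^esub> m"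
  by (simp add: gen_add M.smult_l_distr)

text \<open>An eigenvector \<open>x\<close> of the adjoint action of \<open>h0\<close> adds its
  eigenvalue, since h0 x = x h0 + [h0, x].\<close>

lemma eigenvalue_shift:
  assumes x: "x \<in> L" and m: "m \<in> carrier M"
    and xm: "gen h0 \<odot>\<^bsub>M\<^esub> m = scal a \<odot>\<^bsub>M\<^esub> m" and br: "lie_bracket h0 x = b \<cdot>\<^sub>m x"
  shows "gen h0 \<odot>\<^bsub>M\<^esub> (gen x \<odot>\<^bsub>M\<^esub> m) = scal (a + b) \<odot>\<^bsub>M\<^esub> (gen x \<odot>\<^bsub>M\<^esub> m)"
  using x m gen_swap[OF h0_L x m] by (simp add: xm br scal_gen_swap gen_smult_act scal_plus)

text \<open>The sum of the eigenspaces of \<open>h0\<close> at distance 1, 2, 3, ... below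
  \<open>a\<close>. Each member involves only finitely many eigenvalues, so a single polynomial in
  \<open>h0\<close> kills it.\<close>

inductive lower :: "rat \<Rightarrow> 'v \<Rightarrow> bool" for a where
  eigen: "m \<in> carrier M \<Longrightarrow> k \<ge> 1 \<Longrightarrow> gen h0 \<odot>\<^bsub>M\<^esub> m = scal (a - of_nat k) \<odot>\<^bsub>M\<^esub> m \<Longrightarrow> lower a m"
| add: "lower a m \<Longrightarrow> lower a m' \<Longrightarrow> lower a (m \<oplus>\<^bsub>M\<^esub> m')"

lemma lower_closed: "lower a m \<Longrightarrow> m \<in> carrier M"
  by (induction rule: lower.induct) auto

lemma lower_zero: "lower a \<zero>\<^bsub>M\<^esub>"
  by (rule lower.eigen[of _ 1]) (auto simp: h0_L)

lemma lower_scal: "lower a m \<Longrightarrow> lower a (scal c \<odot>\<^bsub>M\<^esub> m)"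
proof (induction rule: lower.induct)
  case (eigen m k)
  then show ?case
    by (intro lower.eigen[of _ k]) (auto simp: scal_gen_swap[OF h0_L] scal_scal mult.commute)
next
  case (add m m')
  then show ?case by (simp add: M.smult_r_distr lower_closed lower.add)
qed

lemma lower_Neg:
  assumes f: "f \<in> Neg" and "lower a m"
  shows "lower a (gen f \<odot>\<^bsub>M\<^esub> m)"
  using assms(2)
proof (induction rule: lower.induct)
  case (eigen m k)
  have fL: "f \<in> L" using f Neg_subset by auto
  obtain j where j: "j \<ge> 1" "lie_bracket h0 f = (- of_nat j) \<cdot>\<^sub>m f" using Neg_lowers[OF f] by auto
  have "gen h0 \<odot>\<^bsub>M\<^esub> (gen f \<odot>\<^bsub>M\<^esub> m) = scal (a - of_nat k + - of_nat j) \<odot>\<^bsub>M\<^esub> (gen f \<odot>\<^bsub>M\<^esub> m)"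
    using eigen j fL by (intro eigenvalue_shift) auto
  then show ?case
    using eigen fL by (intro lower.eigen[of _ "k + j"]) (auto simp: algebra_simps)
next
  case (add m m')
  then show ?case using f Neg_subset
    by (subst M.smult_r_distr) (auto simp: lower_closed intro: lower.add)
qed

text \<open>The product of the factors h0 - (a - k) for k = 1, ..., K. It kills the eigenvalues a -
  1, ..., a - K and acts on the eigenvalue \<open>a\<close> by the nonzero scalar K!, which
  separates the top eigenspace from the lower ones.\<close>

primrec lower_killer :: "rat \<Rightarrow> nat \<Rightarrow> (rat mat list \<Rightarrow> rat) set" where
  "lower_killer a 0 = \<one>\<^bsub>U\<^esub>"
| "lower_killer a (Suc K) = (gen h0 \<oplus>\<^bsub>U\<^esub> scal (of_nat (Suc K) - a)) \<otimes>\<^bsub>U\<^esub> lower_killer a K"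

lemma lower_killer_closed [simp]: "lower_killer a K \<in> carrier U"
  by (induction K) (auto simp: h0_L)

lemma lower_killer_eigen:
  assumes m: "m \<in> carrier M" and b: "gen h0 \<odot>\<^bsub>M\<^esub> m = scal b \<odot>\<^bsub>M\<^esub> m"
  shows "lower_killer a K \<odot>\<^bsub>M\<^esub> m = scal (\<Prod>k<K. b - a + of_nat (Suc k)) \<odot>\<^bsub>M\<^esub> m"
proof (induction K)
  case 0
  then show ?case using m by (simp add: scal_one)
next
  case (Suc K)
  let ?p = "\<Prod>k<K. b - a + of_nat (Suc k)"
  have "lower_killer a (Suc K) \<odot>\<^bsub>M\<^esub> m
      = (gen h0 \<oplus>\<^bsub>U\<^esub> scal (of_nat (Suc K) - a)) \<odot>\<^bsub>M\<^esub> (scal ?p \<odot>\<^bsub>M\<^esub> m)"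
    using m h0_L by (simp add: M.smult_assoc1 Suc.IH)
  also have "\<dots> = scal (?p * b + (of_nat (Suc K) - a) * ?p) \<odot>\<^bsub>M\<^esub> m"
    using m by (simp add: M.smult_l_distr h0_L scal_gen_swap b scal_scal scal_plus)
  also have "?p * b + (of_nat (Suc K) - a) * ?p = (\<Prod>k<Suc K. b - a + of_nat (Suc k))"
    by (simp add: algebra_simps)
  finally show ?case .
qed

text \<open>A bound valid for all larger \<open>K\<close> is claimed so that the bounds of two
  summands can be combined by their maximum.\<close>

lemma lower_killer_lower:
  assumes "lower a m"
  shows "\<exists>K0. \<forall>K\<ge>K0. lower_killer a K \<odot>\<^bsub>M\<^esub> m = \<zero>\<^bsub>M\<^esub>"
  using assms
proof (induction rule: lower.induct)
  case (eigen m k)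
  have "lower_killer a K \<odot>\<^bsub>M\<^esub> m = \<zero>\<^bsub>M\<^esub>" if "K \<ge> k" for K
  proof -
    have "(\<Prod>i<K. a - of_nat k - a + of_nat (Suc i)) = (0 :: rat)"
      using that eigen(2) by (intro prod_zero bexI[of _ "k - 1"]) auto
    then show ?thesis unfolding lower_killer_eigen[OF eigen(1,3)] using eigen(1) by (simp only: scal_zero_act)
  qed
  then show ?case by blast
next
  case (add m m')
  then obtain K K' where "\<forall>k\<ge>K. lower_killer a k \<odot>\<^bsub>M\<^esub> m = \<zero>\<^bsub>M\<^esub>" "\<forall>k\<ge>K'. lower_killer a k \<odot>\<^bsub>M\<^esub> m' = \<zero>\<^bsub>M\<^esub>"
    by blast
  then show ?case
    using add(1,2) by (intro exI[of _ "max K K'"]) (auto simp: M.smult_r_distr lower_closed)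
qed

text \<open>This stands for the module U(n^-) v; the subalgebra U(n^-) itself is never
  formed.\<close>

inductive neg_span :: "'v \<Rightarrow> 'v \<Rightarrow> bool" for v where
  scal: "neg_span v (scal c \<odot>\<^bsub>M\<^esub> v)"
| neg: "f \<in> Neg \<Longrightarrow> neg_span v m \<Longrightarrow> neg_span v (gen f \<odot>\<^bsub>M\<^esub> m)"
| add: "neg_span v m \<Longrightarrow> neg_span v m' \<Longrightarrow> neg_span v (m \<oplus>\<^bsub>M\<^esub> m')"

context
  fixes v :: 'v and \<chi> :: "rat mat \<Rightarrow> rat"
  assumes v: "v \<in> carrier M"
    and Bor_v: "\<And>b. b \<in> Bor \<Longrightarrow> gen b \<odot>\<^bsub>M\<^esub> v = scal (\<chi> b) \<odot>\<^bsub>M\<^esub> v"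
begin

lemma neg_span_closed: "neg_span v m \<Longrightarrow> m \<in> carrier M"
  by (induction rule: neg_span.induct) (use v Neg_subset in auto)

lemma neg_span_scal: "neg_span v m \<Longrightarrow> neg_span v (scal c \<odot>\<^bsub>M\<^esub> m)"
proof (induction rule: neg_span.induct)
  case (scal d)
  then show ?case using v by (simp add: scal_scal neg_span.scal)
next
  case (neg f m)
  then show ?case
    using Neg_subset neg_span_closed neg_span.neg[OF neg.hyps(1) neg.IH]
    by (subst scal_gen_swap[symmetric]) auto
next
  case (add m m')
  then show ?case by (simp add: M.smult_r_distr neg_span_closed neg_span.add)
qed

lemma neg_span_gen_v: "x \<in> L \<Longrightarrow> neg_span v (gen x \<odot>\<^bsub>M\<^esub> v)"
proof (induction x rule: span_induct[consumes 1])
  case (1 y)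
  have "neg_span v v" using neg_span.scal[of v 1] v by simp
  then show ?case using 1 Bor_v neg_span.scal neg_span.neg by auto
next
  case (2 y z)
  then show ?case using v by (simp add: gen_add_act neg_span.add)
next
  case (3 c y)
  then show ?case using v by (simp add: gen_smult_act neg_span_scal)
qed

text \<open>This is where the triangular decomposition enters: a generator is moved past the
  negative ones at the cost of commutators, which are again in \<open>L\<close>.\<close>

lemma neg_span_gen: "neg_span v m \<Longrightarrow> x \<in> L \<Longrightarrow> neg_span v (gen x \<odot>\<^bsub>M\<^esub> m)"
proof (induction arbitrary: x rule: neg_span.induct)
  case (scal c)
  then show ?case using v by (simp add: scal_gen_swap neg_span_scal neg_span_gen_v)
next
  case (neg f m)
  then have f: "f \<in> L" using Neg_subset by auto
  show ?case
    unfolding gen_swap[OF neg.prems f neg_span_closed[OF neg.hyps(2)]]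
    by (intro neg_span.add neg_span.neg neg.IH neg.prems neg.hyps bracket_closed f)
next
  case (add m m')
  then show ?case by (simp add: M.smult_r_distr neg_span_closed neg_span.add)
qed

text \<open>The negative span contains the multiples of \<open>v\<close> and is stable under every
  generator, hence contains the whole orbit. This is the part of the Poincare-Birkhoff-Witt theorem
  that the argument uses.\<close>

lemma neg_span_orbit: "u \<in> carrier U \<Longrightarrow> neg_span v (u \<odot>\<^bsub>M\<^esub> v)"
proof (induction u rule: uea_induct)
  case (scal c)
  show ?case by (rule neg_span.scal)
next
  case (gen x u)
  then show ?case using v by (simp add: M.smult_assoc1 neg_span_gen)
next
  case (add u u')
  then show ?case using v by (simp add: M.smult_l_distr neg_span.add)
qed

text \<open>Once an element of \<open>Neg\<close> has acted, the result lies entirely below the top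
  eigenvalue; the coefficient of \<open>v\<close> is then taken to be 0.\<close>

lemma neg_span_decomp:
  assumes "neg_span v m"
  shows "\<exists>c l. lower (\<chi> h0) l \<and> m = scal c \<odot>\<^bsub>M\<^esub> v \<oplus>\<^bsub>M\<^esub> l"
  using assms
proof (induction rule: neg_span.induct)
  case (scal c)
  show ?case using lower_zero v by (intro exI[of _ c] exI[of _ "\<zero>\<^bsub>M\<^esub>"]) auto
next
  case (neg f m)
  then obtain c l where l: "lower (\<chi> h0) l" and m: "m = scal c \<odot>\<^bsub>M\<^esub> v \<oplus>\<^bsub>M\<^esub> l" by blast
  have f: "f \<in> L" using neg.hyps(1) Neg_subset by auto
  obtain k where k: "k \<ge> 1" "lie_bracket h0 f = (- of_nat k) \<cdot>\<^sub>m f"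
    using Neg_lowers[OF neg.hyps(1)] by auto
  have "lower (\<chi> h0) (gen f \<odot>\<^bsub>M\<^esub> v)"
    using eigenvalue_shift[OF f v Bor_v[OF h0_Bor] k(2)] f v k(1)
    by (intro lower.eigen[of "gen f \<odot>\<^bsub>M\<^esub> v" k]) simp_all
  then have "lower (\<chi> h0) (scal c \<odot>\<^bsub>M\<^esub> (gen f \<odot>\<^bsub>M\<^esub> v) \<oplus>\<^bsub>M\<^esub> gen f \<odot>\<^bsub>M\<^esub> l)"
    by (rule lower.add[OF lower_scal lower_Neg[OF neg.hyps(1) l]])
  moreover have "gen f \<odot>\<^bsub>M\<^esub> m = scal c \<odot>\<^bsub>M\<^esub> (gen f \<odot>\<^bsub>M\<^esub> v) \<oplus>\<^bsub>M\<^esub> gen f \<odot>\<^bsub>M\<^esub> l"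
    using f v l by (simp add: m M.smult_r_distr lower_closed scal_gen_swap)
  ultimately show ?case
    using v lower_closed
    by (intro exI[of _ 0] exI[of _ "scal c \<odot>\<^bsub>M\<^esub> (gen f \<odot>\<^bsub>M\<^esub> v) \<oplus>\<^bsub>M\<^esub> gen f \<odot>\<^bsub>M\<^esub> l"]) auto
next
  case (add m m')
  then obtain c l c' l' where l: "lower (\<chi> h0) l" "m = scal c \<odot>\<^bsub>M\<^esub> v \<oplus>\<^bsub>M\<^esub> l"
    "lower (\<chi> h0) l'" "m' = scal c' \<odot>\<^bsub>M\<^esub> v \<oplus>\<^bsub>M\<^esub> l'" by blast
  have "m \<oplus>\<^bsub>M\<^esub> m' = scal (c + c') \<odot>\<^bsub>M\<^esub> v \<oplus>\<^bsub>M\<^esub> (l \<oplus>\<^bsub>M\<^esub> l')"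
    using v l lower_closed[OF l(1)] lower_closed[OF l(3)] M.M.add.m_lcomm
    by (simp add: scal_plus[symmetric] M.M.a_assoc)
  then show ?case using lower.add[OF l(1,3)] by blast
qed

text \<open>Write \<open>u\<close> applied to \<open>v\<close> as a multiple of \<open>v\<close>
  plus a lower part. \<open>lower_killer\<close> annihilates the lower part and acts by the same
  nonzero scalar on both eigenvectors of eigenvalue \<open>\<chi> h0\<close>, so these
  agree.\<close>

lemma top_eigenvector_in_orbit:
  assumes u: "u \<in> carrier U"
    and e: "gen h0 \<odot>\<^bsub>M\<^esub> (u \<odot>\<^bsub>M\<^esub> v) = scal (\<chi> h0) \<odot>\<^bsub>M\<^esub> (u \<odot>\<^bsub>M\<^esub> v)"
  shows "\<exists>c. u \<odot>\<^bsub>M\<^esub> v = scal c \<odot>\<^bsub>M\<^esub> v"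
proof -
  obtain c l where l: "lower (\<chi> h0) l" and uv: "u \<odot>\<^bsub>M\<^esub> v = scal c \<odot>\<^bsub>M\<^esub> v \<oplus>\<^bsub>M\<^esub> l"
    using neg_span_decomp[OF neg_span_orbit[OF u]] by blast
  obtain K where K: "lower_killer (\<chi> h0) K \<odot>\<^bsub>M\<^esub> l = \<zero>\<^bsub>M\<^esub>" using lower_killer_lower[OF l] by blast
  let ?d = "(\<Prod>k<K. of_nat (Suc k)) :: rat"
  have uvc: "u \<odot>\<^bsub>M\<^esub> v \<in> carrier M" using u v by simp
  have "scal ?d \<odot>\<^bsub>M\<^esub> (u \<odot>\<^bsub>M\<^esub> v) = lower_killer (\<chi> h0) K \<odot>\<^bsub>M\<^esub> (u \<odot>\<^bsub>M\<^esub> v)"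
    using lower_killer_eigen[OF uvc e, of "\<chi> h0" K] by simp
  also have "\<dots> = lower_killer (\<chi> h0) K \<odot>\<^bsub>M\<^esub> (scal c \<odot>\<^bsub>M\<^esub> v)"
    using v lower_closed[OF l] by (simp add: uv M.smult_r_distr K)
  also have "\<dots> = scal ?d \<odot>\<^bsub>M\<^esub> (scal c \<odot>\<^bsub>M\<^esub> v)"
    using lower_killer_eigen[of "scal c \<odot>\<^bsub>M\<^esub> v" "\<chi> h0" "\<chi> h0" K] v Bor_v[OF h0_Bor]
    by (simp add: scal_gen_swap[OF h0_L] scal_scal mult.commute)
  finally have "scal ?d \<odot>\<^bsub>M\<^esub> (u \<odot>\<^bsub>M\<^esub> v) = scal ?d \<odot>\<^bsub>M\<^esub> (scal c \<odot>\<^bsub>M\<^esub> v)" .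
  moreover have "?d \<noteq> 0" by (simp del: of_nat_Suc)
  ultimately have "u \<odot>\<^bsub>M\<^esub> v = scal c \<odot>\<^bsub>M\<^esub> v"
    by (intro scal_cancel[OF uvc M.smult_closed[OF scal_closed v], of ?d])
  then show ?thesis by blast
qed

end

end

section \<open>Comparison of a simple module with a module having the same weight\<close>

context triangular_lie_algebra
begin

text \<open>If \<open>u v\<close> with \<open>u M' = 0\<close> were nonzero, these vectors would exhaust \<open>M\<close>, so that
  \<open>(v, 0)\<close> would be in the submodule of \<open>M \<oplus> M'\<close> generated by \<open>(v, w)\<close>; but the vectors of
  the same weight in there are the multiples of \<open>(v, w)\<close>.\<close>

lemma annihilates_simple:
  fixes M :: "((rat mat list \<Rightarrow> rat) set, 'v) module" and M' :: "((rat mat list \<Rightarrow> rat) set, 'w) module"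
  assumes simple: "simple_module U M" and M': "left_module U M'"
    and v: "v \<in> carrier M" "v \<noteq> \<zero>\<^bsub>M\<^esub>" and w: "w \<in> carrier M'" "w \<noteq> \<zero>\<^bsub>M'\<^esub>"
    and Bor_v: "\<And>b. b \<in> Bor \<Longrightarrow> gen b \<odot>\<^bsub>M\<^esub> v = scal (\<chi> b) \<odot>\<^bsub>M\<^esub> v"
    and Bor_w: "\<And>b. b \<in> Bor \<Longrightarrow> gen b \<odot>\<^bsub>M'\<^esub> w = scal (\<chi> b) \<odot>\<^bsub>M'\<^esub> w"
    and u: "u \<in> carrier U" "annihilates u M'"
  shows "annihilates u M"
proof -
  have M: "left_module U M" using simple by (simp add: simple_module_def)
  interpret M: triangular_module L h0 Neg Bor M
    by (intro triangular_module.intro triangular_lie_algebra_axioms M)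
  interpret M': triangular_module L h0 Neg Bor M'
    by (intro triangular_module.intro triangular_lie_algebra_axioms M')
  let ?P = "prod_module M M'"
  interpret P: triangular_module L h0 Neg Bor ?P
    by (intro triangular_module.intro triangular_lie_algebra_axioms left_module_prod M M')
  let ?J = "{u \<in> carrier U. annihilates u M'}"
  let ?N = "{u \<odot>\<^bsub>M\<^esub> v | u. u \<in> ?J}"
  have "submodule ?N U M"
  proof (rule M.M.submoduleI)
    show "?N \<subseteq> carrier M" using v by auto
    have "annihilates \<zero>\<^bsub>U\<^esub> M'" by (simp add: annihilates_def)
    then show "\<zero>\<^bsub>M\<^esub> \<in> ?N" using v by (auto intro!: exI[of _ "\<zero>\<^bsub>U\<^esub>"])
    show "x \<oplus>\<^bsub>M\<^esub> y \<in> ?N" if xy: "x \<in> ?N" "y \<in> ?N" for x y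
    proof -
      obtain a b where ab: "a \<in> carrier U" "annihilates a M'" "x = a \<odot>\<^bsub>M\<^esub> v"
        "b \<in> carrier U" "annihilates b M'" "y = b \<odot>\<^bsub>M\<^esub> v" using xy by auto
      then show ?thesis
        using v by (auto intro!: exI[of _ "a \<oplus>\<^bsub>U\<^esub> b"] simp: annihilates_def M.M.smult_l_distr
            M'.M.smult_l_distr)
    qed
    show "c \<odot>\<^bsub>M\<^esub> x \<in> ?N" if c: "c \<in> carrier U" and x: "x \<in> ?N" for c x
    proof -
      obtain a where a: "a \<in> carrier U" "annihilates a M'" "x = a \<odot>\<^bsub>M\<^esub> v" using x by auto
      then show ?thesis
        using v c by (auto intro!: exI[of _ "c \<otimes>\<^bsub>U\<^esub> a"] simp: annihilates_def M.M.smult_assoc1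
            M'.M.smult_assoc1)
    qed
  qed
  then consider "?N = {\<zero>\<^bsub>M\<^esub>}" | "?N = carrier M"
    using simple unfolding simple_module_def by blast
  then show ?thesis
  proof cases
    case 1
    show ?thesis unfolding annihilates_def
    proof
      fix x assume "x \<in> carrier M"
      then obtain a where a: "a \<in> carrier U" "x = a \<odot>\<^bsub>M\<^esub> v"
        using simple_module_cyclic[OF simple v] by blast
      have "annihilates (u \<otimes>\<^bsub>U\<^esub> a) M'"
        using u a by (simp add: annihilates_def M'.M.smult_assoc1)
      then have "(u \<otimes>\<^bsub>U\<^esub> a) \<odot>\<^bsub>M\<^esub> v \<in> ?N" using u a by blast
      then have "(u \<otimes>\<^bsub>U\<^esub> a) \<odot>\<^bsub>M\<^esub> v = \<zero>\<^bsub>M\<^esub>" unfolding 1 by simp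
      then show "u \<odot>\<^bsub>M\<^esub> x = \<zero>\<^bsub>M\<^esub>" using u a v by (simp add: M.M.smult_assoc1)
    qed
  next
    case 2
    then have "v \<in> ?N" using v by simp
    then obtain a where a: "a \<in> carrier U" "annihilates a M'" "a \<odot>\<^bsub>M\<^esub> v = v" by auto
    then have av: "a \<odot>\<^bsub>?P\<^esub> (v, w) = (v, \<zero>\<^bsub>M'\<^esub>)" using w by (simp add: annihilates_def)
    have "\<exists>c. a \<odot>\<^bsub>?P\<^esub> (v, w) = scal c \<odot>\<^bsub>?P\<^esub> (v, w)"
    proof (rule P.top_eigenvector_in_orbit[where \<chi> = \<chi>])
      show "gen h0 \<odot>\<^bsub>?P\<^esub> (a \<odot>\<^bsub>?P\<^esub> (v, w)) = scal (\<chi> h0) \<odot>\<^bsub>?P\<^esub> (a \<odot>\<^bsub>?P\<^esub> (v, w))"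
        unfolding av using M.h0_L by (simp add: Bor_v[OF h0_Bor])
    qed (use v w a Bor_v Bor_w in auto)
    then obtain c where c: "v = scal c \<odot>\<^bsub>M\<^esub> v" "\<zero>\<^bsub>M'\<^esub> = scal c \<odot>\<^bsub>M'\<^esub> w"
      unfolding av by auto
    show ?thesis
    proof (cases "c = 0")
      case True
      then show ?thesis using c(1) v by simp
    next
      case False
      have "scal c \<odot>\<^bsub>M'\<^esub> w = scal c \<odot>\<^bsub>M'\<^esub> \<zero>\<^bsub>M'\<^esub>"
        unfolding c(2)[symmetric] by (rule M'.M.smult_r_null[OF scal_closed, symmetric])
      then have "w = \<zero>\<^bsub>M'\<^esub>"
        by (rule M'.scal_cancel[OF w(1) M'.M.M.zero_closed False])
      then show ?thesis using w by simp
    qed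
  qed
qed

end

section \<open>The Lie algebras of types C and D\<close>

text \<open>Letters \<open>p < 2 n\<close> index the standard basis of the natural representation; \<open>opp n p\<close> is
  the letter of opposite weight, and the nonzero entries of the form are
  \<open>eps t n p\<close> at \<open>(p, opp n p)\<close>.\<close>

definition opp :: "nat \<Rightarrow> nat \<Rightarrow> nat" where
  "opp n p = (if p < n then n + p else p - n)"

definition eps :: "lie_type \<Rightarrow> nat \<Rightarrow> nat \<Rightarrow> rat" where
  "eps t n p = (if p < n then 1 else case t of TypeC \<Rightarrow> - 1 | TypeD \<Rightarrow> 1)"

lemma opp_less [simp]: "p < 2 * n \<Longrightarrow> opp n p < 2 * n"
  by (auto simp: opp_def)

lemma opp_opp [simp]: "p < 2 * n \<Longrightarrow> opp n (opp n p) = p"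
  by (auto simp: opp_def)

lemma opp_neq [simp]: "p < 2 * n \<Longrightarrow> opp n p \<noteq> p" "p < 2 * n \<Longrightarrow> p \<noteq> opp n p"
  by (auto simp: opp_def)

lemma opp_inj: "p < 2 * n \<Longrightarrow> q < 2 * n \<Longrightarrow> opp n p = opp n q \<longleftrightarrow> p = q"
  by (auto simp: opp_def split: if_splits)

lemma eps_square [simp]: "eps t n p * eps t n p = 1" "eps t n p * (eps t n p * c) = c"
  by (auto simp: eps_def split: lie_type.split)

lemma eps_opp:
  "p < 2 * n \<Longrightarrow> eps t n (opp n p) = (case t of TypeC \<Rightarrow> - 1 | TypeD \<Rightarrow> 1) * eps t n p"
  by (auto simp: eps_def opp_def split: lie_type.split)

lemma sum_opp: "(\<Sum>p<2 * n. f (opp n p)) = (\<Sum>p<2 * n. f p :: 'a :: comm_monoid_add)"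
  by (rule sum.reindex_bij_witness[of _ "opp n" "opp n"]) auto

lemma form_mat_entry:
  "p < 2 * n \<Longrightarrow> q < 2 * n \<Longrightarrow> form_mat t n $$ (p, q) = (if q = opp n p then eps t n p else 0)"
  by (auto simp: form_mat_def opp_def eps_def split: lie_type.split)

lemma form_mat_carrier: "form_mat t n \<in> carrier_mat (2 * n) (2 * n)"
  by (auto simp: form_mat_def mult_2 split: lie_type.split)

lemma bil_form_eq:
  assumes v: "v \<in> carrier_vec (2 * n)" and w: "w \<in> carrier_vec (2 * n)"
  shows "bil_form t n v w = (\<Sum>p<2 * n. eps t n p * v $ p * w $ (opp n p))"
proof -
  have "(form_mat t n *\<^sub>v w) $ p = eps t n p * w $ (opp n p)" if p: "p < 2 * n" for p
  proof -
    have "(form_mat t n *\<^sub>v w) $ p = (\<Sum>q<2 * n. form_mat t n $$ (p, q) * w $ q)"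
      using p w form_mat_carrier[of t n] by (simp add: scalar_prod_def atLeast0LessThan)
    also have "\<dots> = (\<Sum>q<2 * n. if q = opp n p then eps t n p * w $ q else 0)"
      using p by (intro sum.cong) (auto simp: form_mat_entry)
    finally show ?thesis using p by simp
  qed
  then show ?thesis
    using w form_mat_carrier[of t n]
    by (auto simp: bil_form_def scalar_prod_def atLeast0LessThan intro!: sum.cong)
qed

text \<open>The entrywise form of x^T J + J x = 0, where row \<open>p\<close> of the form matrix J
  has its only nonzero entry in column \<open>opp n p\<close>.\<close>

lemma lie_alg_iff:
  "x \<in> lie_alg t n \<longleftrightarrow> x \<in> carrier_mat (2 * n) (2 * n) \<and>
    (\<forall>p<2 * n. \<forall>q<2 * n. x $$ (p, q) = - eps t n p * eps t n q * x $$ (opp n q, opp n p))"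
    (is "_ \<longleftrightarrow> _ \<and> ?entries")
proof -
  have mv: "(x *\<^sub>v v) $ p = (\<Sum>q<2 * n. x $$ (p, q) * v $ q)"
    if "x \<in> carrier_mat (2 * n) (2 * n)" "v \<in> carrier_vec (2 * n)" "p < 2 * n" for v :: "rat vec" and p
    using that by (simp add: scalar_prod_def atLeast0LessThan)
  have expand: "bil_form t n (x *\<^sub>v v) w + bil_form t n v (x *\<^sub>v w)
      = (\<Sum>p<2 * n. \<Sum>q<2 * n. v $ p * w $ q *
          (eps t n (opp n q) * x $$ (opp n q, p) + eps t n p * x $$ (opp n p, q)))"
    if x: "x \<in> carrier_mat (2 * n) (2 * n)" and v: "v \<in> carrier_vec (2 * n)"
      and w: "w \<in> carrier_vec (2 * n)" for v w
  proof -
    have "bil_form t n (x *\<^sub>v v) w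
        = (\<Sum>p<2 * n. eps t n p * (x *\<^sub>v v) $ p * w $ (opp n p))"
      using x v w by (intro bil_form_eq) auto
    \<comment> \<open>Reindexing by \<open>opp\<close> produces the plain coordinate
      \<open>w $ q\<close>, so that the coefficients of both forms can be compared term by
      term.\<close>
    also have "\<dots>
        = (\<Sum>q<2 * n. eps t n (opp n q) * (x *\<^sub>v v) $ (opp n q) * w $ (opp n (opp n q)))"
      by (rule sum_opp[symmetric])
    also have "\<dots> = (\<Sum>q<2 * n. \<Sum>p<2 * n. v $ p * w $ q * (eps t n (opp n q) * x $$ (opp n q, p)))"
      using x v by (simp add: mv sum_distrib_left sum_distrib_right del: index_mult_mat_vec) (simp add: mult_ac)
    also have "\<dots> = (\<Sum>p<2 * n. \<Sum>q<2 * n. v $ p * w $ q * (eps t n (opp n q) * x $$ (opp n q, p)))"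
      by (rule sum.swap)
    finally have 1: "bil_form t n (x *\<^sub>v v) w = \<dots>" .
    have 2: "bil_form t n v (x *\<^sub>v w)
        = (\<Sum>p<2 * n. \<Sum>q<2 * n. v $ p * w $ q * (eps t n p * x $$ (opp n p, q)))"
    proof -
      have "bil_form t n v (x *\<^sub>v w) = (\<Sum>p<2 * n. eps t n p * v $ p * (x *\<^sub>v w) $ (opp n p))"
        using x v w by (intro bil_form_eq) auto
      then show ?thesis
        using x w by (simp add: mv sum_distrib_left del: index_mult_mat_vec) (simp add: mult_ac)
    qed
    show ?thesis unfolding 1 2 by (simp add: sum.distrib[symmetric] distrib_left)
  qed
  have swap: "x $$ (p, q) = - eps t n p * eps t n q * x $$ (opp n q, opp n p) \<longleftrightarrow>
      eps t n p * x $$ (p, q) + eps t n q * x $$ (opp n q, opp n p) = 0" for p q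
    by (auto simp: eps_def split: lie_type.split)
  show ?thesis
  proof (cases "x \<in> carrier_mat (2 * n) (2 * n)")
    case True
    have "(\<forall>v \<in> carrier_vec (2 * n). \<forall>w \<in> carrier_vec (2 * n).
        bil_form t n (x *\<^sub>v v) w + bil_form t n v (x *\<^sub>v w) = 0) \<longleftrightarrow> ?entries"
    proof
      assume inv: "\<forall>v \<in> carrier_vec (2 * n). \<forall>w \<in> carrier_vec (2 * n).
        bil_form t n (x *\<^sub>v v) w + bil_form t n v (x *\<^sub>v w) = 0"
      show ?entries
      proof (intro allI impI)
        fix p q assume p: "p < 2 * n" and q: "q < 2 * n"
        \<comment> \<open>Unit vectors at \<open>q\<close> and \<open>opp n p\<close> isolate the
          coefficient relating the entries at (p, q) and (opp q, opp p).\<close>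
        let ?a = "opp n p" and ?c = "\<lambda>a b. eps t n (opp n b) * x $$ (opp n b, a) + eps t n a * x $$ (opp n a, b)"
        have "0 = bil_form t n (x *\<^sub>v unit_vec (2 * n) q) (unit_vec (2 * n) ?a)
            + bil_form t n (unit_vec (2 * n) q) (x *\<^sub>v unit_vec (2 * n) ?a)"
          using inv by simp
        also have "\<dots> = (\<Sum>i<2 * n. \<Sum>j<2 * n. if i = q then if j = ?a then ?c i j else 0 else 0)"
          using p q True by (subst expand) (auto intro!: sum.cong)
        also have "\<dots> = (\<Sum>i<2 * n. if i = q then ?c i ?a else 0)"
          using p by (intro sum.cong) auto
        also have "\<dots> = ?c q ?a" using q by simp
        finally show "x $$ (p, q) = - eps t n p * eps t n q * x $$ (opp n q, opp n p)"
          using p unfolding swap by simp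
      qed
    next
      assume e: ?entries
      have "eps t n (opp n q) * x $$ (opp n q, p) + eps t n p * x $$ (opp n p, q) = 0"
        if "p < 2 * n" "q < 2 * n" for p q
        using e[rule_format, of "opp n q" p] swap[of "opp n q" p] that by simp
      then show "\<forall>v \<in> carrier_vec (2 * n). \<forall>w \<in> carrier_vec (2 * n).
        bil_form t n (x *\<^sub>v v) w + bil_form t n v (x *\<^sub>v w) = 0"
        using True by (auto simp: expand intro!: sum.neutral)
    qed
    then show ?thesis using True by (simp add: lie_alg_def)
  qed (simp add: lie_alg_def)
qed

lemma lie_alg_carrier: "lie_alg t n \<subseteq> carrier_mat (2 * n) (2 * n)"
  by (auto simp: lie_alg_def)

lemma lie_alg_transpose:
  assumes "x \<in> lie_alg t n"
  shows "transpose_mat x \<in> lie_alg t n"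
proof -
  have x: "x \<in> carrier_mat (2 * n) (2 * n)" and
    e: "\<And>p q. p < 2 * n \<Longrightarrow> q < 2 * n \<Longrightarrow>
      x $$ (p, q) = - eps t n p * eps t n q * x $$ (opp n q, opp n p)"
    using assms unfolding lie_alg_iff by blast+
  have "transpose_mat x $$ (p, q) = - eps t n p * eps t n q * transpose_mat x $$ (opp n q, opp n p)"
    if "p < 2 * n" "q < 2 * n" for p q
  proof -
    have "transpose_mat x $$ (p, q) = x $$ (q, p)"
      "transpose_mat x $$ (opp n q, opp n p) = x $$ (opp n p, opp n q)"
      using x that by simp_all
    then show ?thesis using e[OF that(2,1)] by (simp only: mult.commute[of "eps t n p"] mult_minus_left)
  qed
  moreover have "transpose_mat x \<in> carrier_mat (2 * n) (2 * n)" using x by simp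
  ultimately show ?thesis unfolding lie_alg_iff by blast
qed

text \<open>The matrix unit at (p, q) plus its image under the involution whose fixed matrices form
  the Lie algebra. For p = q it is H_p or the negative of H_(p-n); for \<open>q = opp n p\<close> it
  is twice a matrix unit in type C and zero in type D.\<close>

definition root_mat :: "lie_type \<Rightarrow> nat \<Rightarrow> nat \<Rightarrow> nat \<Rightarrow> rat mat" where
  "root_mat t n p q = mat (2 * n) (2 * n) (\<lambda>(a, b). (if a = p \<and> b = q then 1 else 0)
     - (if a = opp n q \<and> b = opp n p then eps t n p * eps t n q else 0))"

lemma root_mat_entry:
  "a < 2 * n \<Longrightarrow> b < 2 * n \<Longrightarrow> root_mat t n p q $$ (a, b) = (if a = p \<and> b = q then 1 else 0)
     - (if a = opp n q \<and> b = opp n p then eps t n p * eps t n q else 0)"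
  by (simp add: root_mat_def)

lemma root_mat_carrier [simp]: "root_mat t n p q \<in> carrier_mat (2 * n) (2 * n)"
  by (simp add: root_mat_def)

lemma root_mat_dims [simp]: "dim_row (root_mat t n p q) = 2 * n" "dim_col (root_mat t n p q) = 2 * n"
  by (simp_all add: root_mat_def)

lemma root_mat_lie_alg:
  assumes pq: "p < 2 * n" "q < 2 * n"
  shows "root_mat t n p q \<in> lie_alg t n"
proof -
  have e: "root_mat t n p q $$ (a, b)
      = - eps t n a * eps t n b * root_mat t n p q $$ (opp n b, opp n a)"
    if ab: "a < 2 * n" "b < 2 * n" for a b
  proof -
    let ?A = "a = p \<and> b = q" and ?B = "a = opp n q \<and> b = opp n p" and ?k = "eps t n p * eps t n q"
    have 1: "root_mat t n p q $$ (a, b) = (if ?A then 1 else 0) - (if ?B then ?k else 0)"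
      using ab by (simp add: root_mat_entry)
    have "opp n b = p \<and> opp n a = q \<longleftrightarrow> ?B" "opp n b = opp n q \<and> opp n a = opp n p \<longleftrightarrow> ?A"
      using pq ab by (auto simp: opp_def split: if_splits)
    then have 2: "root_mat t n p q $$ (opp n b, opp n a) = (if ?B then 1 else 0) - (if ?A then ?k else 0)"
      using ab by (simp add: root_mat_entry)
    have "eps t n (opp n q) * eps t n (opp n p) = ?k"
      using pq by (cases t) (simp_all add: eps_opp)
    then have s: "eps t n a * eps t n b = ?k" if "?A \<or> ?B" using that by auto
    have k: "?k * ?k = 1" by (auto simp: eps_def split: lie_type.split)
    show ?thesis
    proof (cases "?A \<or> ?B")
      case True
      then have m: "- eps t n a * eps t n b = - ?k" using s by simp
      have "(if ?A then 1 else 0) - (if ?B then ?k else 0)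
          = - ?k * ((if ?B then 1 else 0) - (if ?A then ?k else 0))"
        using k by (cases ?A; cases ?B) (simp_all only: if_True if_False, simp_all add: right_diff_distrib)
      then show ?thesis unfolding 1 2 m .
    next
      case False
      then have "?A = False" "?B = False" by blast+
      then show ?thesis unfolding 1 2 by (simp only: if_False) simp
    qed
  qed
  show ?thesis
    by (rule iffD2[OF lie_alg_iff], intro conjI root_mat_carrier allI impI) (rule e)
qed

lemma root_mat_transpose: "transpose_mat (root_mat t n p q) = root_mat t n q p"
  by (rule eq_matI) (simp_all add: root_mat_entry mult.commute conj_commute)

lemma lie_alg_span:
  assumes n: "n > 0" and x: "x \<in> lie_alg t n"
    and base: "\<And>p q. p < 2 * n \<Longrightarrow> q < 2 * n \<Longrightarrow> P (root_mat t n p q)"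
    and add: "\<And>y z. y \<in> lie_alg t n \<Longrightarrow> z \<in> lie_alg t n \<Longrightarrow> P y \<Longrightarrow> P z \<Longrightarrow> P (y + z)"
    and smult: "\<And>c y. y \<in> lie_alg t n \<Longrightarrow> P y \<Longrightarrow> P (c \<cdot>\<^sub>m y)"
  shows "P x"
proof -
  \<comment> \<open>Each root matrix is a matrix unit plus its image under an involution fixing
    \<open>x\<close>, so summing over all entries would count \<open>x\<close> twice.\<close>
  define S where "S B = mat (2 * n) (2 * n) (\<lambda>(a, b). \<Sum>(p, q)\<in>B.
      x $$ (p, q) / 2 * root_mat t n p q $$ (a, b))" for B
  let ?B = "{..<2 * n} \<times> {..<2 * n}"
  have S: "S B \<in> lie_alg t n \<and> P (S B)" if "finite B" "B \<subseteq> ?B" for B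
    using that
  proof (induction B rule: finite_induct)
    case empty
    let ?r = "root_mat t n 0 0"
    have r: "?r \<in> lie_alg t n" "P ?r" using n root_mat_lie_alg[of 0 n 0 t] base[of 0 0] by auto
    \<comment> \<open>The zero matrix is reached as a multiple of a root matrix, for which
      \<open>P\<close> is known; \<open>n > 0\<close> provides one.\<close>
    have "S {} = 0 \<cdot>\<^sub>m ?r" by (rule eq_matI) (auto simp: S_def)
    then show ?case using r smult lie_alg_closed(2)[OF r(1) r(1)] by simp
  next
    case (insert pq B)
    obtain p q where pq: "pq = (p, q)" "p < 2 * n" "q < 2 * n" using insert by (cases pq) auto
    let ?r = "(x $$ (p, q) / 2) \<cdot>\<^sub>m root_mat t n p q"
    note r = root_mat_lie_alg[OF pq(2,3), of t]
    have "S (insert pq B) = ?r + S B"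
      using insert pq by (intro eq_matI) (auto simp: S_def)
    moreover have "?r \<in> lie_alg t n" "P ?r"
      using lie_alg_closed(2)[OF r r] smult[OF r base[OF pq(2,3)]] by auto
    ultimately show ?case using insert add lie_alg_closed(1) by auto
  qed
  have "S ?B = x"
  proof (rule eq_matI)
    fix a b assume "a < dim_row x" "b < dim_col x"
    then have ab: "a < 2 * n" "b < 2 * n" using x by (auto simp: lie_alg_def)
    have "S ?B $$ (a, b) = (\<Sum>p<2 * n. \<Sum>q<2 * n. x $$ (p, q) / 2 * root_mat t n p q $$ (a, b))"
      using ab by (simp add: S_def sum.cartesian_product)
    also have "\<dots> = (\<Sum>p<2 * n. \<Sum>q<2 * n. (if p = a then if q = b then x $$ (p, q) / 2 else 0 else 0)
        - (if p = opp n b then if q = opp n a then x $$ (p, q) / 2 * (eps t n p * eps t n q) else 0 else 0))"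
    proof (intro sum.cong refl)
      fix p q assume "p \<in> {..<2 * n}" "q \<in> {..<2 * n}"
      then have "a = opp n q \<longleftrightarrow> q = opp n a" "b = opp n p \<longleftrightarrow> p = opp n b"
        using ab by (auto simp: opp_def)
      then show "x $$ (p, q) / 2 * root_mat t n p q $$ (a, b)
        = (if p = a then if q = b then x $$ (p, q) / 2 else 0 else 0)
        - (if p = opp n b then if q = opp n a then x $$ (p, q) / 2 * (eps t n p * eps t n q) else 0 else 0)"
        using ab by (simp add: root_mat_entry right_diff_distrib)
    qed
    also have "\<dots> = (\<Sum>p<2 * n. (if p = a then x $$ (p, b) / 2 else 0)
        - (if p = opp n b then x $$ (p, opp n a) / 2 * (eps t n p * eps t n (opp n a)) else 0))"
      using ab by (intro sum.cong) (auto simp: sum_subtractf)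
    also have "\<dots> = x $$ (a, b) / 2
        - x $$ (opp n b, opp n a) / 2 * (eps t n (opp n b) * eps t n (opp n a))"
      using ab by (simp add: sum_subtractf)
    also have "\<dots> = x $$ (a, b)"
    proof -
      have "x $$ (a, b) = - eps t n a * eps t n b * x $$ (opp n b, opp n a)"
        using x ab unfolding lie_alg_iff by blast
      then show ?thesis using ab by (cases t) (simp_all add: eps_opp mult_ac)
    qed
    finally show "S ?B $$ (a, b) = x $$ (a, b)" .
  qed (use x in \<open>auto simp: S_def lie_alg_def\<close>)
  then show ?thesis using S[of ?B] by simp
qed

text \<open>Coordinate \<open>i\<close> of the weight of the basis vector \<open>p\<close>. Integer
  values make parity and size arguments available for weights of words.\<close>

definition letter_weight :: "nat \<Rightarrow> nat \<Rightarrow> nat \<Rightarrow> int" where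
  "letter_weight n i p = (if p = i then 1 else if p = n + i then - 1 else 0)"

lemma letter_weight_opp:
  "i < n \<Longrightarrow> p < 2 * n \<Longrightarrow> letter_weight n i (opp n p) = - letter_weight n i p"
  by (auto simp: letter_weight_def opp_def)

lemma cartan_entry:
  "a < 2 * n \<Longrightarrow> b < 2 * n \<Longrightarrow>
    cartan n i $$ (a, b) = (if a = b then of_int (letter_weight n i a) else 0)"
  by (auto simp: cartan_def letter_weight_def)

lemma cartan_carrier [simp]: "cartan n i \<in> carrier_mat (2 * n) (2 * n)"
  by (simp add: cartan_def)

lemma cartan_dims [simp]: "dim_row (cartan n i) = 2 * n" "dim_col (cartan n i) = 2 * n"
  by (simp_all add: cartan_def)

lemma cartan_eq_root_mat: "i < n \<Longrightarrow> cartan n i = root_mat t n i i"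
  by (rule eq_matI) (auto simp: cartan_entry root_mat_entry letter_weight_def opp_def)

lemma cartan_lie_alg: "i < n \<Longrightarrow> cartan n i \<in> lie_alg t n"
  using cartan_eq_root_mat[of i n t] root_mat_lie_alg[of i n i t] by simp

lemma bracket_diag_entry:
  fixes d x :: "rat mat"
  assumes d: "d \<in> carrier_mat N N" and x: "x \<in> carrier_mat N N" and ab: "a < N" "b < N"
    and diag: "\<And>a b. a < N \<Longrightarrow> b < N \<Longrightarrow> a \<noteq> b \<Longrightarrow> d $$ (a, b) = 0"
  shows "lie_bracket d x $$ (a, b) = (d $$ (a, a) - d $$ (b, b)) * x $$ (a, b)"
proof -
  have "(\<Sum>c<N. d $$ (a, c) * x $$ (c, b)) = (\<Sum>c<N. if c = a then d $$ (a, a) * x $$ (a, b) else 0)"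
    using ab diag by (intro sum.cong) auto
  moreover have "(\<Sum>c<N. x $$ (a, c) * d $$ (c, b)) = (\<Sum>c<N. if c = b then d $$ (b, b) * x $$ (a, b) else 0)"
    using ab diag by (intro sum.cong) auto
  ultimately show ?thesis
    using d x ab by (simp add: lie_bracket_def scalar_prod_def atLeast0LessThan algebra_simps)
qed

lemma bracket_carrier:
  "x \<in> carrier_mat N N \<Longrightarrow> y \<in> carrier_mat N N \<Longrightarrow> lie_bracket x y \<in> carrier_mat N N"
  by (auto simp: lie_bracket_def)

lemma bracket_dims [simp]:
  "dim_row (lie_bracket x y) = dim_row y" "dim_col (lie_bracket x y) = dim_col x"
  by (simp_all add: lie_bracket_def)

lemma bracket_cartan_entry:
  assumes "x \<in> carrier_mat (2 * n) (2 * n)" "a < 2 * n" "b < 2 * n"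
  shows "lie_bracket (cartan n i) x $$ (a, b)
    = of_int (letter_weight n i a - letter_weight n i b) * x $$ (a, b)"
  using assms by (subst bracket_diag_entry[of _ "2 * n"]) (auto simp: cartan_entry)

text \<open>The coefficients are chosen such that all simple roots have positive height.\<close>

definition height :: "nat \<Rightarrow> nat \<Rightarrow> int" where
  "height n p = (\<Sum>i<n. int (n - i) * letter_weight n i p)"

text \<open>The combination of the \<open>cartan n i\<close> with the coefficients of
  \<open>height\<close>. Its diagonal entries are pairwise distinct, and it serves as the element
  \<open>h0\<close> of the triangular decomposition.\<close>

definition grading_mat :: "nat \<Rightarrow> rat mat" where
  "grading_mat n = mat (2 * n) (2 * n) (\<lambda>(a, b). if a = b then of_int (height n a) else 0)"

lemma height_eq: "p < 2 * n \<Longrightarrow> height n p = (if p < n then int n - int p else int p - 2 * int n)"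
proof -
  assume p: "p < 2 * n"
  have "height n p = (\<Sum>i<n. if i = (if p < n then p else p - n)
      then (if p < n then int n - int p else int p - 2 * int n) else 0)"
    unfolding height_def using p by (intro sum.cong) (auto simp: letter_weight_def)
  also have "\<dots> = (if p < n then int n - int p else int p - 2 * int n)"
  proof -
    have "(if p < n then p else p - n) < n" using p by (split if_split) arith
    then show ?thesis by simp
  qed
  finally show ?thesis .
qed

text \<open>The letters 0, ..., n - 1 have heights n, ..., 1 and the letters n, ..., 2n - 1 have
  heights -n, ..., -1. Hence root matrices for distinct letters have nonzero degree.\<close>

lemma height_inj: "p < 2 * n \<Longrightarrow> q < 2 * n \<Longrightarrow> height n p = height n q \<Longrightarrow> p = q"
  by (auto simp: height_eq split: if_splits)

lemma height_opp: "p < 2 * n \<Longrightarrow> height n (opp n p) = - height n p"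
  by (auto simp: height_eq opp_def)

lemma grading_mat_lie_alg: "grading_mat n \<in> lie_alg t n"
  by (auto simp: lie_alg_iff grading_mat_def height_opp opp_inj)

lemma grading_mat_carrier [simp]: "grading_mat n \<in> carrier_mat (2 * n) (2 * n)"
  by (simp add: grading_mat_def)

lemma bracket_grading_entry:
  assumes "x \<in> carrier_mat (2 * n) (2 * n)" "a < 2 * n" "b < 2 * n"
  shows "lie_bracket (grading_mat n) x $$ (a, b) = of_int (height n a - height n b) * x $$ (a, b)"
  using assms by (subst bracket_diag_entry[of _ "2 * n"]) (auto simp: grading_mat_def)

lemma bracket_grading_root_mat:
  assumes "p < 2 * n" "q < 2 * n"
  shows "lie_bracket (grading_mat n) (root_mat t n p q)
    = of_int (height n p - height n q) \<cdot>\<^sub>m root_mat t n p q"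
proof (rule eq_matI)
  fix a b assume "a < dim_row (of_int (height n p - height n q) \<cdot>\<^sub>m root_mat t n p q)"
    "b < dim_col (of_int (height n p - height n q) \<cdot>\<^sub>m root_mat t n p q)"
  then show "lie_bracket (grading_mat n) (root_mat t n p q) $$ (a, b)
      = (of_int (height n p - height n q) \<cdot>\<^sub>m root_mat t n p q) $$ (a, b)"
    using assms by (auto simp: bracket_grading_entry root_mat_entry height_opp)
qed (use bracket_carrier[OF grading_mat_carrier root_mat_carrier[of t n p q]] in auto)

lemma root_mat_root_space:
  assumes "p < 2 * n" "q < 2 * n"
  shows "root_mat t n p q
    \<in> root_space t n (vec n (\<lambda>i. of_int (letter_weight n i p - letter_weight n i q)))"
  unfolding root_space_def
proof (intro CollectI conjI allI impI eq_matI)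
  fix i a b assume i: "i < n"
    and "a < dim_row (vec n (\<lambda>i. of_int (letter_weight n i p - letter_weight n i q)) $ i \<cdot>\<^sub>m root_mat t n p q)"
    "b < dim_col (vec n (\<lambda>i. of_int (letter_weight n i p - letter_weight n i q)) $ i \<cdot>\<^sub>m root_mat t n p q)"
  then show "lie_bracket (cartan n i) (root_mat t n p q) $$ (a, b)
      = (vec n (\<lambda>i. of_int (letter_weight n i p - letter_weight n i q)) $ i \<cdot>\<^sub>m root_mat t n p q) $$ (a, b)"
    using assms by (auto simp: bracket_cartan_entry root_mat_entry letter_weight_opp)
qed (use assms root_mat_lie_alg bracket_carrier[OF cartan_carrier root_mat_carrier[of t n p q]] in auto)

section \<open>Positive roots\<close>

definition unit_fun :: "nat \<Rightarrow> nat \<Rightarrow> rat" where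
  "unit_fun i j = (if j = i then 1 else 0)"

text \<open>\<open>dom_le\<close> for coordinate functions instead of vectors: sums can be formed
  without dimension conditions, and values matter below \<open>n\<close> only.\<close>

definition root_cone :: "lie_type \<Rightarrow> nat \<Rightarrow> (nat \<Rightarrow> rat) \<Rightarrow> bool" where
  "root_cone t n \<alpha> \<longleftrightarrow> (\<exists>m :: nat \<Rightarrow> nat. \<forall>j<n. \<alpha> j = (\<Sum>i<n. of_nat (m i) * simple_root t n i $ j))"

lemma dom_le_iff_root_cone:
  assumes "\<mu> \<in> carrier_vec n" "\<nu> \<in> carrier_vec n"
  shows "dom_le t n \<nu> \<mu> \<longleftrightarrow> root_cone t n (\<lambda>j. \<mu> $ j - \<nu> $ j)"
  unfolding dom_le_def root_cone_def using assms
  by (intro ex_cong1) (auto simp: vec_eq_iff)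

lemma root_cone_cong: "(\<And>j. j < n \<Longrightarrow> \<alpha> j = \<beta> j) \<Longrightarrow> root_cone t n \<alpha> \<longleftrightarrow> root_cone t n \<beta>"
  by (simp add: root_cone_def)

lemma root_cone_zero: "root_cone t n (\<lambda>j. 0)"
  unfolding root_cone_def by (intro exI[of _ "\<lambda>i. 0"]) simp

lemma root_cone_add:
  assumes "root_cone t n \<alpha>" "root_cone t n \<beta>"
  shows "root_cone t n (\<lambda>j. \<alpha> j + \<beta> j)"
proof -
  obtain m m' where "\<forall>j<n. \<alpha> j = (\<Sum>i<n. of_nat (m i) * simple_root t n i $ j)"
    "\<forall>j<n. \<beta> j = (\<Sum>i<n. of_nat (m' i) * simple_root t n i $ j)"
    using assms unfolding root_cone_def by blast
  then show ?thesis
    unfolding root_cone_def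
    by (intro exI[of _ "\<lambda>i. m i + m' i"]) (simp add: sum.distrib distrib_right)
qed

lemma root_cone_simple:
  assumes "i < n"
  shows "root_cone t n (\<lambda>j. simple_root t n i $ j)"
proof -
  have "simple_root t n i $ j
      = (\<Sum>k<n. of_nat (if k = i then 1 else 0) * simple_root t n k $ j)" for j
  proof -
    have "(\<Sum>k<n. of_nat (if k = i then 1 else 0) * simple_root t n k $ j)
        = (\<Sum>k<n. if k = i then simple_root t n i $ j else 0)"
      by (intro sum.cong) auto
    then show ?thesis using assms by simp
  qed
  then show ?thesis unfolding root_cone_def by (intro exI[of _ "\<lambda>k. if k = i then 1 else 0"]) blast
qed

lemma simple_root_entry:
  assumes "j < n"
  shows "Suc i < n \<Longrightarrow> simple_root t n i $ j = unit_fun i j - unit_fun (Suc i) j"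
    and "simple_root TypeC n (n - Suc 0) $ j = 2 * unit_fun (n - Suc 0) j"
    and "simple_root TypeD n (n - Suc 0) $ j = unit_fun (n - 2) j + unit_fun (n - Suc 0) j"
  using assms by (auto simp: simple_root_def unit_fun_def)

text \<open>A telescoping sum of the simple roots with indices from \<open>i\<close> to
  \<open>j - 1\<close>.\<close>

lemma root_cone_diff:
  assumes "i \<le> j" "j < n"
  shows "root_cone t n (\<lambda>k. unit_fun i k - unit_fun j k)"
  using assms
proof (induction j rule: dec_induct)
  case base
  then show ?case by (simp add: root_cone_zero)
next
  case (step j)
  have "root_cone t n (\<lambda>k. (unit_fun i k - unit_fun j k) + simple_root t n j $ k)"
    using step by (intro root_cone_add root_cone_simple) auto
  then show ?case
    by (rule iffD1[OF root_cone_cong, rotated]) (use step.prems in \<open>simp add: simple_root_entry(1)\<close>)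
qed

lemma root_cone_sum_C:
  assumes "i < n" "j < n"
  shows "root_cone TypeC n (\<lambda>k. unit_fun i k + unit_fun j k)"
proof -
  have "root_cone TypeC n (\<lambda>k. (unit_fun i k - unit_fun (n - 1) k)
      + ((unit_fun j k - unit_fun (n - 1) k) + simple_root TypeC n (n - 1) $ k))"
    using assms by (intro root_cone_add root_cone_simple root_cone_diff) auto
  then show ?thesis
    by (rule iffD1[OF root_cone_cong, rotated]) (simp add: simple_root_entry(2))
qed

text \<open>From \<open>i < j\<close> one gets i <= n - 2, so the first coordinate can be moved to n
  - 2 and the second to n - 1, where the last simple root takes over.\<close>

lemma root_cone_sum_D:
  assumes "i < j" "j < n"
  shows "root_cone TypeD n (\<lambda>k. unit_fun i k + unit_fun j k)"
proof -
  have "root_cone TypeD n (\<lambda>k. (unit_fun i k - unit_fun (n - 2) k)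
      + ((unit_fun j k - unit_fun (n - 1) k) + simple_root TypeD n (n - 1) $ k))"
    using assms by (intro root_cone_add root_cone_simple root_cone_diff) auto
  then show ?thesis
    by (rule iffD1[OF root_cone_cong, rotated]) (simp add: simple_root_entry(3))
qed

locale classical =
  fixes t :: lie_type and n :: nat
  assumes valid: "(t = TypeC \<and> n \<ge> 1) \<or> (t = TypeD \<and> n \<ge> 3)"
begin

lemma n_pos: "n > 0" using valid by auto

sublocale mat_lie_algebra "lie_alg t n"
  by unfold_locales (rule lie_alg_closed; assumption)+

text \<open>In type D the matrices excluded here vanish: \<open>2 \<epsilon>\<^sub>i\<close> is not a root.\<close>

lemma positive_root_cone:
  assumes pq: "p < 2 * n" "q < 2 * n" and h: "height n q < height n p"
    and D: "\<not> (t = TypeD \<and> q = opp n p)"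
  shows "root_cone t n (\<lambda>i. of_int (letter_weight n i p - letter_weight n i q))"
proof -
  have w: "of_int (letter_weight n i p) = unit_fun p i" if "p < n" "i < n" for p i
    using that by (auto simp: letter_weight_def unit_fun_def)
  have w': "of_int (letter_weight n i p) = - unit_fun (p - n) i" if "n \<le> p" "i < n" for p i
    using that by (auto simp: letter_weight_def unit_fun_def)
  consider "p < n" "q < n" "p < q" | "p < n" "n \<le> q" | "n \<le> p" "n \<le> q" "q - n < p - n"
    using pq h by (auto simp: height_eq split: if_splits)
  then show ?thesis
  proof cases
    case 1
    then have "root_cone t n (\<lambda>i. unit_fun p i - unit_fun q i)" by (intro root_cone_diff) auto
    then show ?thesis by (rule iffD1[OF root_cone_cong, rotated]) (use 1 in \<open>simp add: w\<close>)
  next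
    case 2
    have "root_cone t n (\<lambda>i. unit_fun p i + unit_fun (q - n) i)"
    proof (cases t)
      case TypeC
      then show ?thesis using root_cone_sum_C[of p n "q - n"] 2 pq by auto
    next
      case TypeD
      then have "p \<noteq> q - n" using D 2 by (auto simp: opp_def)
      then consider "p < q - n" | "q - n < p" by linarith
      then show ?thesis
        using root_cone_sum_D[of p "q - n" n] root_cone_sum_D[of "q - n" p n] 2 pq TypeD
        by cases (auto simp: add.commute)
    qed
    then show ?thesis by (rule iffD1[OF root_cone_cong, rotated]) (use 2 in \<open>simp add: w w'\<close>)
  next
    case 3
    then have "root_cone t n (\<lambda>i. unit_fun (q - n) i - unit_fun (p - n) i)"
      using pq by (intro root_cone_diff) auto
    then show ?thesis by (rule iffD1[OF root_cone_cong, rotated]) (use 3 in \<open>simp add: w'\<close>)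
  qed
qed

text \<open>A linear functional on the root cone is controlled by its values on simple roots. It is
  applied to the height, and for saturation to the coordinate sum and to a sign vector.\<close>

lemma root_cone_functional:
  assumes \<alpha>: "\<And>j. j < n \<Longrightarrow> \<alpha> j = (\<Sum>i<n. of_nat (m i) * simple_root t n i $ j)"
  shows "(\<Sum>j<n. k j * \<alpha> j) = (\<Sum>i<n. of_nat (m i) * (\<Sum>j<n. k j * simple_root t n i $ j :: rat))"
proof -
  have "(\<Sum>j<n. k j * \<alpha> j) = (\<Sum>j<n. \<Sum>i<n. of_nat (m i) * (k j * simple_root t n i $ j))"
    by (intro sum.cong) (simp_all add: \<alpha> sum_distrib_left mult_ac)
  then show ?thesis by (subst (asm) sum.swap) (simp add: sum_distrib_left)
qed

lemma simple_root_functional: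
  assumes i: "i < n"
  shows "Suc i < n \<Longrightarrow> (\<Sum>j<n. k j * simple_root t n i $ j) = k i - k (Suc i)"
    and "i = n - 1 \<Longrightarrow> (\<Sum>j<n. k j * simple_root t n i $ j)
      = (case t of TypeC \<Rightarrow> 2 * k (n - 1) | TypeD \<Rightarrow> k (n - 2) + k (n - 1))"
proof -
  have u: "(\<Sum>j<n. k j * unit_fun p j) = k p" if "p < n" for p and k :: "nat \<Rightarrow> rat"
  proof -
    have "(\<Sum>j<n. k j * unit_fun p j) = (\<Sum>j<n. if j = p then k p else 0)"
      by (intro sum.cong) (auto simp: unit_fun_def)
    then show ?thesis using that by simp
  qed
  show "(\<Sum>j<n. k j * simple_root t n i $ j) = k i - k (Suc i)" if "Suc i < n"
  proof -
    have "(\<Sum>j<n. k j * simple_root t n i $ j) = (\<Sum>j<n. k j * unit_fun i j - k j * unit_fun (Suc i) j)"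
      using that by (intro sum.cong) (auto simp: simple_root_entry(1) right_diff_distrib)
    then show ?thesis using that u[of i k] u[of "Suc i" k] by (simp add: sum_subtractf)
  qed
  show "(\<Sum>j<n. k j * simple_root t n i $ j)
      = (case t of TypeC \<Rightarrow> 2 * k (n - 1) | TypeD \<Rightarrow> k (n - 2) + k (n - 1))" if e: "i = n - 1"
  proof (cases t)
    case TypeC
    have "(\<Sum>j<n. k j * simple_root t n i $ j) = (\<Sum>j<n. 2 * (k j * unit_fun (n - 1) j))"
      unfolding e TypeC by (intro sum.cong) (auto simp: simple_root_entry(2))
    then show ?thesis using TypeC u[of "n - 1" k] n_pos by (simp add: sum_distrib_left[symmetric])
  next
    case TypeD
    have "(\<Sum>j<n. k j * simple_root t n i $ j) = (\<Sum>j<n. k j * unit_fun (n - 2) j + k j * unit_fun (n - 1) j)"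
      unfolding e TypeD by (intro sum.cong) (auto simp: simple_root_entry(3) distrib_left)
    then show ?thesis using TypeD u[of "n - 1" k] u[of "n - 2" k] n_pos by (simp add: sum.distrib)
  qed
qed

text \<open>The values are 1 on the differences, 2 on the last root in type C and 3 on the last root
  in type D.\<close>

lemma simple_root_height_pos:
  assumes i: "i < n"
  shows "(\<Sum>j<n. of_nat (n - j) * simple_root t n i $ j) > 0"
proof (cases "Suc i < n")
  case True
  then show ?thesis unfolding simple_root_functional(1)[OF i True] by simp
next
  case False
  then have e: "i = n - 1" using i by simp
  show ?thesis unfolding simple_root_functional(2)[OF i e] using n_pos by (cases t) auto
qed

lemma root_cone_height_pos:
  assumes "root_cone t n \<alpha>" "\<exists>j<n. \<alpha> j \<noteq> 0"
  shows "(\<Sum>j<n. of_nat (n - j) * \<alpha> j) > 0"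
proof -
  obtain m where m: "\<And>j. j < n \<Longrightarrow> \<alpha> j = (\<Sum>i<n. of_nat (m i) * simple_root t n i $ j)"
    using assms(1) unfolding root_cone_def by blast
  have "\<exists>i<n. m i \<noteq> 0"
  proof (rule ccontr)
    assume "\<not> ?thesis"
    then have "\<alpha> j = 0" if "j < n" for j using m[OF that] by simp
    then show False using assms(2) by blast
  qed
  then obtain i where i: "i < n" "m i \<noteq> 0" by blast
  let ?h = "\<lambda>i. \<Sum>j<n. of_nat (n - j) * simple_root t n i $ j"
  have "(\<Sum>i<n. of_nat (m i) * ?h i) > 0"
  proof (rule sum_pos2[of _ i])
    show "0 < of_nat (m i) * ?h i"
      using i by (intro mult_pos_pos simple_root_height_pos) auto
    show "0 \<le> of_nat (m k) * ?h k" if "k \<in> {..<n}" for k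
      using that by (intro mult_nonneg_nonneg less_imp_le[OF simple_root_height_pos]) auto
  qed (use i in auto)
  then show ?thesis using root_cone_functional[OF m, where k = "\<lambda>j. of_nat (n - j)"] by simp
qed

section \<open>The triangular decomposition in types C and D\<close>

definition Neg :: "rat mat set" where
  "Neg = {root_mat t n p q | p q. p < 2 * n \<and> q < 2 * n \<and> height n p < height n q}"

text \<open>The diagonal matrices enter as the case p = q. \<open>grading_mat\<close> is inserted
  because \<open>h0\<close> itself must be a member.\<close>

definition Bor :: "rat mat set" where
  "Bor = insert (grading_mat n)
     {root_mat t n p q | p q. p < 2 * n \<and> q < 2 * n \<and> height n q \<le> height n p}"

sublocale triangular_lie_algebra "lie_alg t n" "grading_mat n" Neg Bor
proof
  show "Neg \<subseteq> lie_alg t n" "Bor \<subseteq> lie_alg t n" "grading_mat n \<in> Bor"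
    by (auto simp: Neg_def Bor_def root_mat_lie_alg grading_mat_lie_alg)
  fix f assume "f \<in> Neg"
  then obtain p q where pq: "f = root_mat t n p q" "p < 2 * n" "q < 2 * n" "height n p < height n q"
    by (auto simp: Neg_def)
  have "lie_bracket (grading_mat n) f = (- of_nat (nat (height n q - height n p))) \<cdot>\<^sub>m f"
    unfolding pq(1) bracket_grading_root_mat[OF pq(2,3)] using pq(4) by simp
  then show "\<exists>k\<ge>1. lie_bracket (grading_mat n) f = (- of_nat k) \<cdot>\<^sub>m f"
    using pq(4) by (intro exI[of _ "nat (height n q - height n p)"]) auto
next
  fix x and P :: "rat mat \<Rightarrow> bool"
  assume x: "x \<in> lie_alg t n" and base: "\<And>y. y \<in> Neg \<union> Bor \<Longrightarrow> P y"
    and steps: "\<And>y z. y \<in> lie_alg t n \<Longrightarrow> z \<in> lie_alg t n \<Longrightarrow> P y \<Longrightarrow> P z \<Longrightarrow> P (y + z)"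
      "\<And>c y. y \<in> lie_alg t n \<Longrightarrow> P y \<Longrightarrow> P (c \<cdot>\<^sub>m y)"
  have "P (root_mat t n p q)" if "p < 2 * n" "q < 2 * n" for p q
  proof -
    have "root_mat t n p q \<in> Neg" if "height n p < height n q"
      unfolding Neg_def using that \<open>p < 2 * n\<close> \<open>q < 2 * n\<close> by blast
    moreover have "root_mat t n p q \<in> Bor" if "height n q \<le> height n p"
      unfolding Bor_def using that \<open>p < 2 * n\<close> \<open>q < 2 * n\<close> by blast
    ultimately show ?thesis using base by (meson UnI1 UnI2 not_less)
  qed
  then show "P x" by (rule lie_alg_span[OF n_pos x _ steps])
qed

text \<open>The raising condition of \<open>maximal_vector\<close>, tested on root matrices instead
  of all root spaces, so that it can be verified entry by entry. Being nonzero is left as a separate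
  assumption.\<close>

abbreviation "singular_vector \<equiv> \<lambda>M \<nu> v. v \<in> carrier M \<and>
  (\<forall>i<n. gen (cartan n i) \<odot>\<^bsub>M\<^esub> v = scal (\<nu> $ i) \<odot>\<^bsub>M\<^esub> v) \<and>
  (\<forall>p<2 * n. \<forall>q<2 * n. height n q < height n p \<longrightarrow> gen (root_mat t n p q) \<odot>\<^bsub>M\<^esub> v = \<zero>\<^bsub>M\<^esub>)"

text \<open>The linear form on the Borel subalgebra induced by \<open>\<nu>\<close>: the coefficient
  of H_i in a diagonal matrix of the Lie algebra is its entry at (i, i).\<close>

definition weight_char :: "rat vec \<Rightarrow> rat mat \<Rightarrow> rat" where
  "weight_char \<nu> b = (\<Sum>i<n. b $$ (i, i) * \<nu> $ i)"

lemma gen_grading_act: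
  assumes M: "left_module U M" and v: "v \<in> carrier M"
    and w: "\<And>i. i < n \<Longrightarrow> gen (cartan n i) \<odot>\<^bsub>M\<^esub> v = scal (c i) \<odot>\<^bsub>M\<^esub> v"
  shows "gen (grading_mat n) \<odot>\<^bsub>M\<^esub> v = scal (\<Sum>i<n. of_nat (n - i) * c i) \<odot>\<^bsub>M\<^esub> v"
proof -
  interpret M: triangular_module "lie_alg t n" "grading_mat n" Neg Bor M
    by (intro triangular_module.intro triangular_lie_algebra_axioms M)
  \<comment> \<open>Partial sums of \<open>grading_mat\<close>, so that additivity of
    \<open>gen\<close> is applied to one \<open>cartan n k\<close> at a time.\<close>
  define G where "G k = mat (2 * n) (2 * n) (\<lambda>(a, b).
      if a = b then of_int (\<Sum>i<k. int (n - i) * letter_weight n i a) else 0 :: rat)" for k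
  have "G k \<in> lie_alg t n \<and> gen (G k) \<odot>\<^bsub>M\<^esub> v = scal (\<Sum>i<k. of_nat (n - i) * c i) \<odot>\<^bsub>M\<^esub> v"
    if "k \<le> n" for k
    using that
  proof (induction k)
    case 0
    have "G 0 = 0 \<cdot>\<^sub>m cartan n 0" by (rule eq_matI) (auto simp: G_def)
    then show ?case
      using smult_closed[OF cartan_lie_alg[OF n_pos, of t], of 0] cartan_lie_alg[OF n_pos, of t] v
      by (simp add: M.gen_smult_act)
  next
    case (Suc k)
    have G: "G (Suc k) = G k + of_nat (n - k) \<cdot>\<^sub>m cartan n k"
      by (rule eq_matI) (auto simp: G_def cartan_entry)
    have c: "cartan n k \<in> lie_alg t n" using Suc.prems by (intro cartan_lie_alg) simp
    show ?case
      using Suc c v add_closed[OF _ smult_closed[OF c]] smult_closed[OF c]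
      by (simp add: G M.gen_add_act M.gen_smult_act w M.scal_scal M.scal_plus)
  qed
  then have "gen (G n) \<odot>\<^bsub>M\<^esub> v = scal (\<Sum>i<n. of_nat (n - i) * c i) \<odot>\<^bsub>M\<^esub> v" by blast
  moreover have "G n = grading_mat n" unfolding G_def grading_mat_def height_def ..
  ultimately show ?thesis by simp
qed

text \<open>The character depends on \<open>\<nu>\<close> alone. Two singular vectors of equal
  weight in different modules therefore share it, as \<open>annihilates_simple\<close>
  demands.\<close>

lemma Bor_act:
  assumes M: "left_module U M" and v: "singular_vector M \<nu> v" and b: "b \<in> Bor"
  shows "gen b \<odot>\<^bsub>M\<^esub> v = scal (weight_char \<nu> b) \<odot>\<^bsub>M\<^esub> v"
proof -
  interpret M: triangular_module "lie_alg t n" "grading_mat n" Neg Bor M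
    by (intro triangular_module.intro triangular_lie_algebra_axioms M)
  have vc: "v \<in> carrier M" using v by blast
  have cart: "gen (cartan n i) \<odot>\<^bsub>M\<^esub> v = scal (\<nu> $ i) \<odot>\<^bsub>M\<^esub> v" if "i < n" for i using v that by blast
  from b consider "b = grading_mat n"
    | p q where "p < 2 * n" "q < 2 * n" "height n q \<le> height n p" "b = root_mat t n p q"
    by (auto simp: Bor_def)
  then show ?thesis
  proof cases
    case 1
    have "weight_char \<nu> b = (\<Sum>i<n. of_nat (n - i) * \<nu> $ i)"
      unfolding weight_char_def 1
      by (intro sum.cong) (auto simp: grading_mat_def height_eq of_nat_diff)
    then show ?thesis using gen_grading_act[OF M vc cart] 1 by simp
  next
    case 2
    show ?thesis
    proof (cases "p = q")
      case False
      then have "height n q < height n p" using 2 height_inj[of q n p] by fastforce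
      moreover have "weight_char \<nu> b = 0"
        unfolding weight_char_def 2(4) using False 2(1,2)
        by (intro sum.neutral) (auto simp: root_mat_entry opp_def split: if_splits)
      ultimately show ?thesis using v 2 vc by simp
    next
      case True
      show ?thesis
      proof (cases "p < n")
        case p: True
        have "weight_char \<nu> b = (\<Sum>i<n. if i = p then \<nu> $ p else 0)"
          unfolding weight_char_def 2(4) using p True
          by (intro sum.cong) (auto simp: root_mat_entry opp_def)
        then show ?thesis
          using cart[OF p] cartan_eq_root_mat[OF p, of t] p True 2(4) by simp
      next
        case p: False
        let ?p = "p - n"
        have p': "?p < n" using p 2(1) by simp
        \<comment> \<open>A letter of the second half has the weight opposite to that of the letter
          \<open>?p\<close>.\<close>
        have b: "b = (- 1) \<cdot>\<^sub>m cartan n ?p"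
          unfolding 2(4) True[symmetric] using p 2(1)
          by (intro eq_matI)
            (auto simp: root_mat_entry cartan_entry letter_weight_def opp_def eps_def split: lie_type.split)
        have "weight_char \<nu> b = (\<Sum>i<n. if i = ?p then - \<nu> $ ?p else 0)"
          unfolding weight_char_def b
          by (intro sum.cong) (auto simp: cartan_entry letter_weight_def)
        then show ?thesis
          using cart[OF p'] cartan_lie_alg[OF p', of t] p' vc
          by (simp add: b M.gen_smult_act M.scal_scal)
      qed
    qed
  qed
qed

lemma maximal_vector_singular:
  assumes M: "left_module U M" and v: "maximal_vector t n M \<nu> v"
  shows "singular_vector M \<nu> v"
proof (intro conjI allI impI)
  interpret M: triangular_module "lie_alg t n" "grading_mat n" Neg Bor M
    by (intro triangular_module.intro triangular_lie_algebra_axioms M)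
  show vc: "v \<in> carrier M" using v by (simp add: maximal_vector_def)
  show "gen (cartan n i) \<odot>\<^bsub>M\<^esub> v = scal (\<nu> $ i) \<odot>\<^bsub>M\<^esub> v" if "i < n" for i
    using v that by (simp add: maximal_vector_def)
  fix p q assume pq: "p < 2 * n" "q < 2 * n" "height n q < height n p"
  show "gen (root_mat t n p q) \<odot>\<^bsub>M\<^esub> v = \<zero>\<^bsub>M\<^esub>"
  proof (cases "t = TypeD \<and> q = opp n p")
    case True
    \<comment> \<open>Both entries of the root matrix sit at the same place and cancel.\<close>
    have "root_mat t n p q = 0 \<cdot>\<^sub>m root_mat t n p q"
      using True pq by (intro eq_matI) (auto simp: root_mat_entry eps_def)
    then have "gen (root_mat t n p q) \<odot>\<^bsub>M\<^esub> v = gen (0 \<cdot>\<^sub>m root_mat t n p q) \<odot>\<^bsub>M\<^esub> v" by simp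
    also have "\<dots> = \<zero>\<^bsub>M\<^esub>"
      using root_mat_lie_alg[OF pq(1,2), of t] vc by (simp add: M.gen_smult_act)
    finally show ?thesis .
  next
    case False
    let ?a = "vec n (\<lambda>i. rat_of_int (letter_weight n i p - letter_weight n i q))"
    have "dom_le t n (0\<^sub>v n) ?a"
      using positive_root_cone[OF pq False]
      by (subst dom_le_iff_root_cone) (auto elim: iffD1[OF root_cone_cong, rotated])
    moreover have "?a \<noteq> 0\<^sub>v n"
    proof
      assume "?a = 0\<^sub>v n"
      then have "letter_weight n i p = letter_weight n i q" if "i < n" for i
        using that by (auto simp: vec_eq_iff)
      then have "height n p = height n q" by (simp add: height_def)
      then show False using pq by simp
    qed
    ultimately show ?thesis
      using v root_mat_root_space[OF pq(1,2), of t] unfolding maximal_vector_def by auto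
  qed
qed

lemma annihilates_highest_weight_module:
  fixes M :: "((rat mat list \<Rightarrow> rat) set, 'v) module" and M' :: "((rat mat list \<Rightarrow> rat) set, 'w) module"
  assumes M: "simple_module U M" "highest_weight_module t n M \<nu>"
    and M': "left_module U M'" and w: "singular_vector M' \<nu> w" "w \<noteq> \<zero>\<^bsub>M'\<^esub>"
    and u: "u \<in> carrier U" "annihilates u M'"
  shows "annihilates u M"
proof -
  have lm: "left_module U M" using M(1) by (simp add: simple_module_def)
  obtain v where v: "maximal_vector t n M \<nu> v" using M(2) by (auto simp: highest_weight_module_def)
  note v' = maximal_vector_singular[OF lm v]
  show ?thesis
  proof (rule annihilates_simple[OF M(1) M' _ _ _ w(2) _ _ u])
    show "v \<in> carrier M" "v \<noteq> \<zero>\<^bsub>M\<^esub>" using v by (simp_all add: maximal_vector_def)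
    show "w \<in> carrier M'" using w(1) by blast
  qed (use Bor_act[OF lm v'] Bor_act[OF M' w(1)] in auto)
qed

end

section \<open>Complete reducibility of the tensor representation\<close>

definition tensor_dot :: "nat \<Rightarrow> nat \<Rightarrow> (nat list \<Rightarrow> rat) \<Rightarrow> (nat list \<Rightarrow> rat) \<Rightarrow> rat" where
  "tensor_dot N r S T = (\<Sum>w\<in>tensor_words N r. S w * T w)"

lemma tensor_dot_linear:
  "tensor_dot N r (\<lambda>w. S w + S' w) T = tensor_dot N r S T + tensor_dot N r S' T"
  "tensor_dot N r (\<lambda>w. S w - S' w) T = tensor_dot N r S T - tensor_dot N r S' T"
  "tensor_dot N r (\<lambda>w. c * S w) T = c * tensor_dot N r S T"
  "tensor_dot N r T (\<lambda>w. S w + S' w) = tensor_dot N r T S + tensor_dot N r T S'"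
  "tensor_dot N r T (\<lambda>w. S w - S' w) = tensor_dot N r T S - tensor_dot N r T S'"
  "tensor_dot N r T (\<lambda>w. c * S w) = c * tensor_dot N r T S"
  "tensor_dot N r (\<lambda>w. 0) T = 0" "tensor_dot N r T (\<lambda>w. 0) = 0"
  by (simp_all add: tensor_dot_def sum.distrib sum_subtractf sum_distrib_left algebra_simps)

lemma tensor_dot_self_nonneg: "tensor_dot N r T T \<ge> 0"
  by (simp add: tensor_dot_def sum_nonneg)

lemma tensor_dot_self_eq_0:
  assumes "T \<in> carrier (tensor_space N r)" "tensor_dot N r T T = 0"
  shows "T = (\<lambda>w. 0)"
proof
  fix w
  show "T w = 0"
  proof (cases "w \<in> tensor_words N r")
    case True
    have "\<forall>w\<in>tensor_words N r. T w * T w = 0"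
      using assms(2) unfolding tensor_dot_def by (subst (asm) sum_nonneg_eq_0_iff) auto
    then show ?thesis using True by simp
  qed (use assms(1) in \<open>simp add: tensor_space_carrier\<close>)
qed

lemma tensor_dot_adjoint:
  assumes x: "x \<in> carrier_mat N N" and S: "S \<in> carrier (tensor_space N r)"
    and T: "T \<in> carrier (tensor_space N r)"
  shows "tensor_dot N r (tensor_action N r x S) T = tensor_dot N r S (tensor_action N r (transpose_mat x) T)"
proof -
  let ?W = "tensor_words N r"
  have "tensor_dot N r (tensor_action N r x S) T
      = (\<Sum>w\<in>?W. \<Sum>k<r. \<Sum>j<N. x $$ (w ! k, j) * S (w[k := j]) * T w)"
    unfolding tensor_dot_def
    by (intro sum.cong) (auto simp: tensor_action_eq[OF S] deriv_action_eq tensor_words_length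
        sum_distrib_right)
  also have "\<dots> = (\<Sum>k<r. \<Sum>w\<in>?W. \<Sum>j<N. x $$ (w ! k, j) * S (w[k := j]) * T w)"
    by (rule sum.swap)
  also have "\<dots> = (\<Sum>k<r. \<Sum>w\<in>?W. \<Sum>j<N. S w * (transpose_mat x $$ (w ! k, j) * T (w[k := j])))"
  proof (rule sum.cong[OF refl])
    fix k assume "k \<in> {..<r}"
    then have k: "k < r" by simp
    show "(\<Sum>w\<in>?W. \<Sum>j<N. x $$ (w ! k, j) * S (w[k := j]) * T w)
        = (\<Sum>w\<in>?W. \<Sum>j<N. S w * (transpose_mat x $$ (w ! k, j) * T (w[k := j])))"
    proof -
      \<comment> \<open>Exchanging the k-th letter with \<open>j\<close> is an involution on the
        pairs (w, j); it swaps the two indices of \<open>x\<close>, hence the transpose.\<close>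
      define f where "f = (\<lambda>(w, j). (w[k := j], w ! k :: nat))"
      have f: "f (f wj) = wj" "f wj \<in> ?W \<times> {..<N}" if "wj \<in> ?W \<times> {..<N}" for wj
        using that k by (auto simp: f_def tensor_words_update tensor_words_nth tensor_words_length)
      show ?thesis
        unfolding sum.cartesian_product
        by (rule sum.reindex_bij_witness[of _ f f])
          (use f x k in \<open>auto simp: f_def tensor_words_nth tensor_words_length\<close>)
    qed
  qed
  also have "\<dots> = (\<Sum>w\<in>?W. \<Sum>k<r. \<Sum>j<N. S w * (transpose_mat x $$ (w ! k, j) * T (w[k := j])))"
    by (rule sum.swap)
  also have "\<dots> = tensor_dot N r S (tensor_action N r (transpose_mat x) T)"
    unfolding tensor_dot_def
    by (intro sum.cong) (auto simp: tensor_action_eq[OF T] deriv_action_eq tensor_words_length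
        sum_distrib_left)
  finally show ?thesis .
qed

section \<open>Bases, orthogonal projection and dimension of subspaces\<close>

interpretation fun_space: vector_space "\<lambda>(c :: rat) (f :: nat list \<Rightarrow> rat) w. c * f w"
  by unfold_locales (auto simp: fun_eq_iff algebra_simps)

definition tensor_unit :: "nat list \<Rightarrow> nat list \<Rightarrow> rat" where
  "tensor_unit u = (\<lambda>w. if w = u then 1 else 0)"

lemma tensor_space_span:
  "carrier (tensor_space N r) \<subseteq> fun_space.span (tensor_unit ` tensor_words N r)"
proof
  fix T assume T: "T \<in> carrier (tensor_space N r)"
  have sum_apply: "(\<Sum>i\<in>I. f i) w = (\<Sum>i\<in>I. f i w)" if "finite I"
    for I and f :: "nat list \<Rightarrow> nat list \<Rightarrow> rat" and w
    using that by (induction I rule: finite_induct) auto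
  have "T = (\<Sum>u\<in>tensor_words N r. (\<lambda>w. T u * tensor_unit u w))"
  proof
    fix w
    have "(\<Sum>u\<in>tensor_words N r. T u * tensor_unit u w)
        = (\<Sum>u\<in>tensor_words N r. if u = w then T w else 0)"
      by (intro sum.cong) (auto simp: tensor_unit_def)
    also have "\<dots> = T w" using T by (simp add: tensor_space_carrier)
    finally show "T w = (\<Sum>u\<in>tensor_words N r. (\<lambda>w. T u * tensor_unit u w)) w"
      by (simp add: sum_apply)
  qed
  also have "\<dots> \<in> fun_space.span (tensor_unit ` tensor_words N r)"
    by (intro fun_space.span_sum fun_space.span_scale fun_space.span_base) auto
  finally show "T \<in> fun_space.span (tensor_unit ` tensor_words N r)" .
qed

lemma tensor_independent_finite:
  assumes "fun_space.independent B" "B \<subseteq> carrier (tensor_space N r)"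
  shows "finite B"
  using fun_space.independent_span_bound[OF _ assms(1)] assms(2) tensor_space_span[of N r]
  by (meson finite_imageI finite_tensor_words subset_trans)

text \<open>A Gram-Schmidt induction: \<open>b'\<close> is the part of the new vector orthogonal to
  the old span, and the projection is corrected along it.\<close>

lemma orthogonal_projection_span:
  assumes "finite B" "B \<subseteq> carrier (tensor_space N r)" "T \<in> carrier (tensor_space N r)"
  shows "\<exists>S\<in>fun_space.span B. \<forall>b\<in>B. tensor_dot N r (\<lambda>w. T w - S w) b = 0"
  using assms
proof (induction B arbitrary: T rule: finite_induct)
  case empty
  then show ?case by (auto intro: fun_space.span_zero)
next
  case (insert b B)
  let ?d = "tensor_dot N r" and ?V = "carrier (tensor_space N r)"
  have sub: "fun_space.span B \<subseteq> fun_space.span (insert b B)" by (rule fun_space.span_mono) auto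
  have spanV: "S \<in> ?V" if "S \<in> fun_space.span B" for S
    using that insert.prems(1)
    by (induction rule: fun_space.span_induct_alt) (auto simp: tensor_space_carrier zero_fun_def)
  obtain Sb where Sb: "Sb \<in> fun_space.span B" "\<forall>c\<in>B. ?d (\<lambda>w. b w - Sb w) c = 0"
    using insert.IH[of b] insert.prems by auto
  obtain S where S: "S \<in> fun_space.span B" "\<forall>c\<in>B. ?d (\<lambda>w. T w - S w) c = 0"
    using insert.IH[of T] insert.prems by auto
  define b' where "b' = (\<lambda>w. b w - Sb w)"
  have b'V: "b' \<in> ?V"
    using insert.prems(1) spanV[OF Sb(1)] by (auto simp: b'_def tensor_space_carrier)
  have b'span: "b' \<in> fun_space.span (insert b B)"
  proof -
    have "b - Sb \<in> fun_space.span (insert b B)"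
      using subsetD[OF sub Sb(1)] fun_space.span_base[of b] by (intro fun_space.span_diff) auto
    then show ?thesis by (simp add: b'_def fun_diff_def)
  qed
  have orth_span: "?d X s = 0" if "\<forall>c\<in>B. ?d X c = 0" "s \<in> fun_space.span B" for X s
    using that(2)
    by (induction rule: fun_space.span_induct_alt)
      (use that(1) in \<open>auto simp: zero_fun_def plus_fun_def tensor_dot_linear\<close>)
  have b_eq: "?d X b = ?d X b' + ?d X Sb" for X
    by (simp add: b'_def tensor_dot_linear)
  show ?case
  proof (cases "?d b' b' = 0")
    case True
    \<comment> \<open>By definiteness \<open>b\<close> lies in the old span, to which the old
      residual is already orthogonal.\<close>
    then have "b' = (\<lambda>w. 0)" by (rule tensor_dot_self_eq_0[OF b'V])
    then have "?d (\<lambda>w. T w - S w) b = 0"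
      using orth_span[OF S(2) Sb(1)] by (simp add: b_eq tensor_dot_linear)
    then show ?thesis using S sub by auto
  next
    case False
    \<comment> \<open>The coefficient that makes the residual orthogonal to \<open>b'\<close>. As
      \<open>b'\<close> is orthogonal to \<open>B\<close>, the old orthogonality relations
      survive.\<close>
    define c where "c = ?d (\<lambda>w. T w - S w) b' / ?d b' b'"
    define S' where "S' = (\<lambda>w. S w + c * b' w)"
    have S'span: "S' \<in> fun_space.span (insert b B)"
    proof -
      have "S + (\<lambda>w. c * b' w) \<in> fun_space.span (insert b B)"
        using sub S(1) b'span by (intro fun_space.span_add fun_space.span_scale) auto
      then show ?thesis by (simp add: S'_def plus_fun_def)
    qed
    have eq: "(\<lambda>w. T w - S' w) = (\<lambda>w. (T w - S w) - c * b' w)"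
      by (simp add: S'_def algebra_simps)
    have B: "\<forall>e\<in>B. ?d (\<lambda>w. T w - S' w) e = 0"
      unfolding eq using S(2) Sb(2) by (simp add: tensor_dot_linear(2,3) b'_def[symmetric])
    have "?d (\<lambda>w. T w - S' w) b' = 0"
    proof -
      have "c * ?d b' b' = ?d (\<lambda>w. T w - S w) b'" using False by (simp add: c_def)
      then show ?thesis unfolding eq by (simp add: tensor_dot_linear(2,3))
    qed
    then have "?d (\<lambda>w. T w - S' w) b = 0"
      using orth_span[OF B Sb(1)] by (simp add: b_eq)
    then show ?thesis using B S'span by auto
  qed
qed

lemma orthogonal_projection:
  assumes W: "fun_space.subspace W" "W \<subseteq> carrier (tensor_space N r)"
    and T: "T \<in> carrier (tensor_space N r)"
  shows "\<exists>S\<in>W. \<forall>b\<in>W. tensor_dot N r (\<lambda>w. T w - S w) b = 0"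
proof -
  obtain B where B: "B \<subseteq> W" "fun_space.independent B" "W \<subseteq> fun_space.span B"
    by (rule fun_space.basis_exists[of W])
  have fin: "finite B" by (rule tensor_independent_finite[OF B(2) subset_trans[OF B(1) W(2)]])
  obtain S where S: "S \<in> fun_space.span B" "\<forall>b\<in>B. tensor_dot N r (\<lambda>w. T w - S w) b = 0"
    using orthogonal_projection_span[OF fin subset_trans[OF B(1) W(2)] T] by (elim bexE)
  have "tensor_dot N r (\<lambda>w. T w - S w) b = 0" if "b \<in> W" for b
  proof -
    have "b \<in> fun_space.span B" using that B(3) by auto
    then show ?thesis
      by (induction rule: fun_space.span_induct_alt)
        (use S(2) in \<open>auto simp: zero_fun_def plus_fun_def tensor_dot_linear\<close>)
  qed
  moreover have "S \<in> W" by (rule subsetD[OF fun_space.span_minimal[OF B(1) W(1)] S(1)])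
  ultimately show ?thesis by blast
qed

text \<open>A basis of the smaller space stays independent when a vector outside it is added. This
  makes a nonzero submodule of least dimension minimal.\<close>

lemma subspace_psubset_dim:
  assumes N: "fun_space.subspace N'" "N' \<subset> W" and W: "W \<subseteq> carrier (tensor_space N r)"
  shows "fun_space.dim N' < fun_space.dim W"
proof -
  obtain B where B: "B \<subseteq> N'" "fun_space.independent B" "N' \<subseteq> fun_space.span B" "card B = fun_space.dim N'"
    by (rule fun_space.basis_exists[of N'])
  obtain C where C: "C \<subseteq> W" "fun_space.independent C" "W \<subseteq> fun_space.span C" "card C = fun_space.dim W"
    by (rule fun_space.basis_exists[of W])
  have finC: "finite C" by (rule tensor_independent_finite[OF C(2) subset_trans[OF C(1) W]])
  obtain x where x: "x \<in> W" "x \<notin> N'" using N(2) by auto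
  have "fun_space.span B \<subseteq> N'" using fun_space.span_minimal[OF B(1) N(1)] .
  then have ind: "fun_space.independent (insert x B)"
    using x(2) B(2) by (subst fun_space.independent_insert) auto
  have "insert x B \<subseteq> fun_space.span C" using x(1) B(1) N(2) C(3) by blast
  then have "finite (insert x B) \<and> card (insert x B) \<le> card C"
    by (rule fun_space.independent_span_bound[OF finC ind])
  moreover have "x \<notin> B" using x(2) B(1) by auto
  ultimately have "Suc (card B) \<le> card C" by (metis card_insert_disjoint finite_insert)
  then show ?thesis using B(4) C(4) by simp
qed


section \<open>Weights of tensors\<close>

definition word_weight :: "nat \<Rightarrow> nat \<Rightarrow> nat list \<Rightarrow> int" where
  "word_weight n i w = (\<Sum>p\<leftarrow>w. letter_weight n i p)"

lemma deriv_action_diag: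
  assumes "w \<in> tensor_words N r" "\<And>a b. a < N \<Longrightarrow> b < N \<Longrightarrow> d $$ (a, b) = (if a = b then c a else 0)"
  shows "deriv_action N d T w = (\<Sum>p\<leftarrow>w. c p) * T w"
  using assms(1)
proof (induction w arbitrary: T r)
  case (Cons a w)
  then have a: "a < N" and w: "w \<in> tensor_words N (length w)" by auto
  have "(\<Sum>j<N. d $$ (a, j) * T (j # w)) = (\<Sum>j<N. if j = a then c a * T (a # w) else 0)"
    using a assms(2) by (intro sum.cong) auto
  then show ?case using a Cons.IH[OF w] by (simp add: distrib_right)
qed simp

lemma cartan_action:
  assumes T: "T \<in> carrier (tensor_space (2 * n) r)"
  shows "tensor_action (2 * n) r (cartan n i) T = (\<lambda>w. of_int (word_weight n i w) * T w)"
proof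
  fix w
  have "(\<Sum>p\<leftarrow>w. rat_of_int (letter_weight n i p)) = of_int (word_weight n i w)"
    by (induction w) (simp_all add: word_weight_def)
  then show "tensor_action (2 * n) r (cartan n i) T w = of_int (word_weight n i w) * T w"
    using T deriv_action_diag[of w "2 * n" r "cartan n i" "\<lambda>a. of_int (letter_weight n i a)" T]
    by (auto simp: tensor_action_eq cartan_entry tensor_space_carrier)
qed

lemma sum_word_height: "(\<Sum>p\<leftarrow>w. height n p) = (\<Sum>i<n. int (n - i) * word_weight n i w)"
  by (induction w) (simp_all add: word_weight_def height_def sum.distrib distrib_left)

text \<open>The words form a basis of common eigenvectors, so being a weight vector is a condition
  on the support, and all weights are integral.\<close>

lemma tensor_weight_iff:
  assumes T: "T \<in> carrier (tensor_space (2 * n) r)"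
  shows "tensor_action (2 * n) r (cartan n i) T = (\<lambda>w. c * T w) \<longleftrightarrow>
    (\<forall>w. T w \<noteq> 0 \<longrightarrow> of_int (word_weight n i w) = c)"
  unfolding cartan_action[OF T] fun_eq_iff by auto

section \<open>Minimal submodules and maximal vectors of the tensor power\<close>

locale classical_tensor = classical +
  fixes r :: nat
begin

sublocale tensor_representation "lie_alg t n" "2 * n" r
  by unfold_locales (rule lie_alg_carrier)

sublocale T: triangular_module "lie_alg t n" "grading_mat n" Neg Bor tensor_module
  by (intro triangular_module.intro triangular_lie_algebra_axioms left_module_tensor)

lemma submodule_subspace:
  assumes W: "submodule W U tensor_module"
  shows "fun_space.subspace W" "W \<subseteq> V"
proof -
  note W' = T.M.submoduleD[OF W]
  show sub: "W \<subseteq> V" using W'(1) by simp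
  show "fun_space.subspace W"
    unfolding fun_space.subspace_def
  proof (intro conjI ballI allI)
    show "0 \<in> W" using W'(2) by (simp add: zero_fun_def)
    show "x + y \<in> W" if "x \<in> W" "y \<in> W" for x y
      using W'(3)[OF that] by (simp add: plus_fun_def)
    show "(\<lambda>w. c * x w) \<in> W" if x: "x \<in> W" for c x
      using W'(4)[OF scal_closed[of c] x] rep_scal[of x c] sub x by auto
  qed
qed

lemma minimal_submodule_exists:
  assumes W0: "submodule W0 U tensor_module" "W0 \<noteq> {\<lambda>w. 0}"
  obtains W where "submodule W U tensor_module" "W \<subseteq> W0" "W \<noteq> {\<lambda>w. 0}"
    "\<And>N'. submodule N' U tensor_module \<Longrightarrow> N' \<subseteq> W \<Longrightarrow> N' = {\<lambda>w. 0} \<or> N' = W"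
proof -
  let ?P = "\<lambda>W. submodule W U tensor_module \<and> W \<subseteq> W0 \<and> W \<noteq> {\<lambda>w. 0}"
  obtain W where W: "?P W" "\<And>W'. ?P W' \<Longrightarrow> fun_space.dim W \<le> fun_space.dim W'"
    using ex_has_least_nat[of ?P W0 fun_space.dim] W0 by blast
  have "N' = {\<lambda>w. 0} \<or> N' = W" if N': "submodule N' U tensor_module" "N' \<subseteq> W" for N'
  proof (rule ccontr)
    assume "\<not> ?thesis"
    then have "?P N'" "N' \<subset> W" using N' W(1) by auto
    then have "fun_space.dim N' < fun_space.dim W"
      using submodule_subspace N' W(1) by (intro subspace_psubset_dim[of _ _ "2 * n" r]) auto
    then show False using W(2)[OF \<open>?P N'\<close>] by simp
  qed
  then show ?thesis using W(1) that by blast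
qed

lemma submodule_action:
  assumes "submodule W U tensor_module" "x \<in> lie_alg t n" "T \<in> W"
  shows "\<rho> x T \<in> W"
  using T.M.submoduleD(4)[OF assms(1) gen_closed[OF assms(2)] assms(3)] rep_gen[OF assms(2)] by simp

definition weight_tensor :: "(nat \<Rightarrow> int) \<Rightarrow> (nat list \<Rightarrow> rat) \<Rightarrow> bool" where
  "weight_tensor c T \<longleftrightarrow> (\<forall>i<n. \<forall>w. T w \<noteq> 0 \<longrightarrow> word_weight n i w = c i)"

lemma weight_tensor_action:
  "T \<in> V \<Longrightarrow> weight_tensor c T \<Longrightarrow> i < n \<Longrightarrow> \<rho> (cartan n i) T = (\<lambda>w. of_int (c i) * T w)"
  by (subst tensor_weight_iff) (auto simp: weight_tensor_def)

text \<open>A nonzero element of minimal support is a weight vector: otherwise subtracting a multiple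
  from its image under some \<open>H\<^sub>i\<close> would cancel a part of the support.\<close>

lemma weight_tensor_exists:
  assumes W: "submodule W U tensor_module" "W \<noteq> {\<lambda>w. 0}"
  obtains T c where "T \<in> W" "T \<noteq> (\<lambda>w. 0)" "weight_tensor c T"
proof -
  note W' = T.M.submoduleD[OF W(1)] and ss = submodule_subspace[OF W(1)]
  let ?P = "\<lambda>T. T \<in> W \<and> T \<noteq> (\<lambda>w. 0)" and ?s = "\<lambda>T :: nat list \<Rightarrow> rat. {w. T w \<noteq> 0}"
  have "\<exists>T. ?P T" using W'(2) W(2) by (auto simp: set_eq_iff)
  then obtain T where T: "?P T" "\<And>S. ?P S \<Longrightarrow> card (?s T) \<le> card (?s S)"
    using ex_has_least_nat[of ?P _ "\<lambda>T. card (?s T)"] by blast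
  then have TV: "T \<in> V" using ss by auto
  obtain w where w: "T w \<noteq> 0" using T(1) by auto
  have fin: "finite (?s T)"
    using TV by (intro finite_subset[OF _ finite_tensor_words[of "2 * n" r]]) (auto simp: tensor_space_carrier)
  have "word_weight n i w' = word_weight n i w" if i: "i < n" and w': "T w' \<noteq> 0" for i w'
  proof (rule ccontr)
    assume ne: "word_weight n i w' \<noteq> word_weight n i w"
    define S where "S = (\<lambda>u. of_int (word_weight n i u) * T u - of_int (word_weight n i w) * T u)"
    have "\<rho> (cartan n i) T \<in> W" using submodule_action[OF W(1) cartan_lie_alg[OF i]] T(1) by blast
    moreover have "(\<lambda>u. of_int (word_weight n i w) * T u) \<in> W"
      using T(1) fun_space.subspace_scale[OF ss(1)] by blast
    ultimately have "\<rho> (cartan n i) T - (\<lambda>u. of_int (word_weight n i w) * T u) \<in> W"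
      by (rule fun_space.subspace_diff[OF ss(1)])
    then have "S \<in> W" by (simp add: S_def cartan_action[OF TV] fun_diff_def)
    moreover have "S w' \<noteq> 0" using ne w' by (simp add: S_def left_diff_distrib[symmetric])
    ultimately have PS: "?P S" by auto
    have "?s S \<subset> ?s T" using w by (auto simp: S_def)
    then have "card (?s S) < card (?s T)" using fin by (intro psubset_card_mono)
    then show False using T(2)[OF PS] by simp
  qed
  then have "weight_tensor (\<lambda>i. word_weight n i w) T" by (auto simp: weight_tensor_def)
  then show ?thesis using T(1) that by blast
qed

text \<open>Among the weight tensors in \<open>W\<close>, take one whose support contains a word of
  greatest height. An element of a root space of positive height maps it to a tensor of greater
  height, which must be zero.\<close>

lemma maximal_tensor_exists:
  assumes W: "submodule W U tensor_module" "W \<noteq> {\<lambda>w. 0}"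
  obtains T c where "T \<in> W" "T \<noteq> (\<lambda>w. 0)" "weight_tensor c T"
    "\<And>\<alpha> x. x \<in> root_space t n \<alpha> \<Longrightarrow> (\<Sum>i<n. of_nat (n - i) * \<alpha> $ i) > 0 \<Longrightarrow> \<rho> x T = (\<lambda>w. 0)"
proof -
  note W' = T.M.submoduleD[OF W(1)] and ss = submodule_subspace[OF W(1)]
  let ?h = "\<lambda>w. \<Sum>p\<leftarrow>w. height n p"
  let ?A = "{?h w | w T c. T \<in> W \<and> weight_tensor c T \<and> T w \<noteq> 0}"
  have "?A \<subseteq> ?h ` tensor_words (2 * n) r"
    using ss(2) by (auto simp: tensor_space_carrier subset_iff)
  then have fin: "finite ?A" by (rule finite_subset) simp
  obtain T0 c0 where "T0 \<in> W" "T0 \<noteq> (\<lambda>w. 0)" "weight_tensor c0 T0"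
    using weight_tensor_exists[OF W] .
  then have ne: "?A \<noteq> {}" by (auto simp: fun_eq_iff)
  obtain w T c where T: "T \<in> W" "weight_tensor c T" "T w \<noteq> 0" and max: "?h w = Max ?A"
    using Max_in[OF fin ne] by auto
  have TV: "T \<in> V" using T(1) ss by auto
  have "\<rho> x T = (\<lambda>w. 0)"
    if x: "x \<in> root_space t n \<alpha>" and pos: "(\<Sum>i<n. of_nat (n - i) * \<alpha> $ i) > 0" for \<alpha> x
  proof (rule ccontr)
    assume nz: "\<rho> x T \<noteq> (\<lambda>w. 0)"
    then obtain u where u: "\<rho> x T u \<noteq> 0" by auto
    have xL: "x \<in> lie_alg t n" using x by (simp add: root_space_def)
    have xT: "\<rho> x T \<in> W" by (rule submodule_action[OF W(1) xL T(1)])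
    then have xTV: "\<rho> x T \<in> V" using ss by auto
    have eig: "\<rho> (cartan n i) (\<rho> x T) = (\<lambda>w. (of_int (c i) + \<alpha> $ i) * \<rho> x T w)" if i: "i < n" for i
    proof -
      have ci: "cartan n i \<in> lie_alg t n" by (rule cartan_lie_alg[OF i])
      have "lie_bracket (cartan n i) x = \<alpha> $ i \<cdot>\<^sub>m x" using x i by (simp add: root_space_def)
      then have "\<rho> (cartan n i) (\<rho> x T)
          = (\<lambda>w. \<rho> x (\<rho> (cartan n i) T) w + rep (gen (\<alpha> $ i \<cdot>\<^sub>m x)) T w)"
        using T.gen_swap[OF ci xL, of T] TV xL ci by (simp add: rep_gen)
      also have "rep (gen (\<alpha> $ i \<cdot>\<^sub>m x)) T = (\<lambda>w. \<alpha> $ i * \<rho> x T w)"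
        using T.gen_smult_act[OF xL, of T "\<alpha> $ i"] TV xTV xL by (simp add: rep_gen rep_scal)
      also have "\<rho> x (\<rho> (cartan n i) T) = (\<lambda>w. of_int (c i) * \<rho> x T w)"
        unfolding weight_tensor_action[OF TV T(2) i]
        by (rule tensor_End_mem(4)[OF tensor_action_End TV])
      finally show ?thesis by (simp add: distrib_right)
    qed
    then have wt: "of_int (word_weight n i v) = of_int (c i) + \<alpha> $ i" if "\<rho> x T v \<noteq> 0" "i < n" for i v
      using tensor_weight_iff[OF xTV] that by blast
    \<comment> \<open>The coordinates of \<open>\<alpha>\<close> are only known to be rational, so
      the weight of the new tensor is read off the word \<open>u\<close> of its support.\<close>
    have "weight_tensor (\<lambda>i. word_weight n i u) (\<rho> x T)"
      unfolding weight_tensor_def using wt u by (metis of_int_eq_iff)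
    then have "?h u \<in> ?A" using xT u by blast
    then have "?h u \<le> ?h w" using Max_ge[OF fin] max by simp
    moreover have "rat_of_int (?h u) > of_int (?h w)"
    proof -
      have "rat_of_int (?h u) = (\<Sum>i<n. of_nat (n - i) * of_int (word_weight n i u))"
        unfolding sum_word_height by simp
      also have "\<dots> = (\<Sum>i<n. of_nat (n - i) * of_int (c i)) + (\<Sum>i<n. of_nat (n - i) * \<alpha> $ i)"
        unfolding sum.distrib[symmetric] using wt[OF u] by (intro sum.cong) (auto simp: distrib_left)
      also have "(\<Sum>i<n. of_nat (n - i) * of_int (c i)) = rat_of_int (?h w)"
        unfolding sum_word_height using T by (auto simp: weight_tensor_def intro!: sum.cong)
      finally show ?thesis using pos by simp
    qed
    ultimately show False by simp
  qed
  moreover have "T \<noteq> (\<lambda>w. 0)" using T(3) by auto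
  ultimately show ?thesis using that T by blast
qed

end

section \<open>Dominant weights\<close>

text \<open>The square length of a simple root is 2, except for the last one in type C, where it is
  4.\<close>

lemma (in classical) dominant_weights_iff:
  assumes \<nu>: "\<nu> \<in> carrier_vec n"
  shows "\<nu> \<in> dominant_weights t n \<longleftrightarrow> (\<forall>i. Suc i < n \<longrightarrow> \<nu> $ i - \<nu> $ Suc i \<in> \<nat>) \<and>
    (case t of TypeC \<Rightarrow> \<nu> $ (n - 1) \<in> \<nat> | TypeD \<Rightarrow> \<nu> $ (n - 2) + \<nu> $ (n - 1) \<in> \<nat>)"
proof -
  let ?p = "\<lambda>i. 2 * (\<nu> \<bullet> simple_root t n i) / (simple_root t n i \<bullet> simple_root t n i)"
  have u: "unit_vec n i \<in> carrier_vec n" for i by simp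
  have 1: "?p i = \<nu> $ i - \<nu> $ Suc i" if i: "Suc i < n" for i
  proof -
    have "\<nu> \<bullet> (unit_vec n i - unit_vec n (Suc i)) = \<nu> $ i - \<nu> $ Suc i"
      using \<nu> i by (simp add: scalar_prod_minus_distrib[OF \<nu> u u])
    moreover have "(unit_vec n i - unit_vec n (Suc i)) \<bullet> (unit_vec n i - unit_vec n (Suc i)) = (2 :: rat)"
      using i by (simp add: scalar_prod_minus_distrib[of _ n])
    ultimately show ?thesis using i by (simp add: simple_root_def)
  qed
  have 2: "?p (n - 1) = (case t of TypeC \<Rightarrow> \<nu> $ (n - 1) | TypeD \<Rightarrow> \<nu> $ (n - 2) + \<nu> $ (n - 1))"
  proof (cases t)
    case TypeC
    have "\<nu> \<bullet> (2 \<cdot>\<^sub>v unit_vec n (n - 1)) = 2 * \<nu> $ (n - 1)"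
      using \<nu> n_pos by simp
    moreover have "(2 \<cdot>\<^sub>v unit_vec n (n - 1)) \<bullet> (2 \<cdot>\<^sub>v unit_vec n (n - 1)) = (4 :: rat)"
      using n_pos by simp
    ultimately show ?thesis using TypeC n_pos by (simp add: simple_root_def)
  next
    case TypeD
    then have n: "n \<ge> 3" using valid by simp
    have "\<nu> \<bullet> (unit_vec n (n - 2) + unit_vec n (n - 1)) = \<nu> $ (n - 2) + \<nu> $ (n - 1)"
      using \<nu> n by (simp add: scalar_prod_add_distrib[OF \<nu> u u])
    moreover have "(unit_vec n (n - 2) + unit_vec n (n - 1)) \<bullet> (unit_vec n (n - 2) + unit_vec n (n - 1)) = (2 :: rat)"
      using n by (simp add: scalar_prod_add_distrib[of _ n])
    ultimately show ?thesis using TypeD n_pos by (simp add: simple_root_def)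
  qed
  have "(\<forall>i<n. ?p i \<in> \<nat>) \<longleftrightarrow> (\<forall>i. Suc i < n \<longrightarrow> ?p i \<in> \<nat>) \<and> ?p (n - 1) \<in> \<nat>"
  proof
    assume *: "(\<forall>i. Suc i < n \<longrightarrow> ?p i \<in> \<nat>) \<and> ?p (n - 1) \<in> \<nat>"
    show "\<forall>i<n. ?p i \<in> \<nat>"
    proof (intro allI impI)
      fix i assume "i < n"
      then consider "Suc i < n" | "i = n - 1" by linarith
      then show "?p i \<in> \<nat>" using * by cases auto
    qed
  next
    assume *: "\<forall>i<n. ?p i \<in> \<nat>"
    show "(\<forall>i. Suc i < n \<longrightarrow> ?p i \<in> \<nat>) \<and> ?p (n - 1) \<in> \<nat>"
      by (intro conjI allI impI *[rule_format]) (use n_pos in auto)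
  qed
  then show ?thesis using \<nu> 1 2 by (simp add: dominant_weights_def split: lie_type.split)
qed

text \<open>The second matrix is the transpose of the first, so the bracket is e e^T - e^T e. For
  \<open>q\<close> different from \<open>opp n p\<close> the matrix e has two entries of square 1 in
  different rows and columns; for \<open>q = opp n p\<close> in type C it has the single entry 2,
  hence the factor 4.\<close>

lemma root_mat_bracket_entry:
  assumes pq: "p < 2 * n" "q < 2 * n" "p \<noteq> q" and ab: "a < 2 * n" "b < 2 * n"
  shows "q \<noteq> opp n p \<Longrightarrow> lie_bracket (root_mat t n p q) (root_mat t n q p) $$ (a, b) = (if a = b
      then of_int (of_bool (a = p) + of_bool (a = opp n q) - of_bool (a = q) - of_bool (a = opp n p)) else 0)"
    and "q = opp n p \<Longrightarrow> t = TypeC \<Longrightarrow>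
      lie_bracket (root_mat t n p q) (root_mat t n q p) $$ (a, b) =
        (if a = b then of_int (4 * (of_bool (a = p) - of_bool (a = q))) else 0)"
proof -
  have prod: "(root_mat t n p q * root_mat t n q p) $$ (a, b)
      = (\<Sum>c<2 * n. root_mat t n p q $$ (a, c) * root_mat t n p q $$ (b, c))" for p q
  proof -
    have "root_mat t n q p $$ (c, b) = root_mat t n p q $$ (b, c)" if "c < 2 * n" for c
      using ab that by (simp add: root_mat_transpose[of t n p q, symmetric])
    then show ?thesis using ab by (simp add: scalar_prod_def atLeast0LessThan)
  qed
  have br: "lie_bracket (root_mat t n p q) (root_mat t n q p) $$ (a, b)
      = (root_mat t n p q * root_mat t n q p) $$ (a, b) - (root_mat t n q p * root_mat t n p q) $$ (a, b)"
    using ab by (simp add: lie_bracket_def)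
  have two: "(\<Sum>c<2 * n. f c) = f q + f (opp n p)"
    if "p < 2 * n" "q < 2 * n" "q \<noteq> opp n p" "\<And>c. c < 2 * n \<Longrightarrow> c \<noteq> q \<Longrightarrow> c \<noteq> opp n p \<Longrightarrow> f c = 0"
    for f :: "nat \<Rightarrow> rat" and p q
  proof -
    have "(\<Sum>c<2 * n. f c) = (\<Sum>c\<in>{q, opp n p}. f c)"
      using that by (intro sum.mono_neutral_right) auto
    then show ?thesis using that(3) by simp
  qed
  have one: "(\<Sum>c<2 * n. f c) = f q" if "q < 2 * n" "\<And>c. c < 2 * n \<Longrightarrow> c \<noteq> q \<Longrightarrow> f c = 0"
    for f :: "nat \<Rightarrow> rat" and q
  proof -
    have "(\<Sum>c<2 * n. f c) = (\<Sum>c\<in>{q}. f c)" using that by (intro sum.mono_neutral_right) auto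
    then show ?thesis by simp
  qed
  have k: "(eps t n p * eps t n q) * (eps t n p * eps t n q) = 1" for p q
    by (auto simp: eps_def split: lie_type.split)
  {
    assume q: "q \<noteq> opp n p"
    have P: "(root_mat t n p q * root_mat t n q p) $$ (a, b)
        = (if a = b then of_bool (a = p) + of_bool (a = opp n q) else 0)"
      if "p < 2 * n" "q < 2 * n" "p \<noteq> q" "q \<noteq> opp n p" for p q
    proof -
      have ne: "p \<noteq> opp n q" "opp n p \<noteq> q" using that by (auto simp: opp_def split: if_splits)
      have "(\<Sum>c<2 * n. root_mat t n p q $$ (a, c) * root_mat t n p q $$ (b, c))
          = root_mat t n p q $$ (a, q) * root_mat t n p q $$ (b, q)
          + root_mat t n p q $$ (a, opp n p) * root_mat t n p q $$ (b, opp n p)"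
        using that ab by (intro two) (auto simp: root_mat_entry)
      moreover have "root_mat t n p q $$ (c, q) = of_bool (c = p)"
        "root_mat t n p q $$ (c, opp n p) = - (of_bool (c = opp n q) * (eps t n p * eps t n q))"
        if "c < 2 * n" for c
        using that \<open>p < 2 * n\<close> \<open>q < 2 * n\<close> ne by (simp_all add: root_mat_entry)
      ultimately have "(root_mat t n p q * root_mat t n q p) $$ (a, b)
          = of_bool (a = p) * of_bool (b = p) + of_bool (a = opp n q) * of_bool (b = opp n q)
            * ((eps t n p * eps t n q) * (eps t n p * eps t n q))"
        unfolding prod using ab by simp
      then show ?thesis unfolding k by auto
    qed
    have q': "p \<noteq> opp n q" using pq q by (auto simp: opp_def split: if_splits)
    show "lie_bracket (root_mat t n p q) (root_mat t n q p) $$ (a, b) = (if a = b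
      then of_int (of_bool (a = p) + of_bool (a = opp n q) - of_bool (a = q) - of_bool (a = opp n p)) else 0)"
      unfolding br P[OF pq q] P[OF pq(2,1) pq(3)[symmetric] q'] by simp
  }
  {
    assume q: "q = opp n p" and t: "t = TypeC"
    have P: "(root_mat t n p q * root_mat t n q p) $$ (a, b) = (if a = b then of_int (4 * of_bool (a = p)) else 0)"
      if "p < 2 * n" "q < 2 * n" "q = opp n p" for p q
    proof -
      have o: "opp n q = p" using that by simp
      have "(\<Sum>c<2 * n. root_mat t n p q $$ (a, c) * root_mat t n p q $$ (b, c))
          = root_mat t n p q $$ (a, q) * root_mat t n p q $$ (b, q)"
        using that ab o by (intro one) (auto simp: root_mat_entry)
      moreover have "eps t n p * eps t n q = - 1"
        using that t by (auto simp: eps_def opp_def)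
      ultimately show ?thesis
        unfolding prod using that ab o
        by (cases "a = p"; cases "b = p") (simp_all add: root_mat_entry)
    qed
    have q': "p = opp n q" using pq q by simp
    show "lie_bracket (root_mat t n p q) (root_mat t n q p) $$ (a, b)
        = (if a = b then of_int (4 * (of_bool (a = p) - of_bool (a = q))) else 0)"
      unfolding br P[OF pq(1,2) q] P[OF pq(2,1) q'] by simp
  }
qed

context classical_tensor
begin

text \<open>With \<open>e\<close> and \<open>f = e\<^sup>T\<close> the two root matrices, \<open>e T = 0\<close> implies
  \<open>0 \<le> \<langle>f T, f T\<rangle> = \<langle>T, [e, f] T\<rangle> = k \<langle>T, T\<rangle>\<close>; this replaces the representation theory of
  \<open>sl\<^sub>2\<close>.\<close>

lemma coroot_nonneg:
  assumes T: "T \<in> V" "T \<noteq> (\<lambda>w. 0)" and pq: "p < 2 * n" "q < 2 * n"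
    and sing: "\<rho> (root_mat t n p q) T = (\<lambda>w. 0)"
    and D: "\<And>a b. a < 2 * n \<Longrightarrow> b < 2 * n \<Longrightarrow>
      lie_bracket (root_mat t n p q) (root_mat t n q p) $$ (a, b) = (if a = b then of_int (d a) else 0)"
    and k: "\<And>w. T w \<noteq> 0 \<Longrightarrow> (\<Sum>p\<leftarrow>w. d p) = k"
  shows "k \<ge> 0"
proof -
  let ?e = "root_mat t n p q" and ?f = "root_mat t n q p" and ?d = "tensor_dot (2 * n) r"
  have L: "?e \<in> lie_alg t n" "?f \<in> lie_alg t n" using root_mat_lie_alg pq by auto
  have fT: "\<rho> ?f T \<in> V" and eT: "\<rho> ?e (\<rho> ?f T) \<in> V" using T by auto
  have "\<rho> ?e (\<rho> ?f T) = (\<lambda>w. \<rho> ?f (\<rho> ?e T) w + \<rho> (lie_bracket ?e ?f) T w)"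
    using T.gen_swap[OF L, of T] T bracket_closed[OF L] L by (simp add: rep_gen)
  also have "\<rho> ?f (\<rho> ?e T) = (\<lambda>w. 0)"
    unfolding sing using tensor_End_mem(4)[OF tensor_action_End tensor_space_closed(1), of "2 * n" r ?f 0]
    by simp
  also have "\<rho> (lie_bracket ?e ?f) T = (\<lambda>w. of_int k * T w)"
  proof
    fix w
    have "(\<Sum>p\<leftarrow>w. rat_of_int (d p)) = of_int (\<Sum>p\<leftarrow>w. d p)" by (induction w) simp_all
    then show "\<rho> (lie_bracket ?e ?f) T w = of_int k * T w"
      using T k[of w] deriv_action_diag[of w "2 * n" r "lie_bracket ?e ?f" "\<lambda>a. of_int (d a)" T] D
      by (cases "T w = 0") (auto simp: tensor_action_eq tensor_space_carrier)
  qed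
  finally have ef: "\<rho> ?e (\<rho> ?f T) = (\<lambda>w. of_int k * T w)" by simp
  have "0 \<le> ?d (\<rho> ?f T) (\<rho> ?f T)" by (rule tensor_dot_self_nonneg)
  also have "\<dots> = ?d T (\<rho> (transpose_mat ?f) (\<rho> ?f T))"
    by (rule tensor_dot_adjoint) (use T fT in auto)
  also have "\<dots> = of_int k * ?d T T"
    unfolding root_mat_transpose ef by (simp add: tensor_dot_linear)
  finally have "0 \<le> of_int k * ?d T T" .
  moreover have "?d T T > 0"
    using tensor_dot_self_nonneg[of "2 * n" r T] tensor_dot_self_eq_0[OF T(1)] T(2) by fastforce
  ultimately show ?thesis by (simp add: zero_le_mult_iff)
qed

lemma maximal_tensor_dominant:
  assumes T: "T \<in> V" "T \<noteq> (\<lambda>w. 0)" "weight_tensor c T"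
    and sing: "\<And>p q. p < 2 * n \<Longrightarrow> q < 2 * n \<Longrightarrow> height n q < height n p \<Longrightarrow>
      \<rho> (root_mat t n p q) T = (\<lambda>w. 0)"
  shows "vec n (\<lambda>i. of_int (c i)) \<in> dominant_weights t n"
proof -
  have ww: "(\<Sum>p\<leftarrow>w. letter_weight n i p) = c i" if "T w \<noteq> 0" "i < n" for w i
    using T(3) that by (auto simp: weight_tensor_def word_weight_def)
  have nat: "rat_of_int z \<in> \<nat>" if "z \<ge> 0" for z
    using that by (metis Nats_1 of_nat_in_Nats of_int_of_nat_eq zero_le_imp_eq_int)
  have 1: "c (Suc i) \<le> c i" if i: "Suc i < n" for i
  proof -
    have "0 \<le> c i - c (Suc i)"
    proof (rule coroot_nonneg[OF T(1,2) _ _ sing])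
      show "i < 2 * n" "Suc i < 2 * n" "i < 2 * n" "Suc i < 2 * n" using i by auto
      show "height n (Suc i) < height n i" using i by (simp add: height_eq)
      show "(\<Sum>p\<leftarrow>w. letter_weight n i p - letter_weight n (Suc i) p) = c i - c (Suc i)" if "T w \<noteq> 0" for w
        using ww[OF that] i by (simp add: sum_list_subtractf)
      fix a b assume ab: "a < 2 * n" "b < 2 * n"
      show "lie_bracket (root_mat t n i (Suc i)) (root_mat t n (Suc i) i) $$ (a, b)
          = (if a = b then of_int (letter_weight n i a - letter_weight n (Suc i) a) else 0)"
        using i ab by (subst root_mat_bracket_entry(1)) (auto simp: letter_weight_def opp_def)
    qed
    then show ?thesis by simp
  qed
  have 2: "case t of TypeC \<Rightarrow> 0 \<le> c (n - 1) | TypeD \<Rightarrow> 0 \<le> c (n - 2) + c (n - 1)"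
  proof (cases t)
    case TypeC
    \<comment> \<open>Opposite letters give the long simple root. The bracket is four times its
      coroot, which does not affect the sign.\<close>
    let ?p = "n - 1" and ?q = "2 * n - 1"
    have o: "?q = opp n ?p" using n_pos by (auto simp: opp_def)
    have "0 \<le> 4 * c (n - 1)"
    proof (rule coroot_nonneg[OF T(1,2) _ _ sing])
      show "?p < 2 * n" "?q < 2 * n" "?p < 2 * n" "?q < 2 * n" using n_pos by auto
      show "height n ?q < height n ?p" using n_pos by (simp add: height_eq)
      show "(\<Sum>p\<leftarrow>w. 4 * letter_weight n ?p p) = 4 * c ?p" if "T w \<noteq> 0" for w
        using ww[OF that, of ?p] n_pos by (simp add: sum_list_const_mult)
      fix a b assume ab: "a < 2 * n" "b < 2 * n"
      show "lie_bracket (root_mat t n ?p ?q) (root_mat t n ?q ?p) $$ (a, b)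
          = (if a = b then of_int (4 * letter_weight n ?p a) else 0)"
        using n_pos ab TypeC by (subst root_mat_bracket_entry(2)[OF _ _ _ _ _ o]) (auto simp: letter_weight_def)
    qed
    then show ?thesis using TypeC by simp
  next
    case TypeD
    then have n: "n \<ge> 3" using valid by simp
    \<comment> \<open>The letter \<open>?q\<close> is opposite to n - 1, so the weights of
      \<open>?p\<close> and \<open>?q\<close> differ by the last simple root.\<close>
    let ?p = "n - 2" and ?q = "2 * n - 1"
    have "0 \<le> c (n - 2) + c (n - 1)"
    proof (rule coroot_nonneg[OF T(1,2) _ _ sing])
      show "?p < 2 * n" "?q < 2 * n" "?p < 2 * n" "?q < 2 * n" using n by auto
      show "height n ?q < height n ?p" using n by (simp add: height_eq)
      show "(\<Sum>p\<leftarrow>w. letter_weight n (n - 2) p + letter_weight n (n - 1) p) = c (n - 2) + c (n - 1)"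
        if "T w \<noteq> 0" for w
        using ww[OF that] n by (simp add: sum_list_addf)
      fix a b assume ab: "a < 2 * n" "b < 2 * n"
      show "lie_bracket (root_mat t n ?p ?q) (root_mat t n ?q ?p) $$ (a, b)
          = (if a = b then of_int (letter_weight n (n - 2) a + letter_weight n (n - 1) a) else 0)"
      proof -
        have o: "opp n ?q = n - 1" "opp n ?p = 2 * n - 2" using n by (auto simp: opp_def)
        have "letter_weight n (n - 2) a = of_bool (a = n - 2) - of_bool (a = 2 * n - 2)"
          "letter_weight n (n - 1) a = of_bool (a = n - 1) - of_bool (a = 2 * n - 1)"
        proof -
          have e: "n + (n - 2) = 2 * n - 2" "n + (n - 1) = 2 * n - 1" "n - 2 \<noteq> 2 * n - 2" "n - 1 \<noteq> 2 * n - 1"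
            using n by simp_all
          show "letter_weight n (n - 2) a = of_bool (a = n - 2) - of_bool (a = 2 * n - 2)"
            unfolding letter_weight_def e(1) using e(3) by simp
          show "letter_weight n (n - 1) a = of_bool (a = n - 1) - of_bool (a = 2 * n - 1)"
            unfolding letter_weight_def e(2) using e(4) by simp
        qed
        then have eq: "letter_weight n (n - 2) a + letter_weight n (n - 1) a
            = of_bool (a = ?p) + of_bool (a = opp n ?q) - of_bool (a = ?q) - of_bool (a = opp n ?p)"
          unfolding o by simp
        show ?thesis
          unfolding eq by (rule root_mat_bracket_entry(1)[OF _ _ _ ab]) (use n o in auto)
      qed
    qed
    then show ?thesis using TypeD by simp
  qed
  show ?thesis
    using 1 2 n_pos valid
    by (subst dominant_weights_iff)
      (auto simp: of_int_diff[symmetric] of_int_add[symmetric] intro!: nat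
        simp del: of_int_diff of_int_add split: lie_type.splits)
qed

lemma tensor_dominant_weightI:
  assumes T: "T \<in> V" "T \<noteq> (\<lambda>w. 0)" "weight_tensor c T"
    and "vec n (\<lambda>i. of_int (c i)) \<in> dominant_weights t n"
  shows "vec n (\<lambda>i. of_int (c i)) \<in> tensor_dominant_weights t n r"
  unfolding tensor_dominant_weights_def
  using assms weight_tensor_action[OF T(1,3)] by (auto intro!: bexI[of _ T])

lemma minimal_submodule_highest_weight:
  assumes W: "submodule W U tensor_module" "W \<noteq> {\<lambda>w. 0}"
  obtains T \<nu> where "T \<in> W" "T \<noteq> (\<lambda>w. 0)" "\<nu> \<in> tensor_dominant_weights t n r"
    "maximal_vector t n tensor_module \<nu> T"
proof -
  obtain T c where T: "T \<in> W" "T \<noteq> (\<lambda>w. 0)" "weight_tensor c T"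
    and max: "\<And>\<alpha> x. x \<in> root_space t n \<alpha> \<Longrightarrow> (\<Sum>i<n. of_nat (n - i) * \<alpha> $ i) > 0 \<Longrightarrow> \<rho> x T = (\<lambda>w. 0)"
    using maximal_tensor_exists[OF W] by blast
  have TV: "T \<in> V" using T(1) submodule_subspace[OF W(1)] by auto
  let ?\<nu> = "vec n (\<lambda>i. rat_of_int (c i))"
  have sing: "\<rho> (root_mat t n p q) T = (\<lambda>w. 0)"
    if pq: "p < 2 * n" "q < 2 * n" "height n q < height n p" for p q
  proof (rule max[OF root_mat_root_space[OF pq(1,2)]])
    have "(\<Sum>i<n. of_nat (n - i) * vec n (\<lambda>i. rat_of_int (letter_weight n i p - letter_weight n i q)) $ i)
        = rat_of_int (height n p - height n q)"
      by (simp add: height_def sum_subtractf[symmetric] right_diff_distrib)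
    then show "0 < (\<Sum>i<n. of_nat (n - i) * vec n (\<lambda>i. rat_of_int (letter_weight n i p - letter_weight n i q)) $ i)"
      using pq(3) by simp
  qed
  have "maximal_vector t n tensor_module ?\<nu> T"
    unfolding maximal_vector_def
  proof (intro conjI allI impI ballI)
    show "gen (cartan n i) \<odot>\<^bsub>tensor_module\<^esub> T = scal (?\<nu> $ i) \<odot>\<^bsub>tensor_module\<^esub> T" if "i < n" for i
      using that TV cartan_lie_alg[OF that] weight_tensor_action[OF TV T(3) that]
      by (simp add: rep_gen rep_scal)
    fix \<alpha> x assume a: "\<alpha> \<in> carrier_vec n" "\<alpha> \<noteq> 0\<^sub>v n \<and> dom_le t n (0\<^sub>v n) \<alpha>" and x: "x \<in> root_space t n \<alpha>"
    have "root_cone t n (\<lambda>j. \<alpha> $ j)"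
    proof -
      have "root_cone t n (\<lambda>j. \<alpha> $ j - 0\<^sub>v n $ j)"
        using a dom_le_iff_root_cone[OF a(1), of "0\<^sub>v n" t] by simp
      then show ?thesis by (rule iffD1[OF root_cone_cong, rotated]) simp
    qed
    moreover have "\<exists>j<n. \<alpha> $ j \<noteq> 0" using a by (auto simp: vec_eq_iff)
    ultimately have "(\<Sum>i<n. of_nat (n - i) * \<alpha> $ i) > 0" by (rule root_cone_height_pos)
    then have "\<rho> x T = (\<lambda>w. 0)" by (rule max[OF x])
    moreover have "x \<in> lie_alg t n" using x by (simp add: root_space_def)
    ultimately show "gen x \<odot>\<^bsub>tensor_module\<^esub> T = \<zero>\<^bsub>tensor_module\<^esub>" by (simp add: rep_gen)
  qed (use TV T in auto)
  moreover have "?\<nu> \<in> tensor_dominant_weights t n r"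
    using maximal_tensor_dominant[OF TV T(2,3) sing] by (rule tensor_dominant_weightI[OF TV T(2,3)])
  ultimately show ?thesis using that T by blast
qed

text \<open>A tensor is determined by the finite list of its coordinates, and lists of rationals are
  countable.\<close>

lemma tensor_space_embedding:
  assumes "infinite (UNIV :: 'v set)"
  obtains g :: "(nat list \<Rightarrow> rat) \<Rightarrow> 'v" where "inj_on g V"
proof -
  obtain h :: "nat \<Rightarrow> 'v" where h: "inj h" using infinite_countable_subset[OF assms] by blast
  obtain ws where ws: "set ws = tensor_words (2 * n) r" using finite_list[OF finite_tensor_words] by blast
  have "inj_on (\<lambda>T. map T ws) V"
  proof (rule inj_onI, rule ext)
    fix S T w assume "S \<in> V" "T \<in> V" "map S ws = map T ws"
    then show "S w = T w" using ws by (cases "w \<in> set ws") (auto simp: tensor_space_carrier)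
  qed
  note ws_inj = this
  have "inj_on (\<lambda>T. h (to_nat (map T ws))) V"
  proof (rule inj_onI)
    fix S T assume ST: "S \<in> V" "T \<in> V" and eq: "h (to_nat (map S ws)) = h (to_nat (map T ws))"
    have "map S ws = map T ws" using injD[OF h eq] by (simp only: inj_eq[OF inj_to_nat])
    then show "S = T" using ST by (rule inj_onD[OF ws_inj])
  qed
  then show ?thesis by (rule that)
qed

text \<open>Copied into the type \<open>'v\<close>, the minimal submodule becomes one of the modules
  over which the ideal quantifies. Simplicity makes its maximal vector a generator.\<close>

lemma gen_schur_ideal_kills_minimal:
  assumes inf: "infinite (UNIV :: 'v set)"
    and u: "u \<in> gen_schur_ideal TYPE('v) t n (tensor_dominant_weights t n r)"
    and W: "submodule W U tensor_module" "W \<noteq> {\<lambda>w. 0}"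
    and minimal: "\<And>N. submodule N U tensor_module \<Longrightarrow> N \<subseteq> W \<Longrightarrow> N = {\<lambda>w. 0} \<or> N = W"
    and T: "T \<in> W"
  shows "rep u T = (\<lambda>w. 0)"
proof -
  obtain g :: "(nat list \<Rightarrow> rat) \<Rightarrow> 'v" where "inj_on g V" using tensor_space_embedding[OF inf] .
  then have g: "inj_on g W" using submodule_subspace(2)[OF W(1)] by (rule inj_on_subset)
  let ?M = "transport g W tensor_module"
  note W' = T.M.submoduleD[OF W(1)] and tr = transport_simps[OF g]
  have simple: "simple_module U ?M"
    using W minimal by (intro simple_module_transport[OF left_module_tensor W(1) g]) simp_all
  then have lm: "left_module U ?M" by (simp add: simple_module_def)
  interpret M: left_module U ?M by (rule lm)
  obtain S \<nu> where S: "S \<in> W" "S \<noteq> (\<lambda>w. 0)" "\<nu> \<in> tensor_dominant_weights t n r"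
    "maximal_vector t n tensor_module \<nu> S"
    using minimal_submodule_highest_weight[OF W] .
  have "(\<lambda>w. 0) \<in> W" using W'(2) by simp
  then have S0: "g S \<noteq> g (\<lambda>w. 0)" using g S by (auto simp: inj_on_def)
  have "maximal_vector t n ?M \<nu> (g S)"
    using S(4) S(1) S0 unfolding maximal_vector_def by (simp add: tr)
  moreover have "N = carrier ?M" if "submodule N U ?M" "g S \<in> N" for N
  proof -
    have "N \<noteq> {\<zero>\<^bsub>?M\<^esub>}" using that(2) S0 by auto
    then show ?thesis using simple that(1) unfolding simple_module_def by blast
  qed
  ultimately have "highest_weight_module t n ?M \<nu>"
    unfolding highest_weight_module_def using lm by blast
  then have "annihilates u ?M"
    using u simple S(3) unfolding gen_schur_ideal_def by blast
  then have "g (rep u T) = g (\<lambda>w. 0)"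
    using T by (simp add: annihilates_def tr)
  moreover have "rep u T \<in> W"
    using W'(4)[of u T] T u by (simp add: gen_schur_ideal_def)
  ultimately show ?thesis using g \<open>(\<lambda>w. 0) \<in> W\<close> by (auto simp: inj_on_def)
qed

text \<open>Stability under right multiplication makes the set of tensors killed by the ideal a
  submodule.\<close>

lemma gen_schur_ideal_mult:
  assumes u: "u \<in> gen_schur_ideal TYPE('v) t n \<pi>" and a: "a \<in> carrier U"
  shows "u \<otimes>\<^bsub>U\<^esub> a \<in> gen_schur_ideal TYPE('v) t n \<pi>"
  unfolding gen_schur_ideal_def
proof (intro CollectI conjI allI impI)
  have uU: "u \<in> carrier U" using u by (simp add: gen_schur_ideal_def)
  show "u \<otimes>\<^bsub>U\<^esub> a \<in> carrier U" using uU a by simp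
  fix M :: "((rat mat list \<Rightarrow> rat) set, 'v) module" and \<nu>
  assume M: "\<nu> \<in> \<pi> \<and> simple_module U M \<and> highest_weight_module t n M \<nu>"
  then interpret M: left_module U M by (simp add: simple_module_def)
  have "annihilates u M" using M u unfolding gen_schur_ideal_def by blast
  then show "annihilates (u \<otimes>\<^bsub>U\<^esub> a) M"
    using uU a by (simp add: annihilates_def M.smult_assoc1)
qed

lemma orthogonal_submodule:
  assumes W: "submodule W U tensor_module"
  shows "submodule {S \<in> V. \<forall>T\<in>W. tensor_dot (2 * n) r S T = 0} U tensor_module" (is "submodule ?P _ _")
proof (rule T.M.submoduleI)
  show "a \<odot>\<^bsub>tensor_module\<^esub> S \<in> ?P" if "a \<in> carrier U" "S \<in> ?P" for a S
    using that(1)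
  proof (induction a rule: uea_induct)
    case (scal c)
    then show ?case using that(2) by (simp add: rep_scal tensor_dot_linear)
  next
    case (gen x u)
    have uS: "rep u S \<in> ?P" using gen by simp
    have SV: "S \<in> V" using that(2) by simp
    have eq: "rep (gen x \<otimes>\<^bsub>U\<^esub> u) S = \<rho> x (rep u S)"
      using T.M.smult_assoc1[of "gen x" u S] gen.hyps SV by (simp add: rep_gen)
    have xc: "x \<in> carrier_mat (2 * n) (2 * n)" using gen.hyps(1) lie_alg_carrier by auto
    have "tensor_dot (2 * n) r (\<rho> x (rep u S)) T = 0" if T: "T \<in> W" for T
    proof -
      have "\<rho> (transpose_mat x) T \<in> W"
        by (rule submodule_action[OF W lie_alg_transpose[OF gen.hyps(1)] T])
      moreover have "T \<in> V" using T submodule_subspace(2)[OF W] by auto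
      ultimately show ?thesis using uS by (subst tensor_dot_adjoint[OF xc]) auto
    qed
    then show ?case using uS by (simp add: eq)
  next
    case (add u v)
    then show ?case
      using T.M.smult_l_distr[of u v S] that(2) by (simp add: tensor_dot_linear)
  qed
qed (auto simp: tensor_dot_linear)

text \<open>Instead of decomposing the tensor space, consider the submodule \<open>K\<close> of all
  tensors killed by the ideal. A minimal submodule of its orthogonal complement would lie in
  \<open>K\<close> as well, hence be orthogonal to itself; so the complement is zero and
  \<open>K\<close> is everything.\<close>

lemma gen_schur_ideal_le_kernel:
  assumes inf: "infinite (UNIV :: 'v set)"
    and u: "u \<in> gen_schur_ideal TYPE('v) t n (tensor_dominant_weights t n r)" and T: "T \<in> V"
  shows "rep u T = (\<lambda>w. 0)"
proof -
  let ?I = "gen_schur_ideal TYPE('v) t n (tensor_dominant_weights t n r)"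
  have IU: "v \<in> carrier U" if "v \<in> ?I" for v using that by (simp add: gen_schur_ideal_def)
  define K where "K = {T \<in> V. \<forall>u\<in>?I. rep u T = (\<lambda>w. 0)}"
  have K: "submodule K U tensor_module"
  proof (rule T.M.submoduleI)
    show "\<zero>\<^bsub>tensor_module\<^esub> \<in> K" using T.M.smult_r_null IU by (simp add: K_def)
    show "S \<oplus>\<^bsub>tensor_module\<^esub> S' \<in> K" if "S \<in> K" "S' \<in> K" for S S'
      using that T.M.smult_r_distr[of _ S S'] IU by (simp add: K_def)
    fix a S assume a: "a \<in> carrier U" and S: "S \<in> K"
    have "rep v (rep a S) = (\<lambda>w. 0)" if v: "v \<in> ?I" for v
    proof -
      have "v \<otimes>\<^bsub>U\<^esub> a \<in> ?I" by (rule gen_schur_ideal_mult[OF v a])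
      then have "rep (v \<otimes>\<^bsub>U\<^esub> a) S = (\<lambda>w. 0)" using S by (simp add: K_def)
      then show ?thesis using T.M.smult_assoc1[OF IU[OF v] a, of S] S by (simp add: K_def)
    qed
    moreover have "rep a S \<in> V" using T.M.smult_closed[OF a, of S] S by (simp add: K_def)
    ultimately show "a \<odot>\<^bsub>tensor_module\<^esub> S \<in> K" by (simp add: K_def)
  qed (auto simp: K_def)
  let ?P = "{S \<in> V. \<forall>T\<in>K. tensor_dot (2 * n) r S T = 0}"
  have P: "?P = {\<lambda>w. 0}"
  proof (rule ccontr)
    assume "?P \<noteq> {\<lambda>w. 0}"
    then obtain W where W: "submodule W U tensor_module" "W \<subseteq> ?P" "W \<noteq> {\<lambda>w. 0}"
      "\<And>N'. submodule N' U tensor_module \<Longrightarrow> N' \<subseteq> W \<Longrightarrow> N' = {\<lambda>w. 0} \<or> N' = W"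
      using minimal_submodule_exists[OF orthogonal_submodule[OF K]] by blast
    obtain S where S: "S \<in> W" "S \<noteq> (\<lambda>w. 0)"
      using T.M.submoduleD(2)[OF W(1)] W(3) by (auto simp: set_eq_iff)
    have SV: "S \<in> V" using S(1) W(2) by auto
    have "S \<in> K"
      using gen_schur_ideal_kills_minimal[OF inf _ W(1,3,4) S(1)] SV by (simp add: K_def)
    then have "tensor_dot (2 * n) r S S = 0" using S(1) W(2) by auto
    then show False using tensor_dot_self_eq_0[OF SV] S(2) by simp
  qed
  obtain S where S: "S \<in> K" "\<forall>b\<in>K. tensor_dot (2 * n) r (\<lambda>w. T w - S w) b = 0"
    using orthogonal_projection[OF submodule_subspace[OF K] T] by (elim bexE)
  have "(\<lambda>w. T w - S w) \<in> ?P"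
    using S T by (auto simp: tensor_space_carrier K_def)
  then have "(\<lambda>w. T w - S w) = (\<lambda>w. 0)" unfolding P by simp
  then have "T = S" by (simp add: fun_eq_iff)
  then show ?thesis using S(1) u by (simp add: K_def)
qed

end

section \<open>Maximal vectors in tensor powers\<close>

text \<open>The coordinates of the exterior product of the letters of \<open>B\<close>. For distinct
  letters the value is the sign of the rearrangement of \<open>B\<close> into \<open>w\<close>, or
  0. As a determinant it inherits the sign rule for row swaps.\<close>

definition wedge :: "nat list \<Rightarrow> nat list \<Rightarrow> rat" where
  "wedge B w = (if length w = length B
     then det (mat (length B) (length B) (\<lambda>(i, j). if w ! i = B ! j then 1 else 0)) else 0)"

text \<open>A letter of \<open>B\<close> missing from \<open>w\<close> gives a zero column; counting
  does the rest.\<close>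

lemma wedge_support:
  assumes B: "distinct B" and w: "wedge B w \<noteq> 0"
  shows "length w = length B" "set w = set B" "distinct w"
proof -
  let ?K = "length B"
  let ?A = "mat ?K ?K (\<lambda>(i, j). if w ! i = B ! j then 1 else 0) :: rat mat"
  show len: "length w = ?K" using w by (auto simp: wedge_def split: if_splits)
  have "b \<in> set w" if bB: "b \<in> set B" for b
  proof (rule ccontr)
    assume b: "b \<notin> set w"
    obtain j where j: "j < ?K" "B ! j = b" using bB unfolding in_set_conv_nth by blast
    have A: "?A \<in> carrier_mat ?K ?K" by simp
    have "(\<Prod>i = 0..<?K. ?A $$ (i, p i)) = 0" if p: "p permutes {0..<?K}" for p
    proof -
      obtain i where i: "i \<in> {0..<?K}" "p i = j"
        using permutes_image[OF p] j(1) by (metis atLeastLessThan_iff image_iff zero_le)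
      then have "?A $$ (i, p i) = 0" using b j len by (auto simp: in_set_conv_nth)
      then show ?thesis using i by (intro prod_zero) auto
    qed
    then have "det ?A = 0" unfolding det_def'[OF A] by (intro sum.neutral) auto
    then show False using w len by (simp add: wedge_def)
  qed
  then have sub: "set B \<subseteq> set w" by auto
  have card: "card (set B) = ?K" using B by (rule distinct_card)
  have "card (set w) \<le> ?K" using card_length[of w] len by simp
  then show "set w = set B" using card_seteq[OF finite_set sub] card by simp
  then show "distinct w" using card len by (intro card_distinct) simp
qed

lemma wedge_self: "distinct B \<Longrightarrow> wedge B B = 1"
proof -
  assume "distinct B"
  then have "mat (length B) (length B) (\<lambda>(i, j). if B ! i = B ! j then 1 else 0) = (1\<^sub>m (length B) :: rat mat)"
    by (intro eq_matI) (auto simp: nth_eq_iff_index_eq)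
  then show ?thesis by (simp add: wedge_def)
qed

lemma wedge_swap:
  assumes "k < length w" "l < length w" "k \<noteq> l"
  shows "wedge B (w[k := w ! l, l := w ! k]) = - wedge B w"
proof (cases "length w = length B")
  case True
  let ?K = "length B"
  let ?A = "\<lambda>w. mat ?K ?K (\<lambda>(i, j). if w ! i = B ! j then 1 else 0) :: rat mat"
  have "?A (w[k := w ! l, l := w ! k]) = swaprows k l (?A w)"
    using assms True by (intro eq_matI) (auto simp: nth_list_update)
  moreover have "det (swaprows k l (?A w)) = - det (?A w)"
    by (rule det_swaprows) (use assms True in auto)
  ultimately have "det (?A (w[k := w ! l, l := w ! k])) = - det (?A w)" by simp
  then show ?thesis using True by (simp add: wedge_def)
qed (simp add: wedge_def)

text \<open>If a matrix maps the span of \<open>B\<close> to itself with zero diagonal, each summand of its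
  action on the exterior product repeats a letter; the two places of that letter yield opposite
  contributions.\<close>

lemma wedge_action:
  assumes B: "distinct B" "set B \<subseteq> {..<N}" and w: "w \<in> tensor_words N (length B)"
    and x: "\<And>a b. a < N \<Longrightarrow> b \<in> set B \<Longrightarrow> x $$ (a, b) \<noteq> 0 \<Longrightarrow> a \<in> set B \<and> a \<noteq> b"
  shows "deriv_action N x (wedge B) w = 0"
proof -
  let ?K = "length B"
  have len: "length w = ?K" using w by (rule tensor_words_length)
  have "(\<Sum>k<?K. x $$ (w ! k, j) * wedge B (w[k := j])) = 0" for j
  proof (cases "\<exists>k<?K. x $$ (w ! k, j) * wedge B (w[k := j]) \<noteq> 0")
    case True
    then obtain k where k: "k < ?K" "x $$ (w ! k, j) \<noteq> 0" "wedge B (w[k := j]) \<noteq> 0" by auto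
    note supp = wedge_support[OF B(1) k(3)]
    have "j \<in> set (w[k := j])" using k(1) len by (intro set_update_memI) simp
    then have j: "j \<in> set B" using supp by simp
    have a: "w ! k \<in> set B" "w ! k \<noteq> j"
      using x[OF tensor_words_nth[OF w k(1)] j k(2)] by auto
    then obtain l where l: "l < ?K" "w[k := j] ! l = w ! k"
      using supp(2) len by (metis in_set_conv_nth length_list_update)
    have lk: "l \<noteq> k" using l a(2) k(1) len by auto
    have wl: "w ! l = w ! k" using l lk by simp
    have zero: "wedge B (w[m := j]) = 0" if "m < ?K" "m \<noteq> k" "m \<noteq> l" for m
    proof (rule ccontr)
      assume "wedge B (w[m := j]) \<noteq> 0"
      then have "distinct (w[m := j])" by (rule wedge_support(3)[OF B(1)])
      moreover have "w[m := j] ! k = w[m := j] ! l" using that wl by simp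
      ultimately show False using k(1) l(1) lk len by (simp add: nth_eq_iff_index_eq)
    qed
    have "w[k := j, k := w[k := j] ! l, l := w[k := j] ! k] = w[l := j]"
      using k(1) l(1) lk len wl by (intro nth_equalityI) (auto simp: nth_list_update)
    then have opp: "wedge B (w[l := j]) = - wedge B (w[k := j])"
      using wedge_swap[of k "w[k := j]" l B] k(1) l(1) lk len by simp
    have "(\<Sum>m<?K. x $$ (w ! m, j) * wedge B (w[m := j])) = (\<Sum>m\<in>{k, l}. x $$ (w ! m, j) * wedge B (w[m := j]))"
      using k(1) l(1) zero by (intro sum.mono_neutral_right) auto
    then show ?thesis using lk wl opp by simp
  qed (auto intro!: sum.neutral)
  then have "(\<Sum>j<N. \<Sum>k<?K. x $$ (w ! k, j) * wedge B (w[k := j])) = 0" by simp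
  then show ?thesis unfolding deriv_action_eq len by (subst sum.swap)
qed

text \<open>The Leibniz rule for a product of tensors. The cut is fixed at \<open>length u\<close>,
  and the action preserves lengths.\<close>

lemma deriv_action_concat:
  "deriv_action N x (\<lambda>w. S (take (length u) w) * T (drop (length u) w)) (u @ v)
    = deriv_action N x S u * T v + S u * deriv_action N x T v"
proof (induction u arbitrary: S)
  case Nil
  show ?case by (simp add: deriv_action_scale)
next
  case (Cons a u)
  show ?case
    using Cons.IH[of "\<lambda>w. S (a # w)"] by (simp add: distrib_right sum_distrib_right mult.assoc)
qed

lemma tensor_words_append:
  "u \<in> tensor_words N r \<Longrightarrow> v \<in> tensor_words N s \<Longrightarrow> u @ v \<in> tensor_words N (r + s)"
  by (auto simp: tensor_words_def)

section \<open>Maximal tensors and their products\<close>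

context classical
begin

text \<open>A nonzero singular vector of integral weight, stated through \<open>deriv_action\<close>
  and with the degree as an argument, so that tensors of different degrees can be
  multiplied.\<close>

definition maximal_tensor :: "nat \<Rightarrow> (nat \<Rightarrow> int) \<Rightarrow> (nat list \<Rightarrow> rat) \<Rightarrow> bool" where
  "maximal_tensor r c T \<longleftrightarrow> T \<in> carrier (tensor_space (2 * n) r) \<and> T \<noteq> (\<lambda>w. 0) \<and>
     (\<forall>w. T w \<noteq> 0 \<longrightarrow> (\<forall>i<n. word_weight n i w = c i)) \<and>
     (\<forall>p<2 * n. \<forall>q<2 * n. height n q < height n p \<longrightarrow>
       (\<forall>w\<in>tensor_words (2 * n) r. deriv_action (2 * n) (root_mat t n p q) T w = 0))"

text \<open>The tensor product of maximal vectors: weights add, and by the Leibniz rule raising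
  elements kill both terms.\<close>

lemma maximal_tensor_concat:
  assumes S: "maximal_tensor r c S" and T: "maximal_tensor s d T"
  shows "\<exists>X. maximal_tensor (r + s) (\<lambda>i. c i + d i) X"
proof -
  define X where "X w = (if length w = r + s then S (take r w) * T (drop r w) else 0)" for w
  have Sw: "S w = 0" if "w \<notin> tensor_words (2 * n) r" for w
    using S that by (simp add: maximal_tensor_def tensor_space_carrier)
  have Tw: "T w = 0" if "w \<notin> tensor_words (2 * n) s" for w
    using T that by (simp add: maximal_tensor_def tensor_space_carrier)
  have split: "\<exists>u v. w = u @ v \<and> u \<in> tensor_words (2 * n) r \<and> v \<in> tensor_words (2 * n) s"
    if "w \<in> tensor_words (2 * n) (r + s)" for w
    using that by (intro exI[of _ "take r w"] exI[of _ "drop r w"])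
      (auto simp: tensor_words_def dest: in_set_takeD in_set_dropD)
  have X_app: "X (u @ v) = S u * T v" if "u \<in> tensor_words (2 * n) r" "v \<in> tensor_words (2 * n) s" for u v
    using that by (simp add: X_def tensor_words_length)
  have XV: "X \<in> carrier (tensor_space (2 * n) (r + s))"
    unfolding tensor_space_carrier
  proof (intro allI impI)
    fix w assume w: "w \<notin> tensor_words (2 * n) (r + s)"
    show "X w = 0"
    proof (rule ccontr)
      assume "X w \<noteq> 0"
      then have "take r w \<in> tensor_words (2 * n) r" "drop r w \<in> tensor_words (2 * n) s"
        using Sw Tw by (auto simp: X_def split: if_splits)
      then have "take r w @ drop r w \<in> tensor_words (2 * n) (r + s)" by (rule tensor_words_append)
      then show False using w by simp
    qed
  qed
  obtain u v where uv: "S u \<noteq> 0" "T v \<noteq> 0" using S T by (auto simp: maximal_tensor_def fun_eq_iff)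
  then have "X (u @ v) \<noteq> 0" using Sw Tw by (subst X_app) auto
  moreover have "word_weight n i w = c i + d i" if w: "X w \<noteq> 0" "i < n" for w i
  proof -
    have "w \<in> tensor_words (2 * n) (r + s)" using w(1) XV by (auto simp: tensor_space_carrier)
    then obtain u v where uv: "w = u @ v" "u \<in> tensor_words (2 * n) r" "v \<in> tensor_words (2 * n) s"
      using split by blast
    then have "S u \<noteq> 0" "T v \<noteq> 0" using w(1) X_app by auto
    then have "word_weight n i u = c i" "word_weight n i v = d i"
      using S T w(2) by (auto simp: maximal_tensor_def)
    then show ?thesis using uv(1) by (simp add: word_weight_def)
  qed
  moreover have "deriv_action (2 * n) (root_mat t n p q) X w = 0"
    if pq: "p < 2 * n" "q < 2 * n" "height n q < height n p" and w: "w \<in> tensor_words (2 * n) (r + s)" for p q w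
  proof -
    obtain u v where uv: "w = u @ v" "u \<in> tensor_words (2 * n) r" "v \<in> tensor_words (2 * n) s"
      using split[OF w] by blast
    have "deriv_action (2 * n) (root_mat t n p q) X w
        = deriv_action (2 * n) (root_mat t n p q) (\<lambda>w. S (take (length u) w) * T (drop (length u) w)) w"
      using uv(2) by (intro deriv_action_cong[OF w]) (auto simp: X_def tensor_words_length)
    also have "\<dots> = 0"
      unfolding uv(1) deriv_action_concat using S T pq uv(2,3) by (simp add: maximal_tensor_def)
    finally show ?thesis .
  qed
  ultimately have "maximal_tensor (r + s) (\<lambda>i. c i + d i) X"
    unfolding maximal_tensor_def using XV by blast
  then show ?thesis by blast
qed

lemma maximal_tensor_empty: "maximal_tensor 0 (\<lambda>i. 0) (\<lambda>w. if w = [] then 1 else 0)"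
  by (auto simp: maximal_tensor_def tensor_space_carrier word_weight_def tensor_words_def fun_eq_iff)

text \<open>The coordinates are the entries of the form matrix. By the entry relation of
  \<open>lie_alg_iff\<close> all of the Lie algebra kills this tensor. It raises the degree by 2
  without changing the weight.\<close>

lemma maximal_tensor_form: "\<exists>T. maximal_tensor 2 (\<lambda>i. 0) T"
proof -
  define T where "T w = (if w \<in> tensor_words (2 * n) 2 \<and> w ! 1 = opp n (w ! 0) then eps t n (w ! 0) else 0)" for w
  have two: "\<exists>a b. w = [a, b] \<and> a < 2 * n \<and> b < 2 * n" if "w \<in> tensor_words (2 * n) 2" for w
  proof -
    have l: "length w = 2" and s: "set w \<subseteq> {..<2 * n}" using that by (auto simp: tensor_words_def)
    obtain a b where "w = [a, b]" using l by (auto simp: numeral_2_eq_2 length_Suc_conv)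
    then show ?thesis using s by auto
  qed
  have T2: "T [a, b] = (if b = opp n a then eps t n a else 0)" if "a < 2 * n" "b < 2 * n" for a b
    using that by (simp add: T_def tensor_words_def)
  have TV: "T \<in> carrier (tensor_space (2 * n) 2)" by (auto simp: tensor_space_carrier T_def)
  have "T [0, opp n 0] \<noteq> 0" using n_pos T2[of 0 "opp n 0"] by (simp add: eps_def)
  moreover have "word_weight n i w = 0" if "T w \<noteq> 0" "i < n" for w i
  proof -
    have "w \<in> tensor_words (2 * n) 2" using that(1) by (auto simp: T_def split: if_splits)
    then obtain a b where ab: "w = [a, b]" "a < 2 * n" "b < 2 * n" using two by blast
    then have "b = opp n a" using that(1) T2 by (auto split: if_splits)
    then show ?thesis using ab that(2) by (simp add: word_weight_def letter_weight_opp)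
  qed
  moreover have "deriv_action (2 * n) x T w = 0"
    if x: "x \<in> lie_alg t n" and w: "w \<in> tensor_words (2 * n) 2" for x w
  proof -
    obtain a b where ab: "w = [a, b]" "a < 2 * n" "b < 2 * n" using two[OF w] by blast
    have "(\<Sum>j<2 * n. x $$ (a, j) * T [j, b]) = (\<Sum>j<2 * n. if j = opp n b then x $$ (a, opp n b) * eps t n (opp n b) else 0)"
      using ab by (intro sum.cong) (auto simp: T2)
    also have "\<dots> = x $$ (a, opp n b) * eps t n (opp n b)" using ab by simp
    finally have 1: "(\<Sum>j<2 * n. x $$ (a, j) * T [j, b]) = x $$ (a, opp n b) * eps t n (opp n b)" .
    have "(\<Sum>j<2 * n. x $$ (b, j) * T [a, j]) = (\<Sum>j<2 * n. if j = opp n a then x $$ (b, opp n a) * eps t n a else 0)"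
      using ab by (intro sum.cong) (auto simp: T2)
    also have "\<dots> = x $$ (b, opp n a) * eps t n a" using ab by simp
    finally have 2: "(\<Sum>j<2 * n. x $$ (b, j) * T [a, j]) = x $$ (b, opp n a) * eps t n a" .
    have "opp n a < 2 * n" using ab by simp
    then have e: "x $$ (b, opp n a) = - eps t n b * eps t n (opp n a) * x $$ (opp n (opp n a), opp n b)"
      using x ab unfolding lie_alg_iff by blast
    have "x $$ (b, opp n a) = - eps t n b * eps t n (opp n a) * x $$ (a, opp n b)"
      using e ab by simp
    moreover have e': "eps t n b * eps t n (opp n a) * eps t n a = eps t n (opp n b)"
      using ab by (cases t) (auto simp: eps_def opp_def)
    ultimately have "x $$ (b, opp n a) * eps t n a = - (x $$ (a, opp n b) * eps t n (opp n b))"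
      unfolding e'[symmetric] by simp
    then show ?thesis unfolding ab(1) by (simp add: 1 2)
  qed
  ultimately have "maximal_tensor 2 (\<lambda>i. 0) T"
    unfolding maximal_tensor_def using TV root_mat_lie_alg by (auto simp: fun_eq_iff)
  then show ?thesis by blast
qed

text \<open>\<open>up\<close> makes the span of \<open>B\<close> stable under raising matrices:
  these move a letter only to a higher one, and in type D never to its opposite.\<close>

lemma maximal_tensor_wedge:
  assumes B: "distinct B" "set B \<subseteq> {..<2 * n}"
    and up: "\<And>a b. a < 2 * n \<Longrightarrow> b \<in> set B \<Longrightarrow> height n b < height n a \<Longrightarrow>
      \<not> (t = TypeD \<and> a = opp n b) \<Longrightarrow> a \<in> set B"
  shows "maximal_tensor (length B) (\<lambda>i. \<Sum>p\<in>set B. letter_weight n i p) (wedge B)"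
  unfolding maximal_tensor_def
proof (intro conjI allI impI ballI)
  show "wedge B \<in> carrier (tensor_space (2 * n) (length B))"
    unfolding tensor_space_carrier
  proof (intro allI impI)
    fix w assume "w \<notin> tensor_words (2 * n) (length B)"
    then show "wedge B w = 0"
      using wedge_support[OF B(1), of w] B(2) by (cases "wedge B w = 0") (auto simp: tensor_words_def)
  qed
  show "wedge B \<noteq> (\<lambda>w. 0)"
  proof
    assume "wedge B = (\<lambda>w. 0)"
    then have "wedge B B = 0" by (rule fun_cong)
    then show False using wedge_self[OF B(1)] by simp
  qed
  show "word_weight n i w = (\<Sum>p\<in>set B. letter_weight n i p)" if "wedge B w \<noteq> 0" "i < n" for w i
    using wedge_support[OF B(1) that(1)]
    by (simp add: word_weight_def sum_list_distinct_conv_sum_set)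
  fix p q w assume pq: "p < 2 * n" "q < 2 * n" "height n q < height n p"
    and w: "w \<in> tensor_words (2 * n) (length B)"
  show "deriv_action (2 * n) (root_mat t n p q) (wedge B) w = 0"
  proof (rule wedge_action[OF B w])
    fix a b assume a: "a < 2 * n" and b: "b \<in> set B" and nz: "root_mat t n p q $$ (a, b) \<noteq> 0"
    have b': "b < 2 * n" using b B(2) by auto
    have h: "height n b < height n a"
      using nz a b' pq by (auto simp: root_mat_entry height_opp split: if_splits)
    moreover have "\<not> (t = TypeD \<and> a = opp n b)"
    proof
      \<comment> \<open>The defining relation equates this entry with its own negative.\<close>
      assume D: "t = TypeD \<and> a = opp n b"
      have "root_mat t n p q $$ (a, b)
          = - eps t n a * eps t n b * root_mat t n p q $$ (opp n b, opp n a)"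
        using root_mat_lie_alg[OF pq(1,2), of t] a b' unfolding lie_alg_iff by blast
      moreover have "opp n b = a" "opp n a = b" "eps t n a = 1" "eps t n b = 1"
        using D b' by (auto simp: eps_def)
      ultimately show False using nz by simp
    qed
    ultimately show "a \<in> set B \<and> a \<noteq> b" using up[OF a b] by auto
  qed
qed

text \<open>The first \<open>K\<close> letters are those of greatest height, so the set is closed
  upwards.\<close>

lemma maximal_tensor_column:
  assumes K: "K \<le> n"
  shows "\<exists>T. maximal_tensor K (\<lambda>i. if i < K then 1 else 0) T"
proof -
  have "maximal_tensor (length [0..<K]) (\<lambda>i. \<Sum>p\<in>set [0..<K]. letter_weight n i p) (wedge [0..<K])"
    using K by (intro maximal_tensor_wedge) (auto simp: height_eq split: if_splits)
  moreover have "(\<Sum>p\<in>set [0..<K]. letter_weight n i p) = (if i < K then 1 else 0)" if "i < n" for i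
  proof -
    have "(\<Sum>p\<in>set [0..<K]. letter_weight n i p) = (\<Sum>p\<in>{0..<K}. if p = i then 1 else 0)"
      using K that by (intro sum.cong) (auto simp: letter_weight_def)
    then show ?thesis by simp
  qed
  ultimately have "maximal_tensor K (\<lambda>i. if i < K then 1 else 0) (wedge [0..<K])"
    by (simp add: maximal_tensor_def)
  then show ?thesis by blast
qed

text \<open>The last exterior power splits in type D; this is the other half of it.\<close>

lemma maximal_tensor_column_D:
  assumes t: "t = TypeD"
  shows "\<exists>T. maximal_tensor n (\<lambda>i. if i < n - 1 then 1 else - 1) T"
proof -
  \<comment> \<open>The letter n - 1 gives way to its opposite. These two are neighbours in height,
    and no matrix of type D maps one to the other.\<close>
  let ?B = "[0..<n - 1] @ [2 * n - 1]"
  have n: "n \<ge> 3" using valid t by simp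
  have "maximal_tensor (length ?B) (\<lambda>i. \<Sum>p\<in>set ?B. letter_weight n i p) (wedge ?B)"
  proof (rule maximal_tensor_wedge)
    show "distinct ?B" "set ?B \<subseteq> {..<2 * n}" using n by auto
    fix a b assume a: "a < 2 * n" "b \<in> set ?B" "height n b < height n a" "\<not> (t = TypeD \<and> a = opp n b)"
    from a(2) consider "b < n - 1" | "b = 2 * n - 1" by auto
    then show "a \<in> set ?B"
    proof cases
      case 1
      then show ?thesis using a(1,3) by (auto simp: height_eq split: if_splits)
    next
      case 2
      have hb: "height n b = - 1" using 2 n by (simp add: height_eq)
      have "opp n b = n - 1" using 2 n by (auto simp: opp_def)
      then have "a \<noteq> n - 1" using a(4) t by auto
      moreover have "a < n" using a(1,3) hb by (auto simp: height_eq split: if_splits)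
      ultimately show ?thesis by auto
    qed
  qed
  moreover have "(\<Sum>p\<in>set ?B. letter_weight n i p) = (if i < n - 1 then 1 else - 1)" if "i < n" for i
  proof -
    have "(\<Sum>p\<in>set ?B. letter_weight n i p) = letter_weight n i (2 * n - 1) + (\<Sum>p\<in>{0..<n - 1}. letter_weight n i p)"
    proof -
      have "set ?B = insert (2 * n - 1) {0..<n - 1}" by auto
      then show ?thesis using n by (simp only:) (rule sum.insert, auto)
    qed
    also have "(\<Sum>p\<in>{0..<n - 1}. letter_weight n i p) = (\<Sum>p\<in>{0..<n - 1}. if p = i then 1 else 0)"
      using that by (intro sum.cong) (auto simp: letter_weight_def)
    also have "\<dots> = (if i < n - 1 then 1 else 0)" by simp
    also have "letter_weight n i (2 * n - 1) = (if i < n - 1 then 0 else - 1)"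
      using that n by (auto simp: letter_weight_def)
    finally show ?thesis by auto
  qed
  moreover have "length ?B = n" using n by simp
  ultimately have "maximal_tensor n (\<lambda>i. if i < n - 1 then 1 else - 1) (wedge ?B)"
    by (simp add: maximal_tensor_def)
  then show ?thesis by blast
qed

section \<open>Splitting a dominant weight into columns\<close>

definition dominant_int :: "(nat \<Rightarrow> int) \<Rightarrow> bool" where
  "dominant_int c \<longleftrightarrow> (\<forall>i. Suc i < n \<longrightarrow> c (Suc i) \<le> c i) \<and>
     (case t of TypeC \<Rightarrow> 0 \<le> c (n - 1) | TypeD \<Rightarrow> 0 \<le> c (n - 2) + c (n - 1))"

text \<open>For a dominant integral weight, this is the least tensor degree in which it
  occurs.\<close>

abbreviation weight_size :: "(nat \<Rightarrow> int) \<Rightarrow> int" where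
  "weight_size c \<equiv> \<Sum>i<n. \<bar>c i\<bar>"

lemma dominant_int_antimono:
  assumes "dominant_int c" "i \<le> j" "j < n"
  shows "c j \<le> c i"
  using assms(2,3)
proof (induction j rule: dec_induct)
  case (step j)
  then have "c (Suc j) \<le> c j" using assms(1) by (simp add: dominant_int_def)
  then show ?case using step by simp
qed simp

text \<open>All nonzero coordinates move one step towards 0, so the size drops by their number
  \<open>K\<close>, which is also the degree of the tensor. A negative last coordinate calls for the
  second half of the top exterior power in type D.\<close>

lemma remove_column:
  assumes c: "dominant_int c" and pos: "weight_size c > 0"
  obtains K d T where "K > 0" "maximal_tensor K d T" "dominant_int (\<lambda>i. c i - d i)"
    "weight_size (\<lambda>i. c i - d i) = weight_size c - int K"
proof (cases "c (n - 1) < 0")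
  case True
  then have t: "t = TypeD" using c unfolding dominant_int_def by (cases t) auto
  then have n: "n \<ge> 3" using valid by simp
  \<comment> \<open>Dominance bounds c (n - 2) below by the negative of the last coordinate, so all
    n coordinates are nonzero.\<close>
  have last: "c (n - 2) \<ge> 1" using c True t unfolding dominant_int_def by auto
  have ge: "c i \<ge> 1" if "i < n - 1" for i
  proof -
    have "i \<le> n - 2" using that by arith
    then show ?thesis using dominant_int_antimono[OF c, of i "n - 2"] last n by simp
  qed
  let ?d = "\<lambda>i. if i < n - 1 then 1 else - 1 :: int"
  obtain T where T: "maximal_tensor n ?d T" using maximal_tensor_column_D[OF t] by blast
  have "dominant_int (\<lambda>i. c i - ?d i)"
    unfolding dominant_int_def
  proof (intro conjI allI impI)
    fix i assume i: "Suc i < n"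
    show "c (Suc i) - ?d (Suc i) \<le> c i - ?d i"
    proof (cases "Suc i < n - 1")
      case True
      then show ?thesis using c i by (auto simp: dominant_int_def)
    next
      case False
      then have "Suc i = n - 1" using i by simp
      then show ?thesis using ge[of i] True by auto
    qed
  next
    show "case t of TypeC \<Rightarrow> 0 \<le> c (n - 1) - ?d (n - 1)
        | TypeD \<Rightarrow> 0 \<le> c (n - 2) - ?d (n - 2) + (c (n - 1) - ?d (n - 1))"
      using c t n unfolding dominant_int_def by auto
  qed
  moreover have "weight_size (\<lambda>i. c i - ?d i) = (\<Sum>i<n. \<bar>c i\<bar> - 1)"
  proof (rule sum.cong[OF refl])
    fix i assume "i \<in> {..<n}"
    then have "i < n - 1 \<or> i = n - 1" by auto
    then show "\<bar>c i - ?d i\<bar> = \<bar>c i\<bar> - 1" using ge[of i] True by auto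
  qed
  ultimately show ?thesis using that[OF n_pos T] by (simp add: sum_subtractf)
next
  case False
  then have nonneg: "c i \<ge> 0" if "i < n" for i
  proof -
    have "i \<le> n - 1" using that by simp
    then show ?thesis using dominant_int_antimono[OF c, of i "n - 1"] False n_pos by simp
  qed
  \<comment> \<open>The number of nonzero coordinates; since \<open>c\<close> is decreasing and
    nonnegative, they come first. It is the length of the first column of the partition
    \<open>c\<close>.\<close>
  define K where "K = (LEAST k. k = n \<or> c k = 0)"
  have K: "K = n \<or> c K = 0" unfolding K_def by (rule LeastI[of _ n]) simp
  have Kn: "K \<le> n" unfolding K_def by (rule Least_le) simp
  have lt: "c i \<ge> 1" if "i < K" for i
    using not_less_Least[OF that[unfolded K_def]] nonneg[of i] that Kn by simp
  have ge: "c i = 0" if "K \<le> i" "i < n" for i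
    using dominant_int_antimono[OF c that] K nonneg[OF that(2)] that by auto
  have "K > 0"
  proof (rule ccontr)
    assume "\<not> K > 0"
    then have "weight_size c = 0" using ge by simp
    then show False using pos by simp
  qed
  let ?d = "\<lambda>i. if i < K then 1 else 0 :: int"
  obtain T where T: "maximal_tensor K ?d T" using maximal_tensor_column[OF Kn] by blast
  have nonneg': "c i - ?d i \<ge> 0" if "i < n" for i using lt[of i] nonneg[OF that] by simp
  have "dominant_int (\<lambda>i. c i - ?d i)"
    unfolding dominant_int_def
  proof (intro conjI allI impI)
    fix i assume i: "Suc i < n"
    show "c (Suc i) - ?d (Suc i) \<le> c i - ?d i"
    proof (cases "Suc i < K")
      case True
      then show ?thesis using c i by (auto simp: dominant_int_def)
    next
      case False
      then show ?thesis using ge[of "Suc i"] i nonneg'[of i] by simp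
    qed
  next
    show "case t of TypeC \<Rightarrow> 0 \<le> c (n - 1) - ?d (n - 1)
        | TypeD \<Rightarrow> 0 \<le> c (n - 2) - ?d (n - 2) + (c (n - 1) - ?d (n - 1))"
      using nonneg'[of "n - 1"] nonneg'[of "n - 2"] n_pos by (cases t) auto
  qed
  moreover have "weight_size (\<lambda>i. c i - ?d i) = (\<Sum>i<n. \<bar>c i\<bar> - ?d i)"
  proof (rule sum.cong[OF refl])
    fix i show "\<bar>c i - ?d i\<bar> = \<bar>c i\<bar> - ?d i" using lt[of i] by (cases "i < K") auto
  qed
  moreover have "(\<Sum>i<n. ?d i) = int K"
  proof -
    have "{..<n} \<inter> {i. i < K} = {..<K}" using Kn by auto
    then show ?thesis by (simp add: sum.If_cases)
  qed
  ultimately show ?thesis using that[OF \<open>K > 0\<close> T] by (simp add: sum_subtractf)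
qed

text \<open>Induction on the degree, strong because a column uses up several degrees at
  once.\<close>

lemma maximal_tensor_of_weight:
  assumes "dominant_int c" "weight_size c \<le> int r" "even (int r - weight_size c)"
  shows "\<exists>T. maximal_tensor r c T"
  using assms
proof (induction r arbitrary: c rule: less_induct)
  case (less r)
  \<comment> \<open>Weights are functions on all naturals but constrained below \<open>n\<close>
    only, so the zero weight may be replaced by a \<open>c\<close> that vanishes there.\<close>
  have cong: "maximal_tensor r c T" if "maximal_tensor r d T" "\<And>i. i < n \<Longrightarrow> d i = c i" for d T
    using that by (simp add: maximal_tensor_def)
  have nonneg: "weight_size c \<ge> 0" by (simp add: sum_nonneg)
  consider "weight_size c < int r" | "weight_size c = int r" "r > 0" | "weight_size c = int r" "r = 0"
    using less.prems(2) by linarith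
  then show ?case
  proof cases
    case 1
    \<comment> \<open>The parity condition leaves room for at least two more degrees, exactly what
      one copy of the form occupies.\<close>
    have "int r - weight_size c \<noteq> 1" using less.prems(3) by (metis odd_one)
    then have "weight_size c + 2 \<le> int r" using 1 by linarith
    then have r: "weight_size c \<le> int (r - 2)" "r \<ge> 2" using nonneg by linarith+
    have "even (int (r - 2) - weight_size c)" using less.prems(3) r(2) by (simp add: of_nat_diff)
    then obtain T where T: "maximal_tensor (r - 2) c T"
      using less.IH[of "r - 2" c] r less.prems(1) by auto
    obtain \<theta> where "maximal_tensor 2 (\<lambda>i. 0) \<theta>" using maximal_tensor_form by blast
    moreover have "2 + (r - 2) = r" using r(2) by simp
    ultimately show ?thesis using maximal_tensor_concat[OF _ T, of 2 "\<lambda>i. 0" \<theta>] by simp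
  next
    case 2
    obtain K d T where K: "K > 0" "maximal_tensor K d T" "dominant_int (\<lambda>i. c i - d i)"
      "weight_size (\<lambda>i. c i - d i) = weight_size c - int K"
      using remove_column[OF less.prems(1)] 2 by auto
    have "0 \<le> weight_size (\<lambda>i. c i - d i)" by (simp add: sum_nonneg)
    then have Kr: "K \<le> r" using K(4) 2 by simp
    obtain S where S: "maximal_tensor (r - K) (\<lambda>i. c i - d i) S"
      using less.IH[of "r - K" "\<lambda>i. c i - d i"] K Kr 2 by (auto simp: of_nat_diff)
    from maximal_tensor_concat[OF K(2) S] show ?thesis using Kr by simp
  next
    case 3
    then have "c i = 0" if "i < n" for i using that by (simp add: sum_nonneg_eq_0_iff)
    then show ?thesis using cong[OF maximal_tensor_empty[folded 3(2)]] 3(2) by auto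
  qed
qed


section \<open>The dominant weights of tensor powers\<close>

text \<open>A letter has a single nonzero coordinate, equal to 1 or -1: it adds at most 1 to the
  size and flips the parity of the coordinate sum.\<close>

lemma word_weight_size:
  assumes "w \<in> tensor_words (2 * n) r"
  shows "weight_size (\<lambda>i. word_weight n i w) \<le> int r" "even (int r - (\<Sum>i<n. word_weight n i w))"
proof -
  have letter: "(\<Sum>i<n. \<bar>letter_weight n i p\<bar>) = 1" "odd (\<Sum>i<n. letter_weight n i p)" if p: "p < 2 * n" for p
  proof -
    let ?k = "if p < n then p else p - n"
    have k: "?k < n" using p by (split if_split) arith
    have "(\<Sum>i<n. \<bar>letter_weight n i p\<bar>) = (\<Sum>i<n. if i = ?k then 1 else 0)"
      using p by (intro sum.cong) (auto simp: letter_weight_def)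
    then show "(\<Sum>i<n. \<bar>letter_weight n i p\<bar>) = 1" using k by simp
    have "(\<Sum>i<n. letter_weight n i p) = (\<Sum>i<n. if i = ?k then (if p < n then 1 else - 1) else 0)"
      using p by (intro sum.cong) (auto simp: letter_weight_def)
    then show "odd (\<Sum>i<n. letter_weight n i p)" using k by simp
  qed
  have "weight_size (\<lambda>i. word_weight n i w) \<le> int r \<and> even (int r - (\<Sum>i<n. word_weight n i w))"
    using assms
  proof (induction w arbitrary: r)
    case Nil
    then show ?case by (simp add: word_weight_def)
  next
    case (Cons p w)
    have IH: "weight_size (\<lambda>i. word_weight n i w) \<le> int (length w)"
      "even (int (length w) - (\<Sum>i<n. word_weight n i w))"
      using Cons.IH[of "length w"] Cons.prems by auto
    have ww: "word_weight n i (p # w) = letter_weight n i p + word_weight n i w" for i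
      by (simp add: word_weight_def)
    have "weight_size (\<lambda>i. word_weight n i (p # w)) \<le> (\<Sum>i<n. \<bar>letter_weight n i p\<bar> + \<bar>word_weight n i w\<bar>)"
      unfolding ww by (intro sum_mono abs_triangle_ineq)
    then have 1: "weight_size (\<lambda>i. word_weight n i (p # w)) \<le> int r"
      using IH(1) letter(1)[of p] Cons.prems by (simp add: sum.distrib)
    have "even (int r - (\<Sum>i<n. word_weight n i (p # w)))"
      using IH(2) letter(2)[of p] Cons.prems unfolding ww sum.distrib by auto
    with 1 show ?case by blast
  qed
  then show "weight_size (\<lambda>i. word_weight n i w) \<le> int r" "even (int r - (\<Sum>i<n. word_weight n i w))"
    by auto
qed

lemma even_sum_abs: "even ((\<Sum>i<n. \<bar>c i\<bar>) - (\<Sum>i<n. c i :: int))"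
  unfolding sum_subtractf[symmetric] by (intro dvd_sum) auto

lemma dominant_int_iff:
  "vec n (\<lambda>i. of_int (c i)) \<in> dominant_weights t n \<longleftrightarrow> dominant_int c"
proof -
  have nat: "rat_of_int z \<in> \<nat> \<longleftrightarrow> z \<ge> 0" for z
  proof
    assume "rat_of_int z \<in> \<nat>"
    then obtain k where "rat_of_int z = of_nat k" by (auto elim: Nats_cases)
    then show "z \<ge> 0" by (metis of_int_0_le_iff of_nat_0_le_iff)
  next
    assume "z \<ge> 0"
    then show "rat_of_int z \<in> \<nat>" by (metis of_nat_in_Nats of_int_of_nat_eq zero_le_imp_eq_int)
  qed
  have nat': "rat_of_int a - of_int b \<in> \<nat> \<longleftrightarrow> b \<le> a" "rat_of_int a + of_int b \<in> \<nat> \<longleftrightarrow> 0 \<le> a + b" for a b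
    using nat[of "a - b"] nat[of "a + b"] by simp_all
  have idx: "i < n \<Longrightarrow> vec n (\<lambda>i. rat_of_int (c i)) $ i = of_int (c i)" for i by simp
  have "(\<forall>i. Suc i < n \<longrightarrow> vec n (\<lambda>i. rat_of_int (c i)) $ i - vec n (\<lambda>i. rat_of_int (c i)) $ Suc i \<in> \<nat>)
      \<longleftrightarrow> (\<forall>i. Suc i < n \<longrightarrow> c (Suc i) \<le> c i)"
    by (auto simp: nat')
  moreover have "(case t of TypeC \<Rightarrow> vec n (\<lambda>i. rat_of_int (c i)) $ (n - 1) \<in> \<nat>
        | TypeD \<Rightarrow> vec n (\<lambda>i. rat_of_int (c i)) $ (n - 2) + vec n (\<lambda>i. rat_of_int (c i)) $ (n - 1) \<in> \<nat>)
      \<longleftrightarrow> (case t of TypeC \<Rightarrow> 0 \<le> c (n - 1) | TypeD \<Rightarrow> 0 \<le> c (n - 2) + c (n - 1))"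
    using idx[of "n - 1"] idx[of "n - 2"] n_pos by (cases t) (simp_all add: nat nat')
  ultimately show ?thesis
    by (subst dominant_weights_iff) (simp_all add: dominant_int_def)
qed

text \<open>One direction reads the weight off a word in the support, the other uses a maximal
  tensor. Together they show that each dominant weight occurring at all is the weight of a maximal
  vector, as the inclusion of the kernel in the ideal requires.\<close>

lemma tensor_dominant_weights_iff:
  "\<nu> \<in> tensor_dominant_weights t n r \<longleftrightarrow>
    (\<exists>c. \<nu> = vec n (\<lambda>i. of_int (c i)) \<and> dominant_int c \<and> weight_size c \<le> int r \<and>
      even (int r - weight_size c))"
proof
  assume \<nu>: "\<nu> \<in> tensor_dominant_weights t n r"
  then obtain T where T: "T \<in> carrier (tensor_space (2 * n) r)" "T \<noteq> (\<lambda>w. 0)"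
    "\<And>i. i < n \<Longrightarrow> tensor_action (2 * n) r (cartan n i) T = (\<lambda>w. \<nu> $ i * T w)"
    by (auto simp: tensor_dominant_weights_def)
  obtain w where w: "T w \<noteq> 0" using T(2) by auto
  have ww: "w \<in> tensor_words (2 * n) r" using T(1) w by (auto simp: tensor_space_carrier)
  let ?c = "\<lambda>i. word_weight n i w"
  have dom: "\<nu> \<in> dominant_weights t n" using \<nu> by (simp add: tensor_dominant_weights_def)
  have eq: "\<nu> = vec n (\<lambda>i. of_int (?c i))"
  proof (rule eq_vecI)
    fix i assume "i < dim_vec (vec n (\<lambda>i. rat_of_int (?c i)))"
    then have i: "i < n" by simp
    show "\<nu> $ i = vec n (\<lambda>i. of_int (?c i)) $ i"
      using T(3)[OF i] w i unfolding tensor_weight_iff[OF T(1)] by simp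
  qed (use dom in \<open>simp add: dominant_weights_def\<close>)
  have "dominant_int ?c" using dom unfolding eq dominant_int_iff .
  moreover have "even (int r - weight_size ?c)"
    using word_weight_size(2)[OF ww] even_sum_abs[of ?c] by auto
  ultimately show "\<exists>c. \<nu> = vec n (\<lambda>i. of_int (c i)) \<and> dominant_int c \<and> weight_size c \<le> int r \<and>
      even (int r - weight_size c)"
    using eq word_weight_size(1)[OF ww] by (intro exI[of _ ?c] conjI)
next
  assume "\<exists>c. \<nu> = vec n (\<lambda>i. of_int (c i)) \<and> dominant_int c \<and> weight_size c \<le> int r \<and>
      even (int r - weight_size c)"
  then obtain c where c: "\<nu> = vec n (\<lambda>i. of_int (c i))" "dominant_int c" "weight_size c \<le> int r"
    "even (int r - weight_size c)" by blast
  obtain T where T: "maximal_tensor r c T" using maximal_tensor_of_weight[OF c(2-4)] by blast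
  have TV: "T \<in> carrier (tensor_space (2 * n) r)" using T by (simp add: maximal_tensor_def)
  have "tensor_action (2 * n) r (cartan n i) T = (\<lambda>w. \<nu> $ i * T w)" if "i < n" for i
    unfolding tensor_weight_iff[OF TV] using T that by (auto simp: maximal_tensor_def c(1))
  moreover have "\<nu> \<in> dominant_weights t n" unfolding c(1) dominant_int_iff by (rule c(2))
  ultimately show "\<nu> \<in> tensor_dominant_weights t n r"
    using T unfolding tensor_dominant_weights_def maximal_tensor_def by auto
qed

lemma finite_tensor_dominant_weights: "finite (tensor_dominant_weights t n r)"
proof -
  have "tensor_dominant_weights t n r
      \<subseteq> (\<lambda>f. vec n (\<lambda>i. of_int (f i))) ` ({..<n} \<rightarrow>\<^sub>E {- int r..int r})"
  proof
    fix \<nu> assume "\<nu> \<in> tensor_dominant_weights t n r"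
    then obtain c where c: "\<nu> = vec n (\<lambda>i. of_int (c i))" "weight_size c \<le> int r"
      unfolding tensor_dominant_weights_iff by blast
    have "c i \<in> {- int r..int r}" if "i < n" for i
    proof -
      have "\<bar>c i\<bar> \<le> weight_size c" using that by (intro member_le_sum) auto
      then show ?thesis using c(2) by auto
    qed
    then have "restrict c {..<n} \<in> {..<n} \<rightarrow>\<^sub>E {- int r..int r}" by auto
    moreover have "\<nu> = vec n (\<lambda>i. of_int (restrict c {..<n} i))" unfolding c(1) by auto
    ultimately show "\<nu> \<in> (\<lambda>f. vec n (\<lambda>i. of_int (f i))) ` ({..<n} \<rightarrow>\<^sub>E {- int r..int r})" by blast
  qed
  then show ?thesis by (rule finite_subset) (intro finite_imageI finite_PiE; simp)
qed

text \<open>Two functionals are evaluated on the difference of the weights. The coordinate sum is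
  even on simple roots, which preserves parity. The sign vector of the smaller weight is nonnegative
  on simple roots, which bounds the size.\<close>

lemma saturated_tensor_dominant_weights: "saturated t n (tensor_dominant_weights t n r)"
  unfolding saturated_def
proof (intro conjI ballI impI)
  show "tensor_dominant_weights t n r \<subseteq> dominant_weights t n"
    by (auto simp: tensor_dominant_weights_def)
  fix \<nu> \<mu> assume \<nu>: "\<nu> \<in> tensor_dominant_weights t n r" and \<mu>: "\<mu> \<in> dominant_weights t n"
    and le: "dom_le t n \<mu> \<nu>"
  obtain c where c: "\<nu> = vec n (\<lambda>i. of_int (c i))" "dominant_int c" "weight_size c \<le> int r"
    "even (int r - weight_size c)" using \<nu> unfolding tensor_dominant_weights_iff by blast
  have \<mu>n: "\<mu> \<in> carrier_vec n" using \<mu> by (simp add: dominant_weights_def)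
  have "root_cone t n (\<lambda>j. \<nu> $ j - \<mu> $ j)"
    using le c(1) \<mu>n by (subst dom_le_iff_root_cone[symmetric]) auto
  then obtain m where "\<forall>j<n. \<nu> $ j - \<mu> $ j = (\<Sum>i<n. of_nat (m i) * simple_root t n i $ j)"
    unfolding root_cone_def by blast
  then have m: "\<And>j. j < n \<Longrightarrow> \<nu> $ j - \<mu> $ j = (\<Sum>i<n. of_nat (m i) * simple_root t n i $ j)" by blast
  have sr: "simple_root t n i $ j \<in> \<int>" if "i < n" "j < n" for i j
  proof -
    have u: "unit_fun p j \<in> \<int>" for p by (simp add: unit_fun_def)
    show ?thesis
    proof (cases "Suc i < n")
      case True
      then show ?thesis using that u by (simp add: simple_root_entry(1))
    next
      case False
      then have "i = n - Suc 0" using that by simp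
      then show ?thesis using that u by (cases t) (simp_all add: simple_root_entry(2,3))
    qed
  qed
  \<comment> \<open>In type D a dominant weight may have half-integral coordinates. Differing from
    the integral \<open>\<nu>\<close> by integral simple roots forces \<open>\<mu>\<close> to be
    integral, so rounding changes nothing.\<close>
  define d where "d j = \<lfloor>\<mu> $ j\<rfloor>" for j
  have d: "\<mu> $ j = of_int (d j)" if j: "j < n" for j
  proof -
    have "\<mu> $ j = of_int (c j) - (\<Sum>i<n. of_nat (m i) * simple_root t n i $ j)"
      using m[OF j] j by (simp add: c(1))
    also have "\<dots> \<in> \<int>" using sr j by (intro Ints_diff Ints_sum Ints_mult) auto
    finally show ?thesis unfolding d_def by simp
  qed
  have \<mu>eq: "\<mu> = vec n (\<lambda>i. of_int (d i))" using \<mu>n d by (intro eq_vecI) auto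
  have dom: "dominant_int d" using \<mu> unfolding \<mu>eq dominant_int_iff .
  have functional: "(\<Sum>j<n. k j * (c j - d j)) = (\<Sum>i<n - 1. int (m i) * (k i - k (Suc i)))
      + int (m (n - 1)) * (case t of TypeC \<Rightarrow> 2 * k (n - 1) | TypeD \<Rightarrow> k (n - 2) + k (n - 1))" for k :: "nat \<Rightarrow> int"
  proof -
    let ?k = "\<lambda>j. rat_of_int (k j)"
    have "rat_of_int (\<Sum>j<n. k j * (c j - d j)) = (\<Sum>j<n. ?k j * (\<nu> $ j - \<mu> $ j))"
      by (simp add: c(1) d)
    also have "\<dots> = (\<Sum>i<n. of_nat (m i) * (\<Sum>j<n. ?k j * simple_root t n i $ j))"
      by (rule root_cone_functional[OF m])
    \<comment> \<open>Splits off the last simple root, whose shape depends on the type. The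
      substitution also hits the inner sums and is then reversed there.\<close>
    also have "{..<n} = insert (n - 1) {..<n - 1}" using n_pos by auto
    also have "(\<Sum>i\<in>insert (n - 1) {..<n - 1}. of_nat (m i) * (\<Sum>j\<in>insert (n - 1) {..<n - 1}. ?k j * simple_root t n i $ j))
        = of_nat (m (n - 1)) * (\<Sum>j\<in>insert (n - 1) {..<n - 1}. ?k j * simple_root t n (n - 1) $ j)
          + (\<Sum>i<n - 1. of_nat (m i) * (\<Sum>j\<in>insert (n - 1) {..<n - 1}. ?k j * simple_root t n i $ j))"
      by (rule sum.insert) auto
    also have "insert (n - 1) {..<n - 1} = {..<n}" using n_pos by auto
    also have "(\<Sum>i<n - 1. of_nat (m i) * (\<Sum>j<n. ?k j * simple_root t n i $ j))
        = (\<Sum>i<n - 1. of_nat (m i) * (?k i - ?k (Suc i)))"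
      by (intro sum.cong) (auto simp: simple_root_functional(1))
    also have "(\<Sum>j<n. ?k j * simple_root t n (n - 1) $ j)
        = (case t of TypeC \<Rightarrow> 2 * ?k (n - 1) | TypeD \<Rightarrow> ?k (n - 2) + ?k (n - 1))"
      using n_pos by (intro simple_root_functional(2)) auto
    finally have "rat_of_int (\<Sum>j<n. k j * (c j - d j)) = of_int ((\<Sum>i<n - 1. int (m i) * (k i - k (Suc i)))
      + int (m (n - 1)) * (case t of TypeC \<Rightarrow> 2 * k (n - 1) | TypeD \<Rightarrow> k (n - 2) + k (n - 1)))"
      by (simp split: lie_type.split)
    then show ?thesis by (simp only: of_int_eq_iff)
  qed
  \<comment> \<open>The coordinate sum of a simple root is 0 or 2.\<close>
  have "even ((\<Sum>j<n. c j) - (\<Sum>j<n. d j))"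
    using functional[of "\<lambda>j. 1"] by (simp add: sum_subtractf split: lie_type.splits)
  then have "even (int r - weight_size d)"
    using c(4) even_sum_abs[of c] even_sum_abs[of d] by presburger
  moreover have "weight_size d \<le> weight_size c"
  proof -
    \<comment> \<open>The signs of \<open>d\<close>: in a dominant weight only the last coordinate
      can be negative. So \<open>s\<close> paired with \<open>d\<close> gives the size of
      \<open>d\<close>, while paired with \<open>c\<close> it gives at most the size of
      \<open>c\<close>.\<close>
    define s :: "nat \<Rightarrow> int" where "s j = (if j = n - 1 \<and> d (n - 1) < 0 then - 1 else 1)" for j
    have "\<bar>d j\<bar> = s j * d j" if "j < n" for j
    proof (cases "d (n - 1) < 0")
      case True
      then have t: "t = TypeD" using dom unfolding dominant_int_def by (cases t) auto
      have t2: "0 \<le> d (n - 2)" using dom True t unfolding dominant_int_def by auto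
      have "0 \<le> d j" if "j \<noteq> n - 1"
      proof -
        have "j \<le> n - 2" using that \<open>j < n\<close> by arith
        then show ?thesis using dominant_int_antimono[OF dom, of j "n - 2"] t2 n_pos by simp
      qed
      then show ?thesis using True by (auto simp: s_def)
    next
      case False
      moreover have "j \<le> n - 1" using that by simp
      ultimately show ?thesis
        using dominant_int_antimono[OF dom, of j "n - 1"] n_pos by (simp add: s_def)
    qed
    then have "weight_size d = (\<Sum>j<n. s j * d j)" by simp
    moreover have "(\<Sum>j<n. s j * c j) \<le> weight_size c" by (intro sum_mono) (auto simp: s_def)
    moreover have "0 \<le> (\<Sum>j<n. s j * (c j - d j))"
    proof -
      have "0 \<le> s i - s (Suc i)" if "i \<in> {..<n - 1}" for i
        using that by (simp add: s_def)
      moreover have "0 \<le> (case t of TypeC \<Rightarrow> 2 * s (n - 1) | TypeD \<Rightarrow> s (n - 2) + s (n - 1))"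
      proof (cases t)
        case TypeC
        then have "0 \<le> d (n - 1)" using dom unfolding dominant_int_def by simp
        then show ?thesis using TypeC by (simp add: s_def)
      next
        case TypeD
        then have "n - 2 \<noteq> n - 1" using valid by simp
        then show ?thesis using TypeD by (simp add: s_def)
      qed
      ultimately show ?thesis
        unfolding functional by (intro add_nonneg_nonneg sum_nonneg mult_nonneg_nonneg[OF of_nat_0_le_iff]) simp
    qed
    ultimately show ?thesis by (simp add: right_diff_distrib sum_subtractf)
  qed
  ultimately show "\<mu> \<in> tensor_dominant_weights t n r"
    unfolding tensor_dominant_weights_iff using \<mu>eq dom c(3) by (intro exI[of _ d]) auto
qed

end

section \<open>The Schur algebra as a generalized Schur algebra\<close>

context classical_tensor
begin

lemma tensor_rep_eq: "tensor_rep t n r = rep"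
  by (rule ext) (simp add: tensor_rep_def)

lemma kernel_iff: "u \<in> a_kernel U A rep \<longleftrightarrow> u \<in> carrier U \<and> (\<forall>T\<in>V. rep u T = (\<lambda>w. 0))"
proof -
  have "rep u = \<zero>\<^bsub>A\<^esub> \<longleftrightarrow> (\<forall>T\<in>V. rep u T = (\<lambda>w. 0))" if u: "u \<in> carrier U"
  proof
    assume "\<forall>T\<in>V. rep u T = (\<lambda>w. 0)"
    then show "rep u = \<zero>\<^bsub>A\<^esub>"
      by (intro tensor_End_eqI[where N = "2 * n" and r = r] rep.hom_closed u tensor_End_closed)
        (simp add: tensor_End_apply)
  qed (simp add: tensor_End_apply)
  then show ?thesis unfolding a_kernel_def' by blast
qed

lemma maximal_tensor_singular:
  assumes "maximal_tensor r c T"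
  shows "singular_vector tensor_module (vec n (\<lambda>i. of_int (c i))) T"
proof (intro conjI allI impI)
  have TV: "T \<in> V" using assms by (simp add: maximal_tensor_def)
  then show "T \<in> carrier tensor_module" by simp
  show "gen (cartan n i) \<odot>\<^bsub>tensor_module\<^esub> T
      = scal (vec n (\<lambda>i. rat_of_int (c i)) $ i) \<odot>\<^bsub>tensor_module\<^esub> T" if i: "i < n" for i
  proof -
    have "\<rho> (cartan n i) T = (\<lambda>w. of_int (c i) * T w)"
      unfolding tensor_weight_iff[OF TV] using assms i by (simp add: maximal_tensor_def)
    then show ?thesis using TV i cartan_lie_alg[OF i, of t] by (simp add: rep_gen rep_scal)
  qed
  fix p q assume pq: "p < 2 * n" "q < 2 * n" "height n q < height n p"
  have "\<rho> (root_mat t n p q) T = (\<lambda>w. 0)"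
    unfolding tensor_action_eq[OF TV] using assms pq by (auto simp: maximal_tensor_def)
  then show "gen (root_mat t n p q) \<odot>\<^bsub>tensor_module\<^esub> T = \<zero>\<^bsub>tensor_module\<^esub>"
    using root_mat_lie_alg[OF pq(1,2), of t] by (simp add: rep_gen)
qed

lemma kernel_le_gen_schur_ideal:
  assumes u: "u \<in> a_kernel U A rep"
  shows "u \<in> gen_schur_ideal TYPE('v) t n (tensor_dominant_weights t n r)"
  unfolding gen_schur_ideal_def
proof (intro CollectI conjI allI impI)
  show uU: "u \<in> carrier U" using u by (simp add: kernel_iff)
  have ann: "annihilates u tensor_module" using u by (simp add: kernel_iff annihilates_def)
  fix M :: "((rat mat list \<Rightarrow> rat) set, 'v) module" and \<nu>
  assume M: "\<nu> \<in> tensor_dominant_weights t n r \<and> simple_module U M \<and> highest_weight_module t n M \<nu>"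
  then obtain c where c: "\<nu> = vec n (\<lambda>i. of_int (c i))" "dominant_int c" "weight_size c \<le> int r"
    "even (int r - weight_size c)" unfolding tensor_dominant_weights_iff by blast
  obtain T where T: "maximal_tensor r c T" using maximal_tensor_of_weight[OF c(2-4)] by blast
  show "annihilates u M"
  proof (rule annihilates_highest_weight_module[OF _ _ left_module_tensor _ _ uU ann])
    show "simple_module U M" "highest_weight_module t n M \<nu>" using M by auto
    show "singular_vector tensor_module \<nu> T" unfolding c(1) by (rule maximal_tensor_singular[OF T])
    show "T \<noteq> \<zero>\<^bsub>tensor_module\<^esub>" using T by (simp add: maximal_tensor_def)
  qed
qed

lemma kernel_eq_gen_schur_ideal:
  assumes "infinite (UNIV :: 'v set)"
  shows "a_kernel U A rep = gen_schur_ideal TYPE('v) t n (tensor_dominant_weights t n r)"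
proof (intro equalityI subsetI)
  show "u \<in> gen_schur_ideal TYPE('v) t n (tensor_dominant_weights t n r)" if "u \<in> a_kernel U A rep" for u
    using that by (rule kernel_le_gen_schur_ideal)
  fix u assume u: "u \<in> gen_schur_ideal TYPE('v) t n (tensor_dominant_weights t n r)"
  then have "u \<in> carrier U" by (simp add: gen_schur_ideal_def)
  then show "u \<in> a_kernel U A rep"
    using gen_schur_ideal_le_kernel[OF assms u] by (simp add: kernel_iff)
qed

end

theorem proposition1p3p3:
  fixes t :: lie_type and n r :: nat and \<pi> :: "rat vec set"
  assumes "r \<ge> 1"
    and "(t = TypeC \<and> n \<ge> 1) \<or> (t = TypeD \<and> n \<ge> 3)"
    and "\<pi> = tensor_dominant_weights t n r"
    and "infinite (UNIV :: 'v set)"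
  shows "finite \<pi> \<and> saturated t n \<pi> \<and>
    a_kernel (env_alg t n) (End_alg (tensor_space (2 * n) r)) (tensor_rep t n r)
      = gen_schur_ideal TYPE('v) t n \<pi> \<and>
    (\<lambda>X. the_elem (tensor_rep t n r ` X))
      \<in> ring_iso (gen_schur_algebra TYPE('v) t n \<pi>) (schur_algebra t n r)"
proof -
  interpret classical_tensor t n r by unfold_locales (rule assms(2))
  note ker = kernel_eq_gen_schur_ideal[OF assms(4), folded assms(3)]
  \<comment> \<open>With the ideal rewritten as the kernel, this is the first isomorphism theorem
    for \<open>rep\<close> and its image.\<close>
  have "(\<lambda>X. the_elem (rep ` X)) \<in> ring_iso (gen_schur_algebra TYPE('v) t n \<pi>) (schur_algebra t n r)"
    unfolding gen_schur_algebra_def schur_algebra_def ker[symmetric] tensor_rep_eq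
    by (rule rep.FactRing_iso_set_aux)
  then show ?thesis
    using finite_tensor_dominant_weights saturated_tensor_dominant_weights ker
    by (simp only: assms(3) tensor_rep_eq)
qed

end
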